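(* Assume $C$ is symmetric, $\gamma$-Lipschitz, and that $k_\varepsilon=e^{-C/\varepsilon}$ is a positive universal kernel. For any $\varepsilon>0$ and any entropy function $\phi$, the Sinkhorn divergence $S_\varepsilon$ is positive ($S_\varepsilon(\alpha,\beta)\ge0$ for all $\alpha,\beta\in\mathcal{M}_+(X)$), definite ($S_\varepsilon(\alpha,\beta)=0$ if and only if $\alpha=\beta$), and convex in $\alpha$ (for fixed $\beta$) and in $\beta$ (for fixed $\alpha$), though it need not be jointly convex.
   Context: $(X,d_X)$ is a compact metric space; $\mathcal{M}_+(X)$ is the set of positive (finite) Radon measures; $m(\alpha)=\int_X d\alpha$. The cost $C:X^2\to\mathbb{R}$ is continuous; $\gamma$-Lipschitz means $\|C(x,\cdot)-C(y,\cdot)\|_\infty\le\gamma d_X(x,y)$. A continuous kernel $k:X^2\to\mathbb{R}$ is positive if $\int k\,d\xi\otimes d\xi\ge0$ for every signed measure $\xi$, and universal if the functions $x\mapsto k(x,y)$, $y\in X$, are dense in the space of continuous functions on $X$ (in the usual sense that their linear span is dense). An entropy function is a convex, lower semicontinuous $\phi\ge 0$ on $[0,\infty)$ (values in $[0,+\infty]$; the value at $0$ is the lower semicontinuous extension) with $\phi(1)=0$, extended by $+\infty$ on $(-\infty,0)$. $D_\phi(\alpha|\beta)=\int\phi(\frac{d\alpha}{d\beta})d\beta+\phi'_\infty\int d\alpha^\perp$, with Lebesgue decomposition $\alpha=\frac{d\alpha}{d\beta}\beta+\alpha^\perp$ and $\phi'_\infty=\lim_{x\to\infty}\phi(x)/x$.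 $\mathrm{KL}(\mu|\nu)=\int\log(\frac{d\mu}{d\nu})d\mu-\int d\mu+\int d\nu$ ($+\infty$ if $\mu\not\ll\nu$). $$\mathrm{OT}_\varepsilon(\alpha,\beta)=\inf_{\pi\in\mathcal{M}_+(X^2)}\int C\,d\pi+D_\phi(\pi_1|\alpha)+D_\phi(\pi_2|\beta)+\varepsilon\mathrm{KL}(\pi|\alpha\otimes\beta)\in(-\infty,+\infty],$$ with $\pi_1,\pi_2$ the marginals of $\pi$. Unbalanced Sinkhorn divergence: $$S_\varepsilon(\alpha,\beta)=\mathrm{OT}_\varepsilon(\alpha,\beta)-\tfrac12\mathrm{OT}_\varepsilon(\alpha,\alpha)-\tfrac12\mathrm{OT}_\varepsilon(\beta,\beta)+\tfrac{\varepsilon}{2}(m(\alpha)-m(\beta))^2.$$ *)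

theory Defs
  imports "HOL-Analysis.Analysis"
begin

text \<open>
  A compact metric space is a compact set \<open>X\<close> in a type of class \<open>metric_space\<close>, with the
  induced metric. Every finite Borel measure on a compact metric space is Radon, so the finite
  Borel measures below are exactly the positive Radon measures.
\<close>

definition Mplus :: "'a::topological_space set \<Rightarrow> 'a measure set" where
  "Mplus X = {\<alpha>. sets \<alpha> = sets (restrict_space borel X) \<and> finite_measure \<alpha>}"

abbreviation mass :: "'a measure \<Rightarrow> real" where
  "mass \<alpha> \<equiv> measure \<alpha> (space \<alpha>)"

text \<open>The measure \<open>t \<alpha> + (1 - t) \<beta>\<close>, for \<open>0 \<le> t \<le> 1\<close> and \<open>\<alpha>\<close>, \<open>\<beta>\<close> with the same measurable sets.\<close>

definition mix :: "real \<Rightarrow> 'a measure \<Rightarrow> 'a measure \<Rightarrow> 'a measure" where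
  "mix t \<alpha> \<beta> = measure_of (space \<alpha>) (sets \<alpha>)
     (\<lambda>A. ennreal t * emeasure \<alpha> A + ennreal (1 - t) * emeasure \<beta> A)"

text \<open>
  A finite signed measure is a difference \<open>\<xi> = \<mu> - \<nu>\<close> of finite positive measures, and
  integration against \<open>\<xi> \<otimes> \<xi>\<close> is expanded bilinearly.
\<close>

definition positive_kernel :: "'a::topological_space set \<Rightarrow> ('a \<Rightarrow> 'a \<Rightarrow> real) \<Rightarrow> bool" where
  "positive_kernel X k \<longleftrightarrow> (\<forall>\<mu>\<in>Mplus X. \<forall>\<nu>\<in>Mplus X.
     0 \<le> (LINT (x, y)|(\<mu> \<Otimes>\<^sub>M \<mu>). k x y) - (LINT (x, y)|(\<mu> \<Otimes>\<^sub>M \<nu>). k x y)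
       - (LINT (x, y)|(\<nu> \<Otimes>\<^sub>M \<mu>). k x y) + (LINT (x, y)|(\<nu> \<Otimes>\<^sub>M \<nu>). k x y))"

definition universal_kernel :: "'a::topological_space set \<Rightarrow> ('a \<Rightarrow> 'a \<Rightarrow> real) \<Rightarrow> bool" where
  "universal_kernel X k \<longleftrightarrow> (\<forall>f. continuous_on X f \<longrightarrow> (\<forall>e>0. \<exists>T c. finite T \<and> T \<subseteq> X \<and>
     (\<forall>x\<in>X. \<bar>f x - (\<Sum>y\<in>T. c y * k x y)\<bar> < e)))"

text \<open>
  Lower semicontinuity and convexity (with \<open>\<phi> 1 = 0\<close>) already force \<open>\<phi> 0\<close> to be the limit of
  \<open>\<phi>\<close> at \<open>0\<close> from the right. In \<open>ennreal\<close>, \<open>0 * \<infinity> = 0\<close>.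
\<close>

definition entropy_function :: "(real \<Rightarrow> ennreal) \<Rightarrow> bool" where
  "entropy_function \<phi> \<longleftrightarrow>
     (\<forall>x y t. 0 \<le> t \<and> t \<le> 1 \<longrightarrow>
        \<phi> (t * x + (1 - t) * y) \<le> ennreal t * \<phi> x + ennreal (1 - t) * \<phi> y) \<and>
     (\<forall>x. \<phi> x \<le> Liminf (at x) \<phi>) \<and>
     \<phi> 1 = 0 \<and>
     (\<forall>x<0. \<phi> x = \<infinity>)"

definition recession :: "(real \<Rightarrow> ennreal) \<Rightarrow> ennreal" where
  "recession \<phi> = Lim at_top (\<lambda>x. \<phi> x / ennreal x)"

text \<open>\<open>\<alpha> = f \<beta> + \<nu>\<close> with \<open>\<nu>\<close> and \<open>\<beta>\<close> mutually singular.\<close>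

definition lebesgue_decomposition ::
    "'a measure \<Rightarrow> 'a measure \<Rightarrow> ('a \<Rightarrow> real) \<Rightarrow> 'a measure \<Rightarrow> bool" where
  "lebesgue_decomposition \<alpha> \<beta> f \<nu> \<longleftrightarrow>
     f \<in> borel_measurable \<beta> \<and> (\<forall>x. 0 \<le> f x) \<and> sets \<nu> = sets \<beta> \<and>
     (\<forall>A\<in>sets \<beta>. emeasure \<alpha> A = emeasure (density \<beta> (\<lambda>x. ennreal (f x))) A + emeasure \<nu> A) \<and>
     (\<exists>N\<in>sets \<beta>. emeasure \<beta> N = 0 \<and> emeasure \<nu> (space \<beta> - N) = 0)"

text \<open>
  The decomposition exists for finite measures with the same measurable sets and is unique up to
  \<open>\<beta>\<close>-null modifications of the density, so the choice below does not matter.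
\<close>

definition phi_divergence :: "(real \<Rightarrow> ennreal) \<Rightarrow> 'a measure \<Rightarrow> 'a measure \<Rightarrow> ennreal" where
  "phi_divergence \<phi> \<alpha> \<beta> =
     (let p = (SOME p. lebesgue_decomposition \<alpha> \<beta> (fst p) (snd p))
      in (\<integral>\<^sup>+ x. \<phi> (fst p x) \<partial>\<beta>) + recession \<phi> * emeasure (snd p) (space (snd p)))"

text \<open>
  Extended-valued integral (positive part minus negative part; \<open>ennreal\<close> truncates negative
  numbers to \<open>0\<close>). In the divergence below the negative part is finite for finite measures, so no
  \<open>\<infinity> - \<infinity>\<close> arises and the value \<open>\<infinity>\<close> is attained exactly when the positive part diverges.
\<close>

definition ext_integral :: "'a measure \<Rightarrow> ('a \<Rightarrow> real) \<Rightarrow> ereal" where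
  "ext_integral M g =
     enn2ereal (\<integral>\<^sup>+ x. ennreal (g x) \<partial>M) - enn2ereal (\<integral>\<^sup>+ x. ennreal (- g x) \<partial>M)"

definition KL :: "'a measure \<Rightarrow> 'a measure \<Rightarrow> ereal" where
  "KL \<mu> \<nu> = (if absolutely_continuous \<nu> \<mu>
     then ext_integral \<mu> (\<lambda>x. ln (enn2real (RN_deriv \<nu> \<mu> x))) - ereal (mass \<mu>) + ereal (mass \<nu>)
     else \<infinity>)"

text \<open>
  For compact \<open>X\<close> the Borel sets of \<open>X \<times> X\<close> used by \<open>Mplus (X \<times> X)\<close> coincide with the product
  \<open>\<sigma>\<close>-algebra carried by \<open>\<alpha> \<Otimes>\<^sub>M \<beta>\<close>.
\<close>

definition OT :: "'a::topological_space set \<Rightarrow> ('a \<Rightarrow> 'a \<Rightarrow> real) \<Rightarrow> real \<Rightarrow> (real \<Rightarrow> ennreal) \<Rightarrow>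
    'a measure \<Rightarrow> 'a measure \<Rightarrow> ereal" where
  "OT X C \<epsilon> \<phi> \<alpha> \<beta> = (INF \<pi>\<in>Mplus (X \<times> X).
     ereal (LINT (x, y)|\<pi>. C x y)
     + enn2ereal (phi_divergence \<phi> (distr \<pi> (restrict_space borel X) fst) \<alpha>)
     + enn2ereal (phi_divergence \<phi> (distr \<pi> (restrict_space borel X) snd) \<beta>)
     + ereal \<epsilon> * KL \<pi> (\<alpha> \<Otimes>\<^sub>M \<beta>))"

definition sinkhorn_divergence ::
    "'a::topological_space set \<Rightarrow> ('a \<Rightarrow> 'a \<Rightarrow> real) \<Rightarrow> real \<Rightarrow> (real \<Rightarrow> ennreal) \<Rightarrow>
      'a measure \<Rightarrow> 'a measure \<Rightarrow> ereal" where
  "sinkhorn_divergence X C \<epsilon> \<phi> \<alpha> \<beta> =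
     OT X C \<epsilon> \<phi> \<alpha> \<beta> - ereal (1 / 2) * OT X C \<epsilon> \<phi> \<alpha> \<alpha> - ereal (1 / 2) * OT X C \<epsilon> \<phi> \<beta> \<beta>
     + ereal (\<epsilon> / 2 * (mass \<alpha> - mass \<beta>)\<^sup>2)"

definition sinkhorn_setting ::
    "'a::metric_space set \<Rightarrow> ('a \<Rightarrow> 'a \<Rightarrow> real) \<Rightarrow> real \<Rightarrow> real \<Rightarrow> (real \<Rightarrow> ennreal) \<Rightarrow> bool" where
  "sinkhorn_setting X C \<gamma> \<epsilon> \<phi> \<longleftrightarrow>
     compact X \<and>
     continuous_on (X \<times> X) (\<lambda>(x, y). C x y) \<and>
     (\<forall>x\<in>X. \<forall>y\<in>X. C x y = C y x) \<and>
     (\<forall>x\<in>X. \<forall>y\<in>X. \<forall>z\<in>X. \<bar>C x z - C y z\<bar> \<le> \<gamma> * dist x y) \<and>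
     0 < \<epsilon> \<and>
     positive_kernel X (\<lambda>x y. exp (- C x y / \<epsilon>)) \<and>
     universal_kernel X (\<lambda>x y. exp (- C x y / \<epsilon>)) \<and>
     entropy_function \<phi>"

definition jointly_convex_on_Mplus ::
    "'a::topological_space set \<Rightarrow> ('a measure \<Rightarrow> 'a measure \<Rightarrow> ereal) \<Rightarrow> bool" where
  "jointly_convex_on_Mplus X S \<longleftrightarrow>
     (\<forall>\<alpha>\<in>Mplus X. \<forall>\<alpha>'\<in>Mplus X. \<forall>\<beta>\<in>Mplus X. \<forall>\<beta>'\<in>Mplus X. \<forall>t\<in>{0..1}.
        S (mix t \<alpha> \<alpha>') (mix t \<beta> \<beta>') \<le> ereal t * S \<alpha> \<beta> + ereal (1 - t) * S \<alpha>' \<beta>')"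

definition convex_on_Mplus ::
    "'a::topological_space set \<Rightarrow> ('a measure \<Rightarrow> ereal) \<Rightarrow> bool" where
  "convex_on_Mplus X F \<longleftrightarrow>
     (\<forall>\<alpha>\<in>Mplus X. \<forall>\<alpha>'\<in>Mplus X. \<forall>t\<in>{0..1}.
        F (mix t \<alpha> \<alpha>') \<le> ereal t * F \<alpha> + ereal (1 - t) * F \<alpha>')"

end

theory Submission
  imports Defs
begin

text \<open>
  Weak duality bounds \<open>OT \<alpha> \<beta>\<close> from below by the dual functional at any pair of bounded measurable
  potentials. For \<open>\<alpha> = \<beta>\<close> the symmetric Sinkhorn equation
  \<open>f x = R (ln (\<integral> exp (f y - C x y / \<epsilon>) d\<alpha>(y)))\<close>, with \<open>R\<close> antitone and nonexpansive, has a
  solution \<open>f\<^sub>\<alpha>\<close> whose dual value is attained by an explicit plan, so it equals \<open>OT \<alpha> \<alpha>\<close>. Testing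
  \<open>OT \<alpha> \<beta>\<close> with \<open>(f\<^sub>\<alpha>, f\<^sub>\<beta>)\<close> gives
  \<open>S \<alpha> \<beta> \<ge> \<epsilon> / 2 * \<parallel>exp f\<^sub>\<alpha> \<alpha> - exp f\<^sub>\<beta> \<beta>\<parallel>\<^sup>2\<close> in the norm of the kernel \<open>exp (- C / \<epsilon>)\<close>. If the
  right-hand side vanishes, universality gives equality of the two weighted measures, hence of the
  right-hand sides of the Sinkhorn equations, hence of the potentials, hence of \<open>\<alpha>\<close> and \<open>\<beta>\<close>.
  For convexity, \<open>OT\<close> is jointly convex in \<open>(\<pi>, \<alpha>)\<close> before minimisation, and the dual of
  \<open>OT \<alpha> \<alpha> - \<epsilon> m(\<alpha>)\<^sup>2\<close> is jointly concave in \<open>(\<alpha>, exp f \<alpha>)\<close>.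
\<close>

subsection \<open>Borel sets of the square of a compact metric space\<close>

text \<open>Two obstacles shape the proof. For a general \<phi> the map R has slope between -1 and
  0, so the Sinkhorn map is only nonexpansive in the sup norm and the contraction principle does not
  apply. What forces uniqueness is monotonicity in L2: two solutions tested against their
  difference, with the cost symmetrised, agree \<alpha>-almost everywhere, and the integral in the
  equation turns this into agreement on all of X. A quantitative form of this makes approximate
  fixed points uniformly Cauchy, so their limit is an exact one. On the diagonal the explicit plan
  gives a finite value, so the divergence contains no infinity - infinity. The mass correction
  cancels the mass terms of the three dual values. For convexity it leaves -\<epsilon> m(\<alpha>)
  m(\<beta>), which, like the product measure inside KL, is affine in each argument but not jointly;
  this is why convexity is only separate.\<close>

lemma compact_countable_dense:
  fixes X :: "'a::metric_space set"
  assumes "compact X"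
  obtains D where "countable D" "D \<subseteq> X" "\<And>x e. x \<in> X \<Longrightarrow> 0 < e \<Longrightarrow> \<exists>d\<in>D. dist d x < e"
proof -
  have "\<forall>e>0. \<exists>k. finite k \<and> k \<subseteq> X \<and> X \<subseteq> (\<Union>x\<in>k. ball x e)"
    using assms by (intro seq_compact_imp_totally_bounded) (simp add: compact_eq_seq_compact_metric)
  then have "\<forall>n. \<exists>k. finite k \<and> k \<subseteq> X \<and> X \<subseteq> (\<Union>x\<in>k. ball x (1 / real (Suc n)))" by simp
  then obtain k where k: "\<And>n. finite (k n) \<and> k n \<subseteq> X \<and> X \<subseteq> (\<Union>x\<in>k n. ball x (1 / real (Suc n)))"
    by metis
  show ?thesis
  proof
    show "countable (\<Union>n. k n)" using k by (auto intro: countable_finite)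
    show "(\<Union>n. k n) \<subseteq> X" using k by auto
    fix x e assume "x \<in> X" "(0::real) < e"
    obtain n where n: "1 / real (Suc n) < e" using \<open>0 < e\<close> by (metis nat_approx_posE)
    then obtain d where "d \<in> k n" "dist d x < 1 / real (Suc n)" using k[of n] \<open>x \<in> X\<close> by fastforce
    then show "\<exists>d\<in>\<Union>n. k n. dist d x < e" using n by (intro bexI[of _ d]) auto
  qed
qed

text \<open>Separability of the compact set X stands in for a countable base of the whole type: an
  open subset of X \<times> X is the union of those products of balls that it contains, with centres
  in a countable dense set and radii 1 / (n + 1), and these are countably many.\<close>

lemma sets_restrict_borel_Times:
  fixes X :: "'a::metric_space set"
  assumes X: "compact X"
  shows "sets (restrict_space borel (X \<times> X)) =
    sets (restrict_space borel X \<Otimes>\<^sub>M restrict_space borel X)"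
proof (rule antisym)
  let ?B = "restrict_space borel X"
  have fs: "fst \<in> restrict_space borel (X \<times> X) \<rightarrow>\<^sub>M ?B" "snd \<in> restrict_space borel (X \<times> X) \<rightarrow>\<^sub>M ?B"
    by (auto intro!: measurable_restrict_space3 borel_measurable_continuous_onI continuous_intros)
  have "(\<lambda>z. (fst z, snd z)) \<in> restrict_space borel (X \<times> X) \<rightarrow>\<^sub>M ?B \<Otimes>\<^sub>M ?B"
    using fs by (rule measurable_Pair)
  then have id: "(\<lambda>z. z) \<in> restrict_space borel (X \<times> X) \<rightarrow>\<^sub>M ?B \<Otimes>\<^sub>M ?B" by simp
  show "sets (?B \<Otimes>\<^sub>M ?B) \<subseteq> sets (restrict_space borel (X \<times> X))"
  proof
    fix A assume A: "A \<in> sets (?B \<Otimes>\<^sub>M ?B)"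
    then have "A \<subseteq> X \<times> X" using sets.sets_into_space[OF A] by (simp add: space_pair_measure space_restrict_space)
    with measurable_sets[OF id A] show "A \<in> sets (restrict_space borel (X \<times> X))"
      by (simp add: space_restrict_space Int_absorb2)
  qed
  obtain D where D: "countable D" "D \<subseteq> X" "\<And>x e. x \<in> X \<Longrightarrow> 0 < e \<Longrightarrow> \<exists>d\<in>D. dist d x < e"
    using compact_countable_dense[OF X] by blast
  have "(\<lambda>z. z) \<in> ?B \<Otimes>\<^sub>M ?B \<rightarrow>\<^sub>M borel"
  proof (rule borel_measurableI)
    fix U :: "('a \<times> 'a) set" assume U: "open U"
    define R where "R = (\<lambda>(c, d, n). (ball c (1 / real (Suc n)) \<inter> X) \<times> (ball d (1 / real (Suc n)) \<inter> X))"
    define I where "I = {i \<in> D \<times> D \<times> (UNIV :: nat set). R i \<subseteq> U}"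
    have I: "countable I"
      unfolding I_def using D(1) by (intro countable_Collect countable_SIGMA) auto
    have "ball c r \<inter> X \<in> sets ?B" for c r
      by (auto simp: sets_restrict_space image_iff intro!: bexI[of _ "ball c r"])
    then have R: "R i \<in> sets (?B \<Otimes>\<^sub>M ?B)" for i
      unfolding R_def by (auto split: prod.split)
    have "(\<Union>i\<in>I. R i) = U \<inter> X \<times> X"
    proof
      show "(\<Union>i\<in>I. R i) \<subseteq> U \<inter> X \<times> X" by (auto simp: I_def R_def)
      show "U \<inter> X \<times> X \<subseteq> (\<Union>i\<in>I. R i)"
      proof
        fix z assume z: "z \<in> U \<inter> X \<times> X"
        obtain x y where xy: "z = (x, y)" by fastforce
        obtain S T where ST: "open S" "open T" "x \<in> S" "y \<in> T" "S \<times> T \<subseteq> U"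
          using U z unfolding open_prod_def xy by auto
        obtain e1 e2 where e: "0 < e1" "ball x e1 \<subseteq> S" "0 < e2" "ball y e2 \<subseteq> T"
          using ST by (meson openE)
        \<comment> \<open>Half the radius, because a ball of radius r about a point within r of x
          lies in the ball of radius 2 r about x.\<close>
        obtain n where n: "1 / real (Suc n) < min e1 e2 / 2"
          using e by (metis nat_approx_posE half_gt_zero min_less_iff_conj)
        define r where "r = 1 / real (Suc n)"
        have r: "0 < r" "r < min e1 e2 / 2" using n by (auto simp: r_def)
        obtain c where c: "c \<in> D" "dist c x < r" using D(3)[of x r] r z xy by auto
        obtain d where d: "d \<in> D" "dist d y < r" using D(3)[of y r] r z xy by auto
        have "ball c r \<subseteq> ball x e1"
        proof
          fix w assume "w \<in> ball c r"
          then have "dist x w < r + r" using c dist_triangle[of x w c] by (auto simp: dist_commute)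
          then show "w \<in> ball x e1" using r by auto
        qed
        moreover have "ball d r \<subseteq> ball y e2"
        proof
          fix w assume "w \<in> ball d r"
          then have "dist y w < r + r" using d dist_triangle[of y w d] by (auto simp: dist_commute)
          then show "w \<in> ball y e2" using r by auto
        qed
        ultimately have "ball c r \<times> ball d r \<subseteq> U" using ST e by (meson Sigma_mono subset_trans)
        then have "R (c, d, n) \<subseteq> U" unfolding R_def by (auto simp: r_def)
        moreover have "z \<in> R (c, d, n)" using c d z unfolding R_def xy by (auto simp: r_def)
        ultimately show "z \<in> (\<Union>i\<in>I. R i)" using c d by (auto simp: I_def)
      qed
    qed
    moreover have "(\<Union>i\<in>I. R i) \<in> sets (?B \<Otimes>\<^sub>M ?B)" using I R by (intro sets.countable_UN'') auto
    ultimately show "(\<lambda>z. z) -` U \<inter> space (?B \<Otimes>\<^sub>M ?B) \<in> sets (?B \<Otimes>\<^sub>M ?B)"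
      by (simp add: space_pair_measure space_restrict_space)
  qed
  then have "(\<lambda>z. z) \<in> ?B \<Otimes>\<^sub>M ?B \<rightarrow>\<^sub>M restrict_space borel (X \<times> X)"
    by (intro measurable_restrict_space2) (auto simp: space_pair_measure space_restrict_space)
  then show "sets (restrict_space borel (X \<times> X)) \<subseteq> sets (?B \<Otimes>\<^sub>M ?B)"
  proof (intro subsetI)
    fix A assume id: "(\<lambda>z. z) \<in> ?B \<Otimes>\<^sub>M ?B \<rightarrow>\<^sub>M restrict_space borel (X \<times> X)"
      and A: "A \<in> sets (restrict_space borel (X \<times> X))"
    then have "A \<subseteq> X \<times> X" using sets.sets_into_space[OF A] by (simp add: space_restrict_space)
    with measurable_sets[OF id A] show "A \<in> sets (?B \<Otimes>\<^sub>M ?B)"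
      by (simp add: space_pair_measure space_restrict_space Int_absorb2)
  qed
qed

lemma Mplus_sets: "\<alpha> \<in> Mplus X \<Longrightarrow> sets \<alpha> = sets (restrict_space borel X)"
  and Mplus_finite: "\<alpha> \<in> Mplus X \<Longrightarrow> finite_measure \<alpha>"
  by (auto simp: Mplus_def)

lemma Mplus_space: "\<alpha> \<in> Mplus X \<Longrightarrow> space \<alpha> = X"
  using sets_eq_imp_space_eq[OF Mplus_sets[of \<alpha> X]] by (simp add: space_restrict_space)

subsection \<open>Mixtures\<close>

lemma sets_mix [simp, measurable_cong]: "sets (mix t \<alpha> \<beta>) = sets \<alpha>"
  by (simp add: mix_def sets.sigma_sets_eq sets.space_closed)

lemma space_mix [simp]: "space (mix t \<alpha> \<beta>) = space \<alpha>"
  by (simp add: mix_def sets.space_closed)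

lemma emeasure_mix:
  assumes "sets \<alpha> = sets \<beta>" "A \<in> sets \<alpha>"
  shows "emeasure (mix t \<alpha> \<beta>) A = ennreal t * emeasure \<alpha> A + ennreal (1 - t) * emeasure \<beta> A"
  unfolding mix_def
proof (rule emeasure_measure_of_sigma)
  show "countably_additive (sets \<alpha>) (\<lambda>A. ennreal t * emeasure \<alpha> A + ennreal (1 - t) * emeasure \<beta> A)"
  proof (rule countably_additiveI)
    fix A :: "nat \<Rightarrow> _" assume A: "range A \<subseteq> sets \<alpha>" "disjoint_family A"
    have "(\<Sum>i. ennreal t * emeasure \<alpha> (A i) + ennreal (1 - t) * emeasure \<beta> (A i)) =
        ennreal t * (\<Sum>i. emeasure \<alpha> (A i)) + ennreal (1 - t) * (\<Sum>i. emeasure \<beta> (A i))"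
      by (subst suminf_add[symmetric]) auto
    then show "(\<Sum>i. ennreal t * emeasure \<alpha> (A i) + ennreal (1 - t) * emeasure \<beta> (A i)) =
        ennreal t * emeasure \<alpha> (\<Union> (range A)) + ennreal (1 - t) * emeasure \<beta> (\<Union> (range A))"
      using A assms(1) by (simp add: suminf_emeasure)
  qed
  show "sigma_algebra (space \<alpha>) (sets \<alpha>)" by (rule sets.sigma_algebra_axioms)
qed (use assms in \<open>auto simp: positive_def\<close>)

lemma finite_measure_mix:
  assumes "sets \<alpha> = sets \<beta>" "finite_measure \<alpha>" "finite_measure \<beta>"
  shows "finite_measure (mix t \<alpha> \<beta>)"
proof
  have "emeasure \<alpha> (space \<alpha>) \<noteq> \<infinity>" "emeasure \<beta> (space \<alpha>) \<noteq> \<infinity>"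
    using assms finite_measure.emeasure_finite by auto
  then show "emeasure (mix t \<alpha> \<beta>) (space (mix t \<alpha> \<beta>)) \<noteq> \<infinity>"
    using emeasure_mix[OF assms(1) sets.top, of t] by (simp add: ennreal_mult_eq_top_iff)
qed

lemma mix_Mplus: "\<alpha> \<in> Mplus X \<Longrightarrow> \<beta> \<in> Mplus X \<Longrightarrow> mix t \<alpha> \<beta> \<in> Mplus X"
  by (simp add: Mplus_def finite_measure_mix)

lemma nn_integral_mix:
  assumes s: "sets \<alpha> = sets \<beta>" and f: "f \<in> borel_measurable \<alpha>"
  shows "(\<integral>\<^sup>+x. f x \<partial>mix t \<alpha> \<beta>) = ennreal t * (\<integral>\<^sup>+x. f x \<partial>\<alpha>) + ennreal (1 - t) * (\<integral>\<^sup>+x. f x \<partial>\<beta>)"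
  using f
proof (induction rule: borel_measurable_induct)
  case (cong f g)
  have sp: "space \<alpha> = space \<beta>" using s by (rule sets_eq_imp_space_eq)
  have "(\<integral>\<^sup>+x. f x \<partial>mix t \<alpha> \<beta>) = (\<integral>\<^sup>+x. g x \<partial>mix t \<alpha> \<beta>)"
    "(\<integral>\<^sup>+x. f x \<partial>\<alpha>) = (\<integral>\<^sup>+x. g x \<partial>\<alpha>)" "(\<integral>\<^sup>+x. f x \<partial>\<beta>) = (\<integral>\<^sup>+x. g x \<partial>\<beta>)"
    using cong(3) sp by (auto intro!: nn_integral_cong)
  with cong(4) show ?case by simp
next
  case (set A)
  then show ?case using s by (simp add: emeasure_mix)
next
  case (mult u c)
  then have "u \<in> borel_measurable \<beta>" "u \<in> borel_measurable (mix t \<alpha> \<beta>)"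
    using s by (auto cong: measurable_cong_sets)
  with mult show ?case by (simp add: nn_integral_cmult distrib_left mult_ac)
next
  case (add u v)
  then have "u \<in> borel_measurable \<beta>" "u \<in> borel_measurable (mix t \<alpha> \<beta>)"
    "v \<in> borel_measurable \<beta>" "v \<in> borel_measurable (mix t \<alpha> \<beta>)"
    using s by (auto cong: measurable_cong_sets)
  with add show ?case by (simp add: nn_integral_add distrib_left add_ac)
next
  case (seq U)
  have U: "U i \<in> borel_measurable \<beta>" "U i \<in> borel_measurable (mix t \<alpha> \<beta>)" for i
    using seq.hyps(1)[of i] s by (auto cong: measurable_cong_sets)
  have inc: "incseq (\<lambda>i. \<integral>\<^sup>+x. U i x \<partial>N)" for N
    using seq.hyps(3) by (auto simp: incseq_def le_fun_def intro!: nn_integral_mono)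
  have conv: "(\<integral>\<^sup>+x. (SUP i. U i) x \<partial>N) = (SUP i. \<integral>\<^sup>+x. U i x \<partial>N)"
    if "\<And>i. U i \<in> borel_measurable N" for N
    using nn_integral_monotone_convergence_SUP[OF seq.hyps(3) that] by (simp add: image_comp)
  have "(\<integral>\<^sup>+x. (SUP i. U i) x \<partial>mix t \<alpha> \<beta>) =
      (SUP i. ennreal t * (\<integral>\<^sup>+x. U i x \<partial>\<alpha>) + ennreal (1 - t) * (\<integral>\<^sup>+x. U i x \<partial>\<beta>))"
    by (subst conv[OF U(2)]) (simp add: seq.IH)
  also have "\<dots> = (SUP i. ennreal t * (\<integral>\<^sup>+x. U i x \<partial>\<alpha>)) + (SUP i. ennreal (1 - t) * (\<integral>\<^sup>+x. U i x \<partial>\<beta>))"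
    using inc by (intro ennreal_SUP_add) (auto simp: incseq_def intro!: mult_left_mono)
  also have "\<dots> = ennreal t * (\<integral>\<^sup>+x. (SUP i. U i) x \<partial>\<alpha>) + ennreal (1 - t) * (\<integral>\<^sup>+x. (SUP i. U i) x \<partial>\<beta>)"
    by (simp only: conv[OF U(1)] conv[OF seq.hyps(1)] SUP_mult_left_ennreal)
  finally show ?case .
qed

lemma integral_mix:
  fixes f :: "'a \<Rightarrow> real"
  assumes s: "sets \<alpha> = sets \<beta>" and t: "0 \<le> t" "t \<le> 1" and f: "integrable \<alpha> f" "integrable \<beta> f"
  shows "integrable (mix t \<alpha> \<beta>) f"
    and "(\<integral>x. f x \<partial>mix t \<alpha> \<beta>) = t * (\<integral>x. f x \<partial>\<alpha>) + (1 - t) * (\<integral>x. f x \<partial>\<beta>)"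
proof -
  have m: "f \<in> borel_measurable \<alpha>" using f by auto
  have m': "f \<in> borel_measurable (mix t \<alpha> \<beta>)" using m by (auto cong: measurable_cong_sets)
  have fin: "(\<integral>\<^sup>+x. ennreal (f x) \<partial>\<alpha>) \<noteq> \<infinity>" "(\<integral>\<^sup>+x. ennreal (f x) \<partial>\<beta>) \<noteq> \<infinity>"
    "(\<integral>\<^sup>+x. ennreal (- f x) \<partial>\<alpha>) \<noteq> \<infinity>" "(\<integral>\<^sup>+x. ennreal (- f x) \<partial>\<beta>) \<noteq> \<infinity>"
    using f by (auto simp: real_integrable_def)
  note n = nn_integral_mix[OF s, of "\<lambda>x. ennreal (f x)" t] nn_integral_mix[OF s, of "\<lambda>x. ennreal (- f x)" t]
  show i: "integrable (mix t \<alpha> \<beta>) f"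
    unfolding real_integrable_def using m m' fin by (simp add: n ennreal_mult_eq_top_iff)
  have e: "enn2real (ennreal a * p + ennreal b * q) = a * enn2real p + b * enn2real q"
    if "0 \<le> a" "0 \<le> b" "p \<noteq> \<infinity>" "q \<noteq> \<infinity>" for a b p q
    using that by (cases p; cases q) (auto simp: ennreal_mult[symmetric] ennreal_plus[symmetric] simp del: ennreal_plus)
  show "(\<integral>x. f x \<partial>mix t \<alpha> \<beta>) = t * (\<integral>x. f x \<partial>\<alpha>) + (1 - t) * (\<integral>x. f x \<partial>\<beta>)"
    using m fin t by (simp add: real_lebesgue_integral_def[OF i] real_lebesgue_integral_def[OF f(1)]
      real_lebesgue_integral_def[OF f(2)] n e algebra_simps)
qed

lemma mix_same: "0 \<le> t \<Longrightarrow> t \<le> 1 \<Longrightarrow> mix t \<beta> \<beta> = \<beta>"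
  by (rule measure_eqI) (auto simp: emeasure_mix distrib_right[symmetric] ennreal_plus[symmetric] simp del: ennreal_plus)

lemma mix_0: "sets \<alpha> = sets \<beta> \<Longrightarrow> mix 0 \<alpha> \<beta> = \<beta>"
  by (rule measure_eqI) (auto simp: emeasure_mix)

lemma mix_1: "sets \<alpha> = sets \<beta> \<Longrightarrow> mix 1 \<alpha> \<beta> = \<alpha>"
  by (rule measure_eqI) (auto simp: emeasure_mix)

lemma mass_mix:
  assumes "sets \<alpha> = sets \<beta>" "finite_measure \<alpha>" "finite_measure \<beta>" "0 \<le> t" "t \<le> 1"
  shows "mass (mix t \<alpha> \<beta>) = t * mass \<alpha> + (1 - t) * mass \<beta>"
  using integral_mix(2)[OF assms(1,4,5), of "\<lambda>_. 1"] assms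
  by (simp add: finite_measure.integrable_const sets_eq_imp_space_eq[OF assms(1)])

lemma distr_mix:
  assumes s: "sets \<alpha> = sets \<beta>" and f: "f \<in> \<alpha> \<rightarrow>\<^sub>M N"
  shows "distr (mix t \<alpha> \<beta>) N f = mix t (distr \<alpha> N f) (distr \<beta> N f)"
proof -
  have f': "f \<in> \<beta> \<rightarrow>\<^sub>M N" "f \<in> mix t \<alpha> \<beta> \<rightarrow>\<^sub>M N" using f s by (auto cong: measurable_cong_sets)
  have "f -` A \<inter> space \<alpha> \<in> sets \<alpha>" if "A \<in> sets N" for A using f that by (rule measurable_sets)
  then show ?thesis using s f f'
    by (intro measure_eqI) (auto simp: emeasure_mix emeasure_distr sets_eq_imp_space_eq[OF s])
qed

text \<open>With both factors varying, the product of mixtures has cross terms. Fixing one factor,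
  here or in \<open>pair_mix_right\<close>, removes them, and this is what convexity in a single
  argument rests on.\<close>

lemma pair_mix_left:
  assumes s: "sets \<alpha> = sets \<alpha>'" and fin: "finite_measure \<alpha>" "finite_measure \<alpha>'" "finite_measure \<beta>"
  shows "mix t \<alpha> \<alpha>' \<Otimes>\<^sub>M \<beta> = mix t (\<alpha> \<Otimes>\<^sub>M \<beta>) (\<alpha>' \<Otimes>\<^sub>M \<beta>)"
proof -
  interpret b: sigma_finite_measure \<beta> using fin(3) by (rule finite_measure.axioms)
  have sp: "sets (\<alpha> \<Otimes>\<^sub>M \<beta>) = sets (\<alpha>' \<Otimes>\<^sub>M \<beta>)" using s by (intro sets_pair_measure_cong) auto
  show ?thesis
  proof (rule measure_eqI)
    show "sets (mix t \<alpha> \<alpha>' \<Otimes>\<^sub>M \<beta>) = sets (mix t (\<alpha> \<Otimes>\<^sub>M \<beta>) (\<alpha>' \<Otimes>\<^sub>M \<beta>))"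
      by (simp cong: sets_pair_measure_cong)
    then have *: "sets (mix t \<alpha> \<alpha>' \<Otimes>\<^sub>M \<beta>) = sets (\<alpha> \<Otimes>\<^sub>M \<beta>)" by simp
    fix A assume "A \<in> sets (mix t \<alpha> \<alpha>' \<Otimes>\<^sub>M \<beta>)"
    then have A: "A \<in> sets (mix t \<alpha> \<alpha>' \<Otimes>\<^sub>M \<beta>)" "A \<in> sets (\<alpha> \<Otimes>\<^sub>M \<beta>)" "A \<in> sets (\<alpha>' \<Otimes>\<^sub>M \<beta>)" 
      using * sp by auto
    have "(\<lambda>x. emeasure \<beta> (Pair x -` A)) \<in> borel_measurable \<alpha>" using A(2) by (rule b.measurable_emeasure_Pair)
    then show "emeasure (mix t \<alpha> \<alpha>' \<Otimes>\<^sub>M \<beta>) A = emeasure (mix t (\<alpha> \<Otimes>\<^sub>M \<beta>) (\<alpha>' \<Otimes>\<^sub>M \<beta>)) A"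
      using A sp by (simp add: emeasure_mix b.emeasure_pair_measure_alt nn_integral_mix[OF s])
  qed
qed

lemma pair_mix_right:
  assumes s: "sets \<beta> = sets \<beta>'" and fin: "finite_measure \<alpha>" "finite_measure \<beta>" "finite_measure \<beta>'"
  shows "\<alpha> \<Otimes>\<^sub>M mix t \<beta> \<beta>' = mix t (\<alpha> \<Otimes>\<^sub>M \<beta>) (\<alpha> \<Otimes>\<^sub>M \<beta>')"
proof -
  interpret b: sigma_finite_measure \<beta> using fin(2) by (rule finite_measure.axioms)
  interpret b': sigma_finite_measure \<beta>' using fin(3) by (rule finite_measure.axioms)
  interpret m: sigma_finite_measure "mix t \<beta> \<beta>'"
    using finite_measure_mix[OF s fin(2,3)] by (rule finite_measure.axioms)
  have sp: "sets (\<alpha> \<Otimes>\<^sub>M \<beta>) = sets (\<alpha> \<Otimes>\<^sub>M \<beta>')" using s by (intro sets_pair_measure_cong) auto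
  show ?thesis
  proof (rule measure_eqI)
    show "sets (\<alpha> \<Otimes>\<^sub>M mix t \<beta> \<beta>') = sets (mix t (\<alpha> \<Otimes>\<^sub>M \<beta>) (\<alpha> \<Otimes>\<^sub>M \<beta>'))"
      by (simp cong: sets_pair_measure_cong)
    then have *: "sets (\<alpha> \<Otimes>\<^sub>M mix t \<beta> \<beta>') = sets (\<alpha> \<Otimes>\<^sub>M \<beta>)" by simp
    fix A assume "A \<in> sets (\<alpha> \<Otimes>\<^sub>M mix t \<beta> \<beta>')"
    then have A: "A \<in> sets (\<alpha> \<Otimes>\<^sub>M mix t \<beta> \<beta>')" "A \<in> sets (\<alpha> \<Otimes>\<^sub>M \<beta>)" "A \<in> sets (\<alpha> \<Otimes>\<^sub>M \<beta>')"
      using * sp by auto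
    have "(\<lambda>x. emeasure \<beta> (Pair x -` A)) \<in> borel_measurable \<alpha>" "(\<lambda>x. emeasure \<beta>' (Pair x -` A)) \<in> borel_measurable \<alpha>"
      using b.measurable_emeasure_Pair[OF A(2)] b'.measurable_emeasure_Pair[OF A(3)] by auto
    moreover have "emeasure (mix t \<beta> \<beta>') (Pair x -` A) =
        ennreal t * emeasure \<beta> (Pair x -` A) + ennreal (1 - t) * emeasure \<beta>' (Pair x -` A)" for x
      using sets_Pair1[OF A(2), of x] by (rule emeasure_mix[OF s])
    ultimately show "emeasure (\<alpha> \<Otimes>\<^sub>M mix t \<beta> \<beta>') A = emeasure (mix t (\<alpha> \<Otimes>\<^sub>M \<beta>) (\<alpha> \<Otimes>\<^sub>M \<beta>')) A"
      using A sp by (simp add: emeasure_mix[OF sp] b.emeasure_pair_measure_alt b'.emeasure_pair_measure_alt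
          m.emeasure_pair_measure_alt nn_integral_add nn_integral_cmult)
  qed
qed

subsection \<open>Densities with respect to a common dominating measure\<close>

lemma finite_real_density:
  assumes "finite_measure M" "finite_measure \<alpha>" "sets \<alpha> = sets M"
    and ac: "\<And>A. A \<in> sets M \<Longrightarrow> emeasure M A = 0 \<Longrightarrow> emeasure \<alpha> A = 0"
  obtains y where "y \<in> borel_measurable M" "\<And>x. 0 \<le> (y x :: real)" "\<alpha> = density M (\<lambda>x. ennreal (y x))"
proof -
  interpret sigma_finite_measure M using assms(1) by (rule finite_measure.axioms)
  have ac: "absolutely_continuous M \<alpha>"
    unfolding absolutely_continuous_def using ac assms(3) by (auto simp: null_sets_def)
  obtain D where D: "D \<in> borel_measurable M" "AE x in M. RN_deriv M \<alpha> x = ennreal (D x)" "\<And>x. 0 \<le> D x"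
    using real_RN_deriv[OF assms(2) ac assms(3)] by metis
  have "\<alpha> = density M (RN_deriv M \<alpha>)" using density_RN_deriv[OF ac assms(3)] by simp
  also have "\<dots> = density M (\<lambda>x. ennreal (D x))" using D by (intro density_cong) auto
  finally show ?thesis using that D by blast
qed

text \<open>Half mixtures serve as common dominating measures: each component is absolutely
  continuous with respect to the mixture.\<close>

lemma mix_half_null:
  assumes "sets \<alpha> = sets \<beta>" "A \<in> sets \<alpha>" "emeasure (mix (1/2) \<alpha> \<beta>) A = 0"
  shows "emeasure \<alpha> A = 0" "emeasure \<beta> A = 0"
  using assms by (auto simp: emeasure_mix)

subsection \<open>Entropy functions and their recession constant\<close>

lemma ennreal_inverse_mult:
  assumes "0 < (r::real)"
  shows "a / ennreal r = a * ennreal (1 / r)"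
  using assms by (simp add: divide_ennreal_def inverse_ennreal inverse_eq_divide)

text \<open>A positive real limit c excludes the indeterminate product of infinity and 0, so the
  limit a may be infinite.\<close>

lemma ennreal_tendsto_mult:
  fixes f :: "'b \<Rightarrow> ennreal" and g :: "'b \<Rightarrow> real"
  assumes f: "(f \<longlongrightarrow> a) F" and g: "(g \<longlongrightarrow> c) F" and c: "0 < c"
  shows "((\<lambda>x. f x * ennreal (g x)) \<longlongrightarrow> a * ennreal c) F"
  using f g c by (intro tendsto_mult_ennreal tendsto_ennrealI) (auto simp: ennreal_eq_0_iff)

lemma mix_density:
  fixes a b :: "'a \<Rightarrow> real"
  assumes [measurable]: "a \<in> borel_measurable M" "b \<in> borel_measurable M"
    and "\<And>z. 0 \<le> a z" "\<And>z. 0 \<le> b z" "0 \<le> t" "t \<le> 1"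
  shows "mix t (density M (\<lambda>z. ennreal (a z))) (density M (\<lambda>z. ennreal (b z))) =
    density M (\<lambda>z. ennreal (t * a z + (1 - t) * b z))"
  using assms by (intro measure_eqI)
    (auto simp: emeasure_mix emeasure_density nn_integral_add[symmetric] nn_integral_cmult[symmetric] ennreal_mult
        distrib_right mult_ac indicator_def intro!: nn_integral_cong)

locale entropy =
  fixes \<phi> :: "real \<Rightarrow> ennreal"
  assumes entropy: "entropy_function \<phi>"
begin

lemma conv: "0 \<le> t \<Longrightarrow> t \<le> 1 \<Longrightarrow> \<phi> (t * x + (1 - t) * y) \<le> ennreal t * \<phi> x + ennreal (1 - t) * \<phi> y"
  using entropy by (simp add: entropy_function_def)

lemma phi_1 [simp]: "\<phi> 1 = 0"
  using entropy by (simp add: entropy_function_def)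

lemma open_greater: "open {x. c < \<phi> x}"
proof (subst open_subopen, intro ballI)
  fix x assume x: "x \<in> {x. c < \<phi> x}"
  have "\<phi> x \<le> Liminf (at x) \<phi>" using entropy by (simp add: entropy_function_def)
  then have "\<forall>\<^sub>F y in at x. c < \<phi> y" using x by (simp add: le_Liminf_iff)
  then obtain S where "open S" "x \<in> S" "\<forall>y\<in>S. y \<noteq> x \<longrightarrow> c < \<phi> y"
    by (auto simp: eventually_at_topological)
  then show "\<exists>T. open T \<and> x \<in> T \<and> T \<subseteq> {x. c < \<phi> x}"
    using x by (intro exI[of _ S]) auto
qed

lemma measurable_phi [measurable]: "\<phi> \<in> borel_measurable borel"
  by (rule borel_measurableI_greater) (simp add: open_greater)

text \<open>By convexity the chord slopes \<phi> z / (z - 1), taken from the zero of \<phi> at 1,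
  increase with z and so converge to their supremum. Replacing z - 1 by z changes nothing in the
  limit. Only after this does \<open>Lim\<close> in the definition denote an actual limit.\<close>

lemma recession_tendsto: "((\<lambda>x. \<phi> x / ennreal x) \<longlongrightarrow> recession \<phi>) at_top"
proof -
  define G where "G z = \<phi> z * ennreal (1 / (z - 1))" for z
  define S where "S = (SUP z\<in>{1<..}. G z)"
  have mono: "G w \<le> G z" if "1 < w" "w \<le> z" for w z
  proof -
    define t where "t = (w - 1) / (z - 1)"
    have t: "0 \<le> t" "t \<le> 1" "t * (z - 1) = w - 1" using that by (auto simp: t_def)
    have "\<phi> (t * z + (1 - t) * 1) \<le> ennreal t * \<phi> z" using conv[of t z 1] t by simp
    moreover have "t * z + (1 - t) * 1 = w" using t(3) by (simp add: algebra_simps)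
    ultimately have "G w \<le> ennreal t * \<phi> z * ennreal (1 / (w - 1))"
      unfolding G_def by (metis mult_right_mono zero_le)
    also have "\<dots> = \<phi> z * ennreal (t * (1 / (w - 1)))"
      using t that by (subst ennreal_mult) (auto simp: mult_ac)
    also have "t * (1 / (w - 1)) = 1 / (z - 1)" using that by (auto simp: t_def)
    finally show ?thesis by (simp add: G_def)
  qed
  have "(G \<longlongrightarrow> S) at_top"
  proof (rule order_tendstoI)
    fix a assume "a < S"
    then obtain z where z: "1 < z" "a < G z" by (auto simp: S_def less_SUP_iff)
    then show "\<forall>\<^sub>F x in at_top. a < G x"
      by (intro eventually_mono[OF eventually_ge_at_top[of z]]) (metis less_le_trans mono)
  next
    fix a assume "S < a"
    then show "\<forall>\<^sub>F x in at_top. G x < a"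
      unfolding S_def by (intro eventually_mono[OF eventually_gt_at_top[of 1]])
        (auto intro: le_less_trans[OF SUP_upper])
  qed
  moreover have "((\<lambda>z. (z - 1) / z) \<longlongrightarrow> (1::real)) at_top" by real_asymp
  ultimately have "((\<lambda>z. G z * ennreal ((z - 1) / z)) \<longlongrightarrow> S * ennreal 1) at_top"
    by (rule ennreal_tendsto_mult) simp
  moreover have "\<forall>\<^sub>F z in at_top. G z * ennreal ((z - 1) / z) = \<phi> z / ennreal z"
    using eventually_gt_at_top[of 1]
  proof eventually_elim
    case (elim z)
    have "G z * ennreal ((z - 1) / z) = \<phi> z * (ennreal (1 / (z - 1)) * ennreal ((z - 1) / z))"
      by (simp add: G_def mult_ac)
    also have "ennreal (1 / (z - 1)) * ennreal ((z - 1) / z) = ennreal (1 / z)"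
      using elim by (subst ennreal_mult[symmetric]) auto
    finally show ?case using elim by (simp add: ennreal_inverse_mult)
  qed
  ultimately have "((\<lambda>x. \<phi> x / ennreal x) \<longlongrightarrow> S) at_top"
    by (simp add: tendsto_cong)
  then show ?thesis unfolding recession_def by (simp add: tendsto_Lim)
qed

text \<open>The point a + b lies on the chord from a to a far point z, with weight b / (z - a) at z.
  As z tends to infinity this weight times \<phi> z tends to the recession constant times b.\<close>

lemma phi_add_le:
  assumes "0 \<le> b"
  shows "\<phi> (a + b) \<le> \<phi> a + recession \<phi> * ennreal b"
proof (cases "b = 0")
  case False
  then have b: "0 < b" using assms by simp
  have "((\<lambda>z. b * z / (z - a)) \<longlongrightarrow> b) at_top" by real_asymp
  then have "((\<lambda>z. \<phi> z / ennreal z * ennreal (b * z / (z - a))) \<longlongrightarrow> recession \<phi> * ennreal b) at_top"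
    by (intro ennreal_tendsto_mult recession_tendsto b)
  then have "((\<lambda>z. \<phi> a + \<phi> z / ennreal z * ennreal (b * z / (z - a))) \<longlongrightarrow> \<phi> a + recession \<phi> * ennreal b) at_top"
    by (intro tendsto_add tendsto_const)
  moreover have "\<forall>\<^sub>F z in at_top. \<phi> (a + b) \<le> \<phi> a + \<phi> z / ennreal z * ennreal (b * z / (z - a))"
    using eventually_gt_at_top[of "max 0 (a + b)"]
  proof eventually_elim
    case (elim z)
    define t where "t = b / (z - a)"
    have t: "0 \<le> t" "t \<le> 1" "t * (z - a) = b" using elim b by (auto simp: t_def)
    have "\<phi> (a + b) = \<phi> (t * z + (1 - t) * a)" using t(3) by (simp add: algebra_simps)
    also have "\<dots> \<le> ennreal t * \<phi> z + ennreal (1 - t) * \<phi> a" using t conv by simp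
    also have "\<dots> \<le> ennreal t * \<phi> z + \<phi> a"
      using t mult_right_mono[of "ennreal (1 - t)" 1 "\<phi> a"] by (intro add_left_mono) (simp add: ennreal_le_1)
    also have "ennreal t * \<phi> z = \<phi> z / ennreal z * ennreal (b * z / (z - a))"
    proof -
      have "\<phi> z / ennreal z * ennreal (b * z / (z - a)) = \<phi> z * (ennreal (1 / z) * ennreal (b * z / (z - a)))"
        using elim by (simp add: ennreal_inverse_mult mult_ac)
      also have "ennreal (1 / z) * ennreal (b * z / (z - a)) = ennreal (1 / z * (b * z / (z - a)))"
        using elim b by (intro ennreal_mult[symmetric]) auto
      also have "1 / z * (b * z / (z - a)) = t" using elim by (simp add: t_def)
      finally show ?thesis by (simp add: mult_ac)
    qed
    finally show ?case by (simp add: add_ac)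
  qed
  ultimately show ?thesis by (intro tendsto_lowerbound) auto
qed simp

text \<open>The closed perspective of \<phi>: for x > 0 the value at y = 0 is the limit of y \<phi>
  (x / y). It merges the absolutely continuous and the singular term of the divergence into one
  integrand. At x = y = 0 the convention that 0 times infinity is 0 gives 0.\<close>

definition persp :: "real \<Rightarrow> real \<Rightarrow> ennreal" where
  "persp x y = (if 0 < y then ennreal y * \<phi> (x / y) else recession \<phi> * ennreal x)"

lemma measurable_persp [measurable]:
  assumes [measurable]: "f \<in> borel_measurable M" "g \<in> borel_measurable M"
  shows "(\<lambda>z. persp (f z) (g z)) \<in> borel_measurable M"
  unfolding persp_def by measurable

lemma persp_scale: "0 \<le> t \<Longrightarrow> 0 \<le> x \<Longrightarrow> 0 \<le> y \<Longrightarrow> persp (t * x) (t * y) = ennreal t * persp x y"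
  by (cases "t = 0") (auto simp: persp_def ennreal_mult zero_less_mult_iff mult_ac)

text \<open>For y and y' positive this is convexity of \<phi> with weights proportional to y and y';
  if one of them vanishes it is \<open>phi_add_le\<close>. With \<open>persp_scale\<close> it gives
  joint convexity.\<close>

lemma persp_add:
  assumes "0 \<le> x" "0 \<le> x'" "0 \<le> y" "0 \<le> y'"
  shows "persp (x + x') (y + y') \<le> persp x y + persp x' y'"
proof -
  have one: "persp (x + x') y \<le> persp x y + persp x' 0" if "0 < y" "0 \<le> x" "0 \<le> x'" for x x' y
  proof -
    have "ennreal y * \<phi> (x / y + x' / y) \<le> ennreal y * (\<phi> (x / y) + recession \<phi> * ennreal (x' / y))"
      using that by (intro mult_left_mono phi_add_le) auto
    also have "\<dots> = ennreal y * \<phi> (x / y) + recession \<phi> * (ennreal y * ennreal (x' / y))"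
      by (simp add: distrib_left mult_ac)
    also have "ennreal y * ennreal (x' / y) = ennreal x'"
      using that by (subst ennreal_mult[symmetric]) auto
    finally show ?thesis using that by (simp add: persp_def add_divide_distrib)
  qed
  consider "0 < y" "0 < y'" | "0 < y" "y' = 0" | "y = 0" "0 < y'" | "y = 0" "y' = 0" using assms by fastforce
  then show ?thesis
  proof cases
    case 1
    define t where "t = y / (y + y')"
    have t: "0 \<le> t" "t \<le> 1" "(y + y') * t = y" "(y + y') * (1 - t) = y'" using 1 by (auto simp: t_def field_simps)
    have "(x + x') / (y + y') = t * (x / y) + (1 - t) * (x' / y')"
    proof -
      have "t * (x / y) = x / (y + y')" "(1 - t) * (x' / y') = x' / (y + y')"
        using 1 by (auto simp: t_def diff_divide_eq_iff)
      then show ?thesis by (simp add: add_divide_distrib)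
    qed
    then have "\<phi> ((x + x') / (y + y')) \<le> ennreal t * \<phi> (x / y) + ennreal (1 - t) * \<phi> (x' / y')"
      using conv[OF t(1,2), of "x / y" "x' / y'"] by metis
    then have "ennreal (y + y') * \<phi> ((x + x') / (y + y'))
        \<le> ennreal (y + y') * (ennreal t * \<phi> (x / y) + ennreal (1 - t) * \<phi> (x' / y'))"
      by (rule mult_left_mono) simp
    also have "\<dots> = ennreal ((y + y') * t) * \<phi> (x / y) + ennreal ((y + y') * (1 - t)) * \<phi> (x' / y')"
    proof -
      have *: "ennreal ((y + y') * s) = ennreal (y + y') * ennreal s" if "0 \<le> s" for s
        using 1 that by (intro ennreal_mult) auto
      have "0 \<le> 1 - t" using t by simp
      then show ?thesis using t(1) by (simp only: distrib_left mult.assoc *)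
    qed
    finally show ?thesis using 1 t by (simp add: persp_def del: ennreal_plus)
  next
    case 2 then show ?thesis using one assms by simp
  next
    case 3 then show ?thesis using one[of y' x' x] assms by (simp add: add_ac)
  next
    case 4 then show ?thesis using assms by (simp add: persp_def distrib_left)
  qed
qed

text \<open>Compare the affine minorant with \<phi> at 1 + b, where \<open>phi_add_le\<close> and
  \<phi> 1 = 0 bound \<phi> by the recession constant times b; then divide by b and let b tend to
  infinity.\<close>

lemma recession_ge:
  assumes "\<And>p. 0 \<le> p \<Longrightarrow> ennreal (u - F * p) \<le> \<phi> p"
  shows "ennreal (- F) \<le> recession \<phi>"
proof (cases "recession \<phi>")
  case (real r)
  have "(u - F * (1 + b)) / b \<le> r" if "0 < b" for b
  proof -
    have "ennreal (u - F * (1 + b)) \<le> \<phi> (1 + b)" using that by (intro assms) auto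
    also have "\<dots> \<le> ennreal r * ennreal b" using phi_add_le[of b 1] that real by simp
    finally have "u - F * (1 + b) \<le> r * b" using that real by (simp add: ennreal_mult[symmetric])
    then show ?thesis using that by (simp add: field_simps)
  qed
  then have "\<forall>\<^sub>F b in at_top. (u - F * (1 + b)) / b \<le> r"
    by (intro eventually_mono[OF eventually_gt_at_top[of 0]])
  moreover have "((\<lambda>b. (u - F * (1 + b)) / b) \<longlongrightarrow> - F) at_top" by real_asymp
  ultimately have "- F \<le> r" by (intro tendsto_upperbound) auto
  then show ?thesis using real by simp
qed simp

text \<open>The left-hand side is the perspective of the affine minorant u - F p. The pair (u, F)
  encodes the Fenchel inequality, u being at most minus the conjugate of \<phi> at -F, so no
  conjugate has to be defined.\<close>

lemma persp_ge:
  assumes "\<And>p. 0 \<le> p \<Longrightarrow> ennreal (u - F * p) \<le> \<phi> p" and "0 \<le> x" "0 \<le> y"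
  shows "ennreal (u * y - F * x) \<le> persp x y"
proof (cases "0 < y")
  case True
  have "ennreal (u * y - F * x) = ennreal y * ennreal (u - F * (x / y))"
    using True by (subst ennreal_mult'[symmetric]) (auto simp: right_diff_distrib mult.commute)
  also have "\<dots> \<le> ennreal y * \<phi> (x / y)"
    using True assms(2) by (intro mult_left_mono assms(1)) auto
  finally show ?thesis using True by (simp add: persp_def)
next
  case False
  then have "ennreal (u * y - F * x) = ennreal (- F) * ennreal x"
    using assms by (subst ennreal_mult''[symmetric]) auto
  also have "\<dots> \<le> recession \<phi> * ennreal x" by (intro mult_right_mono recession_ge[of u]) (use assms in auto)
  finally show ?thesis using False by (simp add: persp_def)
qed

subsection \<open>The divergence as an integral of the perspective function\<close>

text \<open>
  Against a common dominating measure the divergence is the integral of a jointly sublinear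
  function of the two densities; convexity and duality become pointwise statements.
\<close>

lemma lebesgue_decomposition_density:
  fixes x y :: "'a \<Rightarrow> real"
  assumes [measurable]: "x \<in> borel_measurable M" "y \<in> borel_measurable M"
    and nn: "\<And>z. 0 \<le> x z" "\<And>z. 0 \<le> y z"
  shows "lebesgue_decomposition (density M (\<lambda>z. ennreal (x z))) (density M (\<lambda>z. ennreal (y z)))
    (\<lambda>z. if 0 < y z then x z / y z else 0) (density M (\<lambda>z. if 0 < y z then 0 else ennreal (x z)))"
  unfolding lebesgue_decomposition_def
proof (intro conjI ballI allI)
  let ?N = "{z\<in>space M. \<not> 0 < y z}"
  show "\<exists>N\<in>sets (density M (\<lambda>z. ennreal (y z))). emeasure (density M (\<lambda>z. ennreal (y z))) N = 0 \<and>
      emeasure (density M (\<lambda>z. if 0 < y z then 0 else ennreal (x z))) (space (density M (\<lambda>z. ennreal (y z))) - N) = 0"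
  proof (intro bexI[of _ ?N] conjI)
    show "emeasure (density M (\<lambda>z. ennreal (y z))) ?N = 0"
      using nn by (subst emeasure_density) (auto simp: nn_integral_0_iff_AE indicator_def not_less ennreal_eq_0_iff)
    show "emeasure (density M (\<lambda>z. if 0 < y z then 0 else ennreal (x z))) (space (density M (\<lambda>z. ennreal (y z))) - ?N) = 0"
      by (subst emeasure_density) (auto simp: nn_integral_0_iff_AE indicator_def)
  qed auto
  fix A assume "A \<in> sets (density M (\<lambda>z. ennreal (y z)))"
  then have [measurable]: "A \<in> sets M" by simp
  have "emeasure (density M (\<lambda>z. ennreal (x z))) A =
      (\<integral>\<^sup>+z. ennreal (y z) * ennreal (if 0 < y z then x z / y z else 0) * indicator A z + (if 0 < y z then 0 else ennreal (x z)) * indicator A z \<partial>M)"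
    using nn by (subst emeasure_density)
      (auto intro!: nn_integral_cong simp: ennreal_mult[symmetric] indicator_def)
  also have "\<dots> = emeasure (density (density M (\<lambda>z. ennreal (y z))) (\<lambda>z. ennreal (if 0 < y z then x z / y z else 0))) A +
      emeasure (density M (\<lambda>z. if 0 < y z then 0 else ennreal (x z))) A"
    by (subst nn_integral_add) (auto simp: density_density_eq emeasure_density)
  finally show "emeasure (density M (\<lambda>z. ennreal (x z))) A = emeasure (density (density M (\<lambda>z. ennreal (y z))) (\<lambda>z. ennreal (if 0 < y z then x z / y z else 0))) A +
      emeasure (density M (\<lambda>z. if 0 < y z then 0 else ennreal (x z))) A" .
qed (use nn in auto)

text \<open>The decomposition (f, \<nu>) picked by \<open>SOME\<close> is arbitrary, so the argument
  must fit any choice. Since \<nu> is dominated by \<mu>, it has a density n, and x = y f + n almost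
  everywhere. On the null set N of the singular part y = 0, so x = n; off N, n = 0, so x = y f. In
  both cases the integrand is \<open>persp\<close>.\<close>

lemma phi_divergence_density:
  fixes x y :: "'a \<Rightarrow> real"
  assumes M: "finite_measure M" and [measurable]: "x \<in> borel_measurable M" "y \<in> borel_measurable M"
    and nn: "\<And>z. 0 \<le> x z" "\<And>z. 0 \<le> y z"
    and \<mu>: "\<mu> = density M (\<lambda>z. ennreal (x z))" "finite_measure \<mu>"
    and \<alpha>: "\<alpha> = density M (\<lambda>z. ennreal (y z))"
  shows "phi_divergence \<phi> \<mu> \<alpha> = (\<integral>\<^sup>+z. persp (x z) (y z) \<partial>M)"
proof -
  interpret sigma_finite_measure M using M by (rule finite_measure.axioms)
  define p where "p = (SOME p. lebesgue_decomposition \<mu> \<alpha> (fst p) (snd p))"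
  have "\<exists>p. lebesgue_decomposition \<mu> \<alpha> (fst p) (snd p)"
    using lebesgue_decomposition_density[of x M y] nn unfolding \<mu> \<alpha> by auto
  then have "lebesgue_decomposition \<mu> \<alpha> (fst p) (snd p)" unfolding p_def by (rule someI_ex)
  then obtain f \<nu> where p: "p = (f, \<nu>)" and d: "lebesgue_decomposition \<mu> \<alpha> f \<nu>" by (cases p) auto
  have sets: "sets \<alpha> = sets M" "sets \<mu> = sets M" "sets \<nu> = sets M"
    using d by (auto simp: \<alpha> \<mu> lebesgue_decomposition_def)
  have sp: "space \<nu> = space M" using sets(3) by (rule sets_eq_imp_space_eq)
  have f[measurable]: "f \<in> borel_measurable M" and f0: "\<And>z. 0 \<le> f z"
    using d by (auto simp: lebesgue_decomposition_def \<alpha>)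
  have dec: "emeasure \<mu> A = emeasure (density \<alpha> (\<lambda>x. ennreal (f x))) A + emeasure \<nu> A" if "A \<in> sets M" for A
    using d that sets by (simp add: lebesgue_decomposition_def)
  obtain N where N[measurable]: "N \<in> sets M" and N0: "emeasure \<alpha> N = 0" "emeasure \<nu> (space M - N) = 0"
    using d sets sets_eq_imp_space_eq[OF sets(1)] by (auto simp: lebesgue_decomposition_def)
  have le: "emeasure \<nu> A \<le> emeasure \<mu> A" if "A \<in> sets M" for A using dec[OF that] by simp
  have "emeasure \<nu> (space M) \<le> emeasure \<mu> (space M)" by (rule le) simp
  also have "\<dots> < \<infinity>" using \<mu>(2) by (simp add: finite_measure.emeasure_finite less_top[symmetric])
  finally have fin\<nu>: "finite_measure \<nu>" by (intro finite_measureI) (simp add: sp)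
  have ac: "emeasure \<nu> A = 0" if "A \<in> sets M" "emeasure M A = 0" for A
  proof -
    have "A \<in> null_sets M" using that by auto
    then have "emeasure \<mu> A = 0" unfolding \<mu> using AE_not_in[of A M] that(1)
      by (subst emeasure_density) (auto simp: nn_integral_0_iff_AE elim!: eventually_mono)
    then show ?thesis using le[OF that(1)] by simp
  qed
  obtain n where n[measurable]: "n \<in> borel_measurable M" and n0: "\<And>z. 0 \<le> n z"
    and \<nu>: "\<nu> = density M (\<lambda>z. ennreal (n z))"
    using finite_real_density[OF M fin\<nu> sets(3) ac] by metis
  have "density M (\<lambda>z. ennreal (x z)) = density M (\<lambda>z. ennreal (y z) * ennreal (f z) + ennreal (n z))"
  proof (rule measure_eqI)
    fix A assume "A \<in> sets (density M (\<lambda>z. ennreal (x z)))"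
    then have A[measurable]: "A \<in> sets M" by simp
    show "emeasure (density M (\<lambda>z. ennreal (x z))) A = emeasure (density M (\<lambda>z. ennreal (y z) * ennreal (f z) + ennreal (n z))) A"
      unfolding \<mu>(1)[symmetric] dec[OF A] unfolding \<nu> \<alpha>
      by (simp add: density_density_eq emeasure_density nn_integral_add distrib_right)
  qed simp
  then have eq: "AE z in M. ennreal (x z) = ennreal (y z) * ennreal (f z) + ennreal (n z)"
    by (intro density_unique) auto
  have yN: "AE z in M. z \<in> N \<longrightarrow> y z = 0"
    using N0(1) nn unfolding \<alpha> by (subst (asm) emeasure_density)
      (auto simp: nn_integral_0_iff_AE indicator_def ennreal_eq_0_iff elim!: eventually_mono intro: antisym)
  have nN: "AE z in M. z \<notin> N \<longrightarrow> n z = 0"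
    using N0(2) n0 AE_space unfolding \<nu> by (subst (asm) emeasure_density)
      (auto simp: nn_integral_0_iff_AE indicator_def ennreal_eq_0_iff elim!: eventually_elim2 intro: antisym)
  have "phi_divergence \<phi> \<mu> \<alpha> = (\<integral>\<^sup>+z. \<phi> (f z) \<partial>\<alpha>) + recession \<phi> * emeasure \<nu> (space \<nu>)"
    unfolding phi_divergence_def Let_def p_def[symmetric] p by simp
  also have "emeasure \<nu> (space \<nu>) = (\<integral>\<^sup>+z. ennreal (n z) \<partial>M)"
    unfolding sp unfolding \<nu> by (subst emeasure_density) (auto intro!: nn_integral_cong)
  also have "(\<integral>\<^sup>+z. \<phi> (f z) \<partial>\<alpha>) = (\<integral>\<^sup>+z. ennreal (y z) * \<phi> (f z) \<partial>M)"
    unfolding \<alpha> by (subst nn_integral_density) auto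
  also have "\<dots> + recession \<phi> * (\<integral>\<^sup>+z. ennreal (n z) \<partial>M) =
      (\<integral>\<^sup>+z. ennreal (y z) * \<phi> (f z) + recession \<phi> * ennreal (n z) \<partial>M)"
    by (simp add: nn_integral_add nn_integral_cmult)
  also have "\<dots> = (\<integral>\<^sup>+z. persp (x z) (y z) \<partial>M)"
  proof (rule nn_integral_cong_AE)
    show "AE z in M. ennreal (y z) * \<phi> (f z) + recession \<phi> * ennreal (n z) = persp (x z) (y z)"
      using eq yN nN
    proof eventually_elim
      case (elim z)
      have "ennreal (x z) = ennreal (y z * f z + n z)"
        using elim(1) nn f0 n0 by (simp add: ennreal_mult)
      then have x: "x z = y z * f z + n z"
        using nn f0 n0 by (subst (asm) ennreal_inj) auto
      show ?case
      proof (cases "z \<in> N")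
        case True
        then show ?thesis using x elim by (simp add: persp_def)
      next
        case False
        then show ?thesis using x elim nn(2)[of z] by (cases "y z = 0") (simp_all add: persp_def)
      qed
    qed
  qed
  finally show ?thesis .
qed

lemma phi_divergence_density_self:
  fixes p :: "'a \<Rightarrow> real"
  assumes \<alpha>: "finite_measure \<alpha>" and p[measurable]: "p \<in> borel_measurable \<alpha>" and nn: "\<And>z. 0 \<le> p z"
    and fin: "finite_measure (density \<alpha> (\<lambda>z. ennreal (p z)))"
  shows "phi_divergence \<phi> (density \<alpha> (\<lambda>z. ennreal (p z))) \<alpha> = (\<integral>\<^sup>+z. \<phi> (p z) \<partial>\<alpha>)"
proof -
  have "\<alpha> = density \<alpha> (\<lambda>z. ennreal 1)" by (simp add: density_1)
  then have "phi_divergence \<phi> (density \<alpha> (\<lambda>z. ennreal (p z))) \<alpha> = (\<integral>\<^sup>+z. persp (p z) 1 \<partial>\<alpha>)"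
    by (intro phi_divergence_density[OF \<alpha>] p nn fin) auto
  then show ?thesis by (simp add: persp_def)
qed

lemma phi_divergence_mix:
  assumes fin: "finite_measure \<mu>" "finite_measure \<mu>'" "finite_measure \<alpha>" "finite_measure \<alpha>'"
    and sets: "sets \<mu> = sets \<alpha>" "sets \<mu>' = sets \<alpha>" "sets \<alpha>' = sets \<alpha>" and t: "0 \<le> t" "t \<le> 1"
  shows "phi_divergence \<phi> (mix t \<mu> \<mu>') (mix t \<alpha> \<alpha>') \<le>
    ennreal t * phi_divergence \<phi> \<mu> \<alpha> + ennreal (1 - t) * phi_divergence \<phi> \<mu>' \<alpha>'"
proof -
  \<comment> \<open>A nested half mixture dominates all four measures at once.\<close>
  define M where "M = mix (1/2) (mix (1/2) \<mu> \<mu>') (mix (1/2) \<alpha> \<alpha>')"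
  have sM: "sets M = sets \<alpha>" using sets by (simp add: M_def)
  have fM: "finite_measure M" unfolding M_def by (intro finite_measure_mix fin) (auto simp: sets)
  have ac: "emeasure \<mu> A = 0" "emeasure \<mu>' A = 0" "emeasure \<alpha> A = 0" "emeasure \<alpha>' A = 0"
    if "A \<in> sets M" "emeasure M A = 0" for A
  proof -
    have "emeasure (mix (1/2) \<mu> \<mu>') A = 0" "emeasure (mix (1/2) \<alpha> \<alpha>') A = 0"
      using mix_half_null[of "mix (1/2) \<mu> \<mu>'" "mix (1/2) \<alpha> \<alpha>'" A] that sets by (auto simp: M_def)
    then show "emeasure \<mu> A = 0" "emeasure \<mu>' A = 0" "emeasure \<alpha> A = 0" "emeasure \<alpha>' A = 0"
      using mix_half_null[of \<mu> \<mu>' A] mix_half_null[of \<alpha> \<alpha>' A] that(1) sets sM by auto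
  qed
  obtain x where x[measurable]: "x \<in> borel_measurable M" "\<And>z. 0 \<le> (x z :: real)" "\<mu> = density M (\<lambda>z. ennreal (x z))"
    using finite_real_density[OF fM fin(1) _ ac(1)] sM sets by metis
  obtain x' where x'[measurable]: "x' \<in> borel_measurable M" "\<And>z. 0 \<le> (x' z :: real)" "\<mu>' = density M (\<lambda>z. ennreal (x' z))"
    using finite_real_density[OF fM fin(2) _ ac(2)] sM sets by metis
  obtain y where y[measurable]: "y \<in> borel_measurable M" "\<And>z. 0 \<le> (y z :: real)" "\<alpha> = density M (\<lambda>z. ennreal (y z))"
    using finite_real_density[OF fM fin(3) _ ac(3)] sM sets by metis
  obtain y' where y'[measurable]: "y' \<in> borel_measurable M" "\<And>z. 0 \<le> (y' z :: real)" "\<alpha>' = density M (\<lambda>z. ennreal (y' z))"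
    using finite_real_density[OF fM fin(4) _ ac(4)] sM sets by metis
  have nn: "0 \<le> t * x z + (1 - t) * x' z" "0 \<le> t * y z + (1 - t) * y' z" for z
    using t x(2) x'(2) y(2) y'(2) by auto
  have "phi_divergence \<phi> (mix t \<mu> \<mu>') (mix t \<alpha> \<alpha>') =
      (\<integral>\<^sup>+z. persp (t * x z + (1 - t) * x' z) (t * y z + (1 - t) * y' z) \<partial>M)"
  proof (rule phi_divergence_density[OF fM _ _ nn])
    show "finite_measure (mix t \<mu> \<mu>')" using fin sets by (intro finite_measure_mix) auto
    show "mix t \<mu> \<mu>' = density M (\<lambda>z. ennreal (t * x z + (1 - t) * x' z))"
      unfolding x(3) x'(3) using x x' by (intro mix_density t) auto
    show "mix t \<alpha> \<alpha>' = density M (\<lambda>z. ennreal (t * y z + (1 - t) * y' z))"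
      unfolding y(3) y'(3) using y y' by (intro mix_density t) auto
  qed auto
  also have "\<dots> \<le> (\<integral>\<^sup>+z. ennreal t * persp (x z) (y z) + ennreal (1 - t) * persp (x' z) (y' z) \<partial>M)"
  proof (rule nn_integral_mono)
    fix z
    have "persp (t * x z + (1 - t) * x' z) (t * y z + (1 - t) * y' z) \<le>
        persp (t * x z) (t * y z) + persp ((1 - t) * x' z) ((1 - t) * y' z)"
      using t x(2) x'(2) y(2) y'(2) by (intro persp_add) auto
    also have "\<dots> = ennreal t * persp (x z) (y z) + ennreal (1 - t) * persp (x' z) (y' z)"
      using t x(2) x'(2) y(2) y'(2) by (simp add: persp_scale)
    finally show "persp (t * x z + (1 - t) * x' z) (t * y z + (1 - t) * y' z) \<le>
        ennreal t * persp (x z) (y z) + ennreal (1 - t) * persp (x' z) (y' z)" .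
  qed
  also have "\<dots> = ennreal t * (\<integral>\<^sup>+z. persp (x z) (y z) \<partial>M) + ennreal (1 - t) * (\<integral>\<^sup>+z. persp (x' z) (y' z) \<partial>M)"
    by (simp add: nn_integral_add nn_integral_cmult)
  also have "(\<integral>\<^sup>+z. persp (x z) (y z) \<partial>M) = phi_divergence \<phi> \<mu> \<alpha>"
    by (rule phi_divergence_density[OF fM x(1) y(1) x(2) y(2) x(3) fin(1) y(3), symmetric])
  also have "(\<integral>\<^sup>+z. persp (x' z) (y' z) \<partial>M) = phi_divergence \<phi> \<mu>' \<alpha>'"
    by (rule phi_divergence_density[OF fM x'(1) y'(1) x'(2) y'(2) x'(3) fin(2) y'(3), symmetric])
  finally show ?thesis .
qed

text \<open>Weak duality for a single divergence: \<open>persp_ge\<close> is integrated against the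
  densities with respect to a common dominating measure.\<close>

lemma phi_divergence_ge:
  assumes fin: "finite_measure \<mu>" "finite_measure \<alpha>" and sets: "sets \<mu> = sets \<alpha>"
    and u: "integrable \<alpha> u" and F: "integrable \<mu> F"
    and feas: "\<And>z p. z \<in> space \<alpha> \<Longrightarrow> 0 \<le> p \<Longrightarrow> ennreal (u z - F z * p) \<le> \<phi> p"
  shows "ereal ((\<integral>z. u z \<partial>\<alpha>) - (\<integral>z. F z \<partial>\<mu>)) \<le> enn2ereal (phi_divergence \<phi> \<mu> \<alpha>)"
proof -
  define M where "M = mix (1/2) \<mu> \<alpha>"
  have sM: "sets M = sets \<alpha>" using sets by (simp add: M_def)
  have fM: "finite_measure M" unfolding M_def by (intro finite_measure_mix fin) (auto simp: sets)
  have ac: "emeasure \<mu> A = 0" "emeasure \<alpha> A = 0" if "A \<in> sets M" "emeasure M A = 0" for A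
    using mix_half_null[of \<mu> \<alpha> A] that sets by (auto simp: M_def)
  obtain x where x[measurable]: "x \<in> borel_measurable M" "\<And>z. 0 \<le> (x z :: real)" "\<mu> = density M (\<lambda>z. ennreal (x z))"
    using finite_real_density[OF fM fin(1) _ ac(1)] sM sets by metis
  obtain y where y[measurable]: "y \<in> borel_measurable M" "\<And>z. 0 \<le> (y z :: real)" "\<alpha> = density M (\<lambda>z. ennreal (y z))"
    using finite_real_density[OF fM fin(2) _ ac(2)] sM sets by metis
  have m[measurable]: "u \<in> borel_measurable M" "F \<in> borel_measurable M"
    using borel_measurable_integrable[OF u] borel_measurable_integrable[OF F] sM sets by (auto cong: measurable_cong_sets)
  have iu: "integrable M (\<lambda>z. y z * u z)" and iF: "integrable M (\<lambda>z. x z * F z)"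
    using u F y(2) x(2) unfolding y(3) x(3) by (auto simp: integrable_density)
  have iw: "integrable M (\<lambda>z. u z * y z - F z * x z)" using iu iF by (simp add: mult.commute)
  have "(\<integral>z. u z \<partial>\<alpha>) - (\<integral>z. F z \<partial>\<mu>) = (\<integral>z. u z * y z - F z * x z \<partial>M)"
    unfolding y(3) x(3) using iu iF x(2) y(2) by (simp add: integral_density mult.commute)
  \<comment> \<open>\<open>ennreal\<close> truncates negative values, so the right-hand side
    integrates the positive part, which is at least the signed integral.\<close>
  also have "ereal \<dots> \<le> enn2ereal (\<integral>\<^sup>+z. ennreal (u z * y z - F z * x z) \<partial>M)"
  proof -
    let ?w = "\<lambda>z. u z * y z - F z * x z"
    have "(\<integral>z. ?w z \<partial>M) \<le> (\<integral>z. max 0 (?w z) \<partial>M)" using iw by (intro integral_mono) auto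
    moreover have "(\<integral>\<^sup>+z. ennreal (?w z) \<partial>M) = (\<integral>\<^sup>+z. ennreal (max 0 (?w z)) \<partial>M)"
      by (intro nn_integral_cong) (auto simp: max_def ennreal_neg)
    moreover have "\<dots> = ennreal (\<integral>z. max 0 (?w z) \<partial>M)" using iw by (intro nn_integral_eq_integral) auto
    ultimately show ?thesis by (simp add: enn2ereal_ennreal)
  qed
  also have "(\<integral>\<^sup>+z. ennreal (u z * y z - F z * x z) \<partial>M) \<le> (\<integral>\<^sup>+z. persp (x z) (y z) \<partial>M)"
    using feas x(2) y(2) sets_eq_imp_space_eq[OF sM] by (intro nn_integral_mono persp_ge) auto
  also have "\<dots> = phi_divergence \<phi> \<mu> \<alpha>"
    by (rule phi_divergence_density[OF fM x(1) y(1) x(2) y(2) x(3) fin(1) y(3), symmetric])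
  finally show ?thesis by (simp add: less_eq_ennreal.rep_eq)
qed

end

subsection \<open>The Kullback--Leibler divergence as a \<open>\<phi>\<close>-divergence\<close>

text \<open>Writing KL as the divergence of this entropy lets the convexity and duality results
  above cover it. The convention for \<open>ln 0\<close> does not matter, since it is multiplied by
  0; the value at 0 is 1.\<close>

definition kl_entropy :: "real \<Rightarrow> ennreal" where
  "kl_entropy p = (if 0 \<le> p then ennreal (p * ln p - p + 1) else \<infinity>)"

text \<open>This is exp z \<ge> 1 + z at z = s - ln p, multiplied by p. Equality holds at s = ln p
  when p > 0, so the entropy is a supremum of affine functions with slopes s.\<close>

lemma kl_Fenchel:
  assumes "0 \<le> (p::real)"
  shows "p * s - exp s + 1 \<le> p * ln p - p + 1"
proof (cases "p = 0")
  case False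
  then have p: "0 < p" using assms by simp
  have "p * (1 + (s - ln p)) \<le> p * exp (s - ln p)"
    using p exp_ge_add_one_self[of "s - ln p"] by (intro mult_left_mono) auto
  also have "\<dots> = exp s" using p by (simp add: exp_diff)
  finally show ?thesis by (simp add: algebra_simps)
qed simp

lemma kl_nonneg: "0 \<le> (p::real) \<Longrightarrow> 0 \<le> p * ln p - p + 1"
  using kl_Fenchel[of p 0] by simp

lemma kl_entropy_ge: "ennreal (p * s - exp s + 1) \<le> kl_entropy p"
  using kl_Fenchel[of p s] unfolding kl_entropy_def by (auto intro!: ennreal_leI)

text \<open>Convexity and lower semicontinuity are both read off from the representation as a
  supremum of the affine functions in \<open>kl_Fenchel\<close>.\<close>

lemma entropy_function_kl: "entropy_function kl_entropy"
  unfolding entropy_function_def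
proof (intro conjI allI impI)
  fix x y t :: real assume t: "0 \<le> t \<and> t \<le> 1"
  show "kl_entropy (t * x + (1 - t) * y) \<le> ennreal t * kl_entropy x + ennreal (1 - t) * kl_entropy y"
  proof -
    consider "t = 0" | "t = 1" | "0 < t" "t < 1" "x < 0 \<or> y < 0" | "0 < t" "t < 1" "0 \<le> x" "0 \<le> y"
      using t by fastforce
    then show ?thesis
    proof cases
      case 3
      then show ?thesis by (auto simp: kl_entropy_def ennreal_mult_top)
    next
      case 4
      let ?k = "\<lambda>p::real. p * ln p - p + 1" and ?z = "t * x + (1 - t) * y"
      have z: "0 \<le> ?z" using 4 by simp
      have "?k ?z \<le> t * ?k x + (1 - t) * ?k y"
      proof (cases "?z = 0")
        case True
        then have "t * x = 0" "(1 - t) * y = 0" using 4 by (smt (verit) mult_nonneg_nonneg)+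
        then have "x = 0" "y = 0" using 4 by auto
        then show ?thesis by simp
      next
        case False
        \<comment> \<open>The slope of the tangent at the mixed point, for which
          \<open>kl_Fenchel\<close> is an equality there.\<close>
        define s where "s = ln ?z"
        have "?k ?z = ?z * s - exp s + 1" using z False by (simp add: s_def)
        also have "\<dots> = t * (x * s - exp s + 1) + (1 - t) * (y * s - exp s + 1)" by (simp add: algebra_simps)
        also have "\<dots> \<le> t * ?k x + (1 - t) * ?k y"
          using 4 by (intro add_mono mult_left_mono kl_Fenchel) auto
        finally show ?thesis .
      qed
      then have "ennreal (?k ?z) \<le> ennreal t * ennreal (?k x) + ennreal (1 - t) * ennreal (?k y)"
        using 4 kl_nonneg[of x] kl_nonneg[of y] by (simp add: ennreal_mult[symmetric] ennreal_plus[symmetric] del: ennreal_plus)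
      then show ?thesis using 4 z unfolding kl_entropy_def by simp
    qed auto
  qed
next
  fix x :: real
  show "kl_entropy x \<le> Liminf (at x) kl_entropy"
    unfolding le_Liminf_iff
  proof (intro allI impI)
    fix c assume c: "c < kl_entropy x"
    show "\<forall>\<^sub>F y in at x. c < kl_entropy y"
    proof (cases "x < 0")
      case True
      then have "\<forall>\<^sub>F y in at x. y < 0" by (intro order_tendstoD[of _ x]) auto
      moreover have "c < \<infinity>" using c by (auto simp: less_top[symmetric])
      ultimately show ?thesis by (auto elim!: eventually_mono simp: kl_entropy_def)
    next
      case False
      obtain r where r: "c = ennreal r" "0 \<le> r" using c by (cases c) auto
      have "\<exists>s. r < x * s - exp s + 1"
      proof (cases "x = 0")
        case True
        then have "ennreal r < ennreal 1" using c r by (simp add: kl_entropy_def)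
        then have "r < 1" using r by (subst (asm) ennreal_less_iff) auto
        \<comment> \<open>At p = 0 the supremum 1 of 1 - exp s is not attained; exp s = (1 - r) / 2
          gives the value (1 + r) / 2 > r.\<close>
        then show ?thesis using True by (intro exI[of _ "ln ((1 - r) / 2)"]) (simp add: field_simps)
      next
        case 2: False
        then show ?thesis using False c r by (intro exI[of _ "ln x"]) (simp add: kl_entropy_def ennreal_less_iff)
      qed
      then obtain s where s: "r < x * s - exp s + 1" by blast
      have "((\<lambda>y. y * s - exp s + 1) \<longlongrightarrow> x * s - exp s + 1) (at x)" by (intro tendsto_intros)
      then have "\<forall>\<^sub>F y in at x. r < y * s - exp s + 1" using s by (rule order_tendstoD)
      then show ?thesis
      proof (rule eventually_mono)
        fix y assume "r < y * s - exp s + 1"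
        then have "ennreal r < ennreal (y * s - exp s + 1)" using r by (simp add: ennreal_less_iff)
        then show "c < kl_entropy y" using r kl_entropy_ge[of y s] by simp
      qed
    qed
  qed
qed (auto simp: kl_entropy_def)

interpretation kl: entropy kl_entropy
  by unfold_locales (rule entropy_function_kl)

text \<open>This is \<open>phi_divergence_ge\<close> for the pair u = 1 - exp T, F = - T, whose
  minorant property is \<open>kl_entropy_ge\<close> with s = T.\<close>

lemma kl_divergence_ge:
  assumes "finite_measure \<pi>" "finite_measure \<nu>" "sets \<pi> = sets \<nu>"
    and T: "integrable \<pi> T" and e: "integrable \<nu> (\<lambda>z. exp (T z))"
  shows "ereal (mass \<nu> - (\<integral>z. exp (T z) \<partial>\<nu>) + (\<integral>z. T z \<partial>\<pi>)) \<le> enn2ereal (phi_divergence kl_entropy \<pi> \<nu>)"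
proof -
  interpret n: finite_measure \<nu> by fact
  have "ereal ((\<integral>z. 1 - exp (T z) \<partial>\<nu>) - (\<integral>z. - T z \<partial>\<pi>)) \<le> enn2ereal (phi_divergence kl_entropy \<pi> \<nu>)"
    using assms kl_entropy_ge by (intro kl.phi_divergence_ge) (auto simp: algebra_simps)
  then show ?thesis using e by (simp add: Bochner_Integration.integral_diff)
qed

text \<open>In the absolutely continuous case all terms are moved to the side where they are
  nonnegative, giving an identity in \<open>ennreal\<close> that remains valid when the positive
  part is infinite; only then is it converted to \<open>ereal\<close>. In the other case both sides
  are infinite.\<close>

lemma KL_eq_divergence:
  assumes fin: "finite_measure \<pi>" "finite_measure \<nu>" and sets: "sets \<pi> = sets \<nu>"
  shows "KL \<pi> \<nu> = enn2ereal (phi_divergence kl_entropy \<pi> \<nu>)"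
proof (cases "absolutely_continuous \<nu> \<pi>")
  case True
  interpret n: finite_measure \<nu> by fact
  interpret p: finite_measure \<pi> by fact
  obtain r where r[measurable]: "r \<in> borel_measurable \<nu>" and r0: "\<And>z. 0 \<le> (r z :: real)"
    and \<pi>: "\<pi> = density \<nu> (\<lambda>z. ennreal (r z))"
    using finite_real_density[OF fin(2,1) sets] True sets
    by (auto simp: absolutely_continuous_def null_sets_def)
  have RN: "AE z in \<nu>. ennreal (r z) = RN_deriv \<nu> \<pi> z"
    using n.RN_deriv_unique[of "\<lambda>z. ennreal (r z)" \<pi>] by (simp add: \<pi>)
  define P N D where "P = (\<integral>\<^sup>+z. ennreal (r z * ln (r z)) \<partial>\<nu>)"
    and "N = (\<integral>\<^sup>+z. ennreal (- (r z * ln (r z))) \<partial>\<nu>)" and "D = (\<integral>\<^sup>+z. kl_entropy (r z) \<partial>\<nu>)"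
  have "(\<integral>\<^sup>+z. ennreal (s * ln (enn2real (RN_deriv \<nu> \<pi> z))) \<partial>\<pi>) = (\<integral>\<^sup>+z. ennreal (s * (r z * ln (r z))) \<partial>\<nu>)" for s
  proof -
    have "(\<integral>\<^sup>+z. ennreal (s * ln (enn2real (RN_deriv \<nu> \<pi> z))) \<partial>\<pi>) =
        (\<integral>\<^sup>+z. ennreal (r z) * ennreal (s * ln (enn2real (RN_deriv \<nu> \<pi> z))) \<partial>\<nu>)"
      by (subst (1) \<pi>, subst nn_integral_density) auto
    also have "\<dots> = (\<integral>\<^sup>+z. ennreal (s * (r z * ln (r z))) \<partial>\<nu>)"
    proof (rule nn_integral_cong_AE)
      show "AE z in \<nu>. ennreal (r z) * ennreal (s * ln (enn2real (RN_deriv \<nu> \<pi> z))) = ennreal (s * (r z * ln (r z)))"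
        using RN
      proof eventually_elim
        case (elim z)
        have "ennreal (r z) * ennreal (s * ln (r z)) = ennreal (r z * (s * ln (r z)))"
          using r0 by (rule ennreal_mult'[symmetric])
        moreover have "enn2real (RN_deriv \<nu> \<pi> z) = r z" using elim r0[of z] by (metis enn2real_ennreal)
        ultimately show ?case by (simp add: mult.left_commute)
      qed
    qed
    finally show ?thesis .
  qed
  \<comment> \<open>The factors s = 1 and s = -1 yield the positive and the negative part of the
    logarithmic integral.\<close>
  from this[of 1] this[of "-1"] have ext: "ext_integral \<pi> (\<lambda>z. ln (enn2real (RN_deriv \<nu> \<pi> z))) = enn2ereal P - enn2ereal N"
    by (simp add: ext_integral_def P_def N_def)
  \<comment> \<open>From r ln r - r + 1 \<ge> 0 the negative part of r ln r is at most 1, hence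
    integrable for a finite measure.\<close>
  have "N \<le> (\<integral>\<^sup>+z. ennreal 1 \<partial>\<nu>)" unfolding N_def
  proof (rule nn_integral_mono)
    show "ennreal (- (r z * ln (r z))) \<le> ennreal 1" for z
      using kl_nonneg[OF r0[of z]] r0[of z] by (intro ennreal_leI) linarith
  qed
  then have "N \<noteq> \<infinity>" using n.emeasure_finite by (auto simp: top_unique)
  then obtain n where n: "N = ennreal n" "0 \<le> n" by (cases N) auto
  have m\<pi>: "ennreal (mass \<pi>) = (\<integral>\<^sup>+z. ennreal (r z) \<partial>\<nu>)"
    unfolding p.emeasure_eq_measure[symmetric] unfolding \<pi>
    by (subst emeasure_density) (auto intro!: nn_integral_cong)
  have "D + N + ennreal (mass \<pi>) = (\<integral>\<^sup>+z. kl_entropy (r z) + ennreal (- (r z * ln (r z))) + ennreal (r z) \<partial>\<nu>)"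
    by (simp add: D_def N_def m\<pi> nn_integral_add)
  also have "\<dots> = (\<integral>\<^sup>+z. ennreal (r z * ln (r z)) + 1 \<partial>\<nu>)"
  proof (rule nn_integral_cong)
    fix z
    show "kl_entropy (r z) + ennreal (- (r z * ln (r z))) + ennreal (r z) = ennreal (r z * ln (r z)) + 1"
    proof (cases "0 \<le> r z * ln (r z)")
      case True
      then show ?thesis using r0[of z] kl_nonneg[OF r0[of z]]
        by (simp add: kl_entropy_def ennreal_neg ennreal_plus[symmetric] ennreal_1[symmetric] del: ennreal_plus ennreal_1)
    next
      case False
      then show ?thesis using r0[of z] kl_nonneg[OF r0[of z]]
        by (simp add: kl_entropy_def ennreal_neg ennreal_plus[symmetric] ennreal_1[symmetric] del: ennreal_plus ennreal_1)
    qed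
  qed
  also have "\<dots> = P + ennreal (mass \<nu>)"
    by (simp add: P_def nn_integral_add n.emeasure_eq_measure)
  finally have key: "D + ennreal n + ennreal (mass \<pi>) = P + ennreal (mass \<nu>)" by (simp add: n)
  have "phi_divergence kl_entropy \<pi> \<nu> = D"
    unfolding \<pi> D_def using fin(1) r0 by (intro kl.phi_divergence_density_self fin) (auto simp: \<pi>)
  moreover have "enn2ereal P - enn2ereal N - ereal (mass \<pi>) + ereal (mass \<nu>) = enn2ereal D"
  proof (cases P)
    case (real p)
    then have "D \<noteq> \<infinity>" using key by (auto simp: ennreal_plus[symmetric] simp del: ennreal_plus)
    then obtain d where d: "D = ennreal d" "0 \<le> d" by (cases D) auto
    have "d + n + mass \<pi> = p + mass \<nu>"
      using key d n real by (simp add: ennreal_plus[symmetric] del: ennreal_plus)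
    then show ?thesis using d n real by (simp add: enn2ereal_ennreal)
  next
    case top
    then have "D = \<infinity>" using key by (cases D) (auto simp: ennreal_plus[symmetric] simp del: ennreal_plus)
    then show ?thesis using top n by (simp add: enn2ereal_ennreal)
  qed
  ultimately show ?thesis using True by (simp add: KL_def ext)
next
  case False
  then obtain A where A: "A \<in> sets \<nu>" "emeasure \<nu> A = 0" "emeasure \<pi> A \<noteq> 0"
    using sets by (auto simp: absolutely_continuous_def null_sets_def)
  interpret n: finite_measure \<nu> by fact
  interpret p: finite_measure \<pi> by fact
  have [measurable]: "A \<in> sets \<nu>" "A \<in> sets \<pi>" using A sets by auto
  have pos: "0 < measure \<pi> A" using A(3) by (simp add: p.emeasure_eq_measure zero_less_measure_iff)
  \<comment> \<open>The test function K times the indicator of A is invisible to \<nu>, but its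
    \<pi>-integral grows without bound in K.\<close>
  have "ereal (K * measure \<pi> A) \<le> enn2ereal (phi_divergence kl_entropy \<pi> \<nu>)" for K
  proof -
    have "AE z in \<nu>. z \<notin> A" using A(1,2) by (intro AE_not_in) (auto simp: null_sets_def)
    then have ae: "AE z in \<nu>. exp (K * indicator A z) = (1::real)" by eventually_elim simp
    have "integrable \<nu> (\<lambda>z. exp (K * indicator A z :: real))"
      by (subst integrable_cong_AE[OF _ _ ae]) auto
    moreover have "(\<integral>z. exp (K * indicator A z) \<partial>\<nu>) = mass \<nu>"
      by (subst integral_cong_AE[OF _ _ ae]) auto
    moreover have "integrable \<pi> (\<lambda>z. K * indicator A z :: real)"
      by (intro integrable_mult_right integrable_real_indicator) (auto simp: p.emeasure_eq_measure)
    ultimately show ?thesis using kl_divergence_ge[OF fin sets, of "\<lambda>z. K * indicator A z"] sets.sets_into_space[of A \<pi>]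
      by (simp add: Int_absorb2)
  qed
  then have *: "ereal b \<le> enn2ereal (phi_divergence kl_entropy \<pi> \<nu>)" for b
    using pos by (metis less_irrefl nonzero_divide_eq_eq times_divide_eq_left)
  have "enn2ereal (phi_divergence kl_entropy \<pi> \<nu>) = \<infinity>" by (rule ereal_top) (rule *)
  then show ?thesis using False by (simp add: KL_def)
qed

lemma KL_density:
  assumes fin: "finite_measure \<nu>" and T[measurable]: "T \<in> borel_measurable \<nu>" and bd: "\<And>z. z \<in> space \<nu> \<Longrightarrow> \<bar>T z\<bar> \<le> c"
  shows "KL (density \<nu> (\<lambda>z. ennreal (exp (T z)))) \<nu> =
    ereal ((\<integral>z. exp (T z) * T z \<partial>\<nu>) - (\<integral>z. exp (T z) \<partial>\<nu>) + mass \<nu>)"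
proof -
  interpret n: finite_measure \<nu> by fact
  let ?\<pi> = "density \<nu> (\<lambda>z. ennreal (exp (T z)))"
  have be: "exp (T z) \<le> exp c" if "z \<in> space \<nu>" for z using bd[OF that] by simp
  have i1: "integrable \<nu> (\<lambda>z. exp (T z))"
    using be by (intro n.integrable_const_bound[where B="exp c"]) auto
  have i2: "integrable \<nu> (\<lambda>z. exp (T z) * T z)"
    using be bd by (intro n.integrable_const_bound[where B="exp c * c"]) (auto simp: abs_mult intro!: mult_mono)
  have "(\<integral>\<^sup>+z. ennreal (exp (T z)) \<partial>\<nu>) = ennreal (\<integral>z. exp (T z) \<partial>\<nu>)"
    using i1 by (intro nn_integral_eq_integral) auto
  then have "emeasure ?\<pi> (space ?\<pi>) = ennreal (\<integral>z. exp (T z) \<partial>\<nu>)"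
    by (subst emeasure_density) (auto simp: nn_integral_cong[of \<nu> "\<lambda>z. ennreal (exp (T z)) * indicator (space \<nu>) z" "\<lambda>z. ennreal (exp (T z))"])
  then have f\<pi>: "finite_measure ?\<pi>" by (intro finite_measureI) simp
  have "KL ?\<pi> \<nu> = enn2ereal (\<integral>\<^sup>+z. kl_entropy (exp (T z)) \<partial>\<nu>)"
    using f\<pi> fin by (simp add: KL_eq_divergence kl.phi_divergence_density_self)
  also have "(\<integral>\<^sup>+z. kl_entropy (exp (T z)) \<partial>\<nu>) = (\<integral>\<^sup>+z. ennreal (exp (T z) * T z - exp (T z) + 1) \<partial>\<nu>)"
    by (simp add: kl_entropy_def)
  also have "\<dots> = ennreal (\<integral>z. exp (T z) * T z - exp (T z) + 1 \<partial>\<nu>)"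
    using i1 i2 kl_nonneg[of "exp (T _)"] by (intro nn_integral_eq_integral) auto
  also have "enn2ereal \<dots> = ereal (\<integral>z. exp (T z) * T z - exp (T z) + 1 \<partial>\<nu>)"
    using kl_nonneg[of "exp (T _)"] by (intro enn2ereal_ennreal integral_nonneg) auto
  also have "(\<integral>z. exp (T z) * T z - exp (T z) + 1 \<partial>\<nu>) = (\<integral>z. exp (T z) * T z \<partial>\<nu>) - (\<integral>z. exp (T z) \<partial>\<nu>) + mass \<nu>"
    using i1 i2 by simp
  finally show ?thesis .
qed

subsection \<open>Weak duality and convexity of the transport cost\<close>

lemma bounded_integrable:
  fixes f :: "'a \<Rightarrow> real"
  assumes "finite_measure M" "f \<in> borel_measurable M" "\<And>z. z \<in> space M \<Longrightarrow> \<bar>f z\<bar> \<le> K"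
  shows "integrable M f"
  using assms by (intro finite_measure.integrable_const_bound[of M f K]) auto

lemma finite_measure_pair:
  assumes "finite_measure \<alpha>" "finite_measure \<beta>"
  shows "finite_measure (\<alpha> \<Otimes>\<^sub>M \<beta>)"
proof
  interpret b: finite_measure \<beta> by fact
  interpret a: finite_measure \<alpha> by fact
  show "emeasure (\<alpha> \<Otimes>\<^sub>M \<beta>) (space (\<alpha> \<Otimes>\<^sub>M \<beta>)) \<noteq> \<infinity>"
    by (simp add: space_pair_measure b.emeasure_pair_measure_Times a.emeasure_eq_measure b.emeasure_eq_measure
        ennreal_mult[symmetric])
qed

lemma mass_pair:
  assumes "finite_measure \<alpha>" "finite_measure \<beta>"
  shows "mass (\<alpha> \<Otimes>\<^sub>M \<beta>) = mass \<alpha> * mass \<beta>"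
proof -
  interpret b: finite_measure \<beta> by fact
  interpret a: finite_measure \<alpha> by fact
  interpret p: finite_measure "\<alpha> \<Otimes>\<^sub>M \<beta>" by (intro finite_measure_pair assms)
  have "ennreal (mass (\<alpha> \<Otimes>\<^sub>M \<beta>)) = ennreal (mass \<alpha> * mass \<beta>)"
    unfolding p.emeasure_eq_measure[symmetric] 
    by (simp add: space_pair_measure b.emeasure_pair_measure_Times a.emeasure_eq_measure b.emeasure_eq_measure ennreal_mult)
  then show ?thesis by (subst (asm) ennreal_inj) auto
qed

locale ot_problem = entropy \<phi> for \<phi> +
  fixes X :: "'a::metric_space set" and C :: "'a \<Rightarrow> 'a \<Rightarrow> real" and \<epsilon> :: real
  assumes compact: "compact X" and cont: "continuous_on (X \<times> X) (\<lambda>(x, y). C x y)"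
    and eps: "0 < \<epsilon>"
begin

abbreviation B :: "'a measure" where "B \<equiv> restrict_space borel X"

definition cmax :: real where "cmax = (SOME c. \<forall>x\<in>X. \<forall>y\<in>X. \<bar>C x y\<bar> \<le> c)"

lemma C_bound: "x \<in> X \<Longrightarrow> y \<in> X \<Longrightarrow> \<bar>C x y\<bar> \<le> cmax"
proof -
  have "bounded ((\<lambda>(x, y). C x y) ` (X \<times> X))"
    using compact cont by (intro compact_imp_bounded compact_continuous_image compact_Times) auto
  then have "\<exists>c. \<forall>x\<in>X. \<forall>y\<in>X. \<bar>C x y\<bar> \<le> c" by (auto simp: bounded_iff)
  from someI_ex[OF this] show "x \<in> X \<Longrightarrow> y \<in> X \<Longrightarrow> \<bar>C x y\<bar> \<le> cmax" by (auto simp: cmax_def)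
qed

lemma C_measurable [measurable]: "(\<lambda>z. C (fst z) (snd z)) \<in> borel_measurable (B \<Otimes>\<^sub>M B)"
proof -
  have "(\<lambda>z. C (fst z) (snd z)) \<in> borel_measurable (restrict_space borel (X \<times> X))"
    using cont by (intro borel_measurable_continuous_on_restrict) (simp add: case_prod_unfold)
  then show ?thesis
    using sets_restrict_borel_Times[OF compact] by (simp cong: measurable_cong_sets)
qed

lemma Mplus_pair_sets:
  "\<pi> \<in> Mplus (X \<times> X) \<Longrightarrow> \<alpha> \<in> Mplus X \<Longrightarrow> \<beta> \<in> Mplus X \<Longrightarrow> sets \<pi> = sets (\<alpha> \<Otimes>\<^sub>M \<beta>)"
  using sets_restrict_borel_Times[OF compact] by (simp add: Mplus_def cong: sets_pair_measure_cong)

lemma Mplus_marginals: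
  assumes "\<pi> \<in> Mplus (X \<times> X)"
  shows "fst \<in> \<pi> \<rightarrow>\<^sub>M B" "snd \<in> \<pi> \<rightarrow>\<^sub>M B" "finite_measure (distr \<pi> B fst)" "finite_measure (distr \<pi> B snd)"
proof -
  have s[measurable_cong]: "sets \<pi> = sets (B \<Otimes>\<^sub>M B)"
    using assms sets_restrict_borel_Times[OF compact] by (simp add: Mplus_def)
  interpret finite_measure \<pi> using assms by (rule Mplus_finite)
  show m: "fst \<in> \<pi> \<rightarrow>\<^sub>M B" "snd \<in> \<pi> \<rightarrow>\<^sub>M B" by measurable
  then show "finite_measure (distr \<pi> B fst)" "finite_measure (distr \<pi> B snd)"
    by (auto intro: finite_measure_distr)
qed

text \<open>All three penalties are nonnegative and are added in \<open>ennreal\<close>; the signed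
  cost stays a separate real number, so infinities of opposite sign never meet.\<close>

definition penalty :: "('a \<times> 'a) measure \<Rightarrow> 'a measure \<Rightarrow> 'a measure \<Rightarrow> ennreal" where
  "penalty \<pi> \<alpha> \<beta> = phi_divergence \<phi> (distr \<pi> B fst) \<alpha> + phi_divergence \<phi> (distr \<pi> B snd) \<beta> +
     ennreal \<epsilon> * phi_divergence kl_entropy \<pi> (\<alpha> \<Otimes>\<^sub>M \<beta>)"

lemma OT_eq:
  assumes \<alpha>: "\<alpha> \<in> Mplus X" and \<beta>: "\<beta> \<in> Mplus X"
  shows "OT X C \<epsilon> \<phi> \<alpha> \<beta> =
    (INF \<pi>\<in>Mplus (X \<times> X). ereal (\<integral>z. C (fst z) (snd z) \<partial>\<pi>) + enn2ereal (penalty \<pi> \<alpha> \<beta>))"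
  unfolding OT_def
proof (rule INF_cong[OF refl])
  fix \<pi> assume \<pi>: "\<pi> \<in> Mplus (X \<times> X)"
  have "KL \<pi> (\<alpha> \<Otimes>\<^sub>M \<beta>) = enn2ereal (phi_divergence kl_entropy \<pi> (\<alpha> \<Otimes>\<^sub>M \<beta>))"
    using \<pi> \<alpha> \<beta> by (intro KL_eq_divergence finite_measure_pair Mplus_pair_sets) (auto dest: Mplus_finite)
  then show "ereal (LINT (x, y)|\<pi>. C x y) + enn2ereal (phi_divergence \<phi> (distr \<pi> B fst) \<alpha>)
      + enn2ereal (phi_divergence \<phi> (distr \<pi> B snd) \<beta>) + ereal \<epsilon> * KL \<pi> (\<alpha> \<Otimes>\<^sub>M \<beta>) =
      ereal (\<integral>z. C (fst z) (snd z) \<partial>\<pi>) + enn2ereal (penalty \<pi> \<alpha> \<beta>)"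
    using eps by (simp add: penalty_def plus_ennreal.rep_eq times_ennreal.rep_eq enn2ereal_ennreal case_prod_unfold add.assoc)
qed

text \<open>Here f is the potential in units of \<epsilon>, and u is a minorant of minus the
  conjugate of \<phi> at -\<epsilon> f. Leaving u free avoids a measurability argument for the
  conjugate. Truncation by \<open>ennreal\<close> is harmless because \<phi> \<ge> 0.\<close>

definition dual_pair :: "('a \<Rightarrow> real) \<Rightarrow> ('a \<Rightarrow> real) \<Rightarrow> bool" where
  "dual_pair f u \<longleftrightarrow> f \<in> borel_measurable B \<and> u \<in> borel_measurable B \<and>
     (\<exists>K. \<forall>x\<in>X. \<bar>f x\<bar> \<le> K \<and> \<bar>u x\<bar> \<le> K) \<and>
     (\<forall>x\<in>X. \<forall>p\<ge>0. ennreal (u x - \<epsilon> * f x * p) \<le> \<phi> p)"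

lemma dual_pair_0: "dual_pair (\<lambda>_. 0) (\<lambda>_. 0)"
  by (auto simp: dual_pair_def)

definition soft_mass :: "('a \<Rightarrow> real) \<Rightarrow> ('a \<Rightarrow> real) \<Rightarrow> 'a measure \<Rightarrow> 'a measure \<Rightarrow> real" where
  "soft_mass f g \<alpha> \<beta> = (\<integral>z. exp (f (fst z) + g (snd z) - C (fst z) (snd z) / \<epsilon>) \<partial>(\<alpha> \<Otimes>\<^sub>M \<beta>))"

text \<open>Each penalty is bounded below by its Fenchel inequality, with test function T = f + g -
  C / \<epsilon> for KL. The integrals of f, g and C against the plan then cancel, so the bound is
  the same for every plan.\<close>

theorem OT_ge:
  assumes \<alpha>: "\<alpha> \<in> Mplus X" and \<beta>: "\<beta> \<in> Mplus X" and fu: "dual_pair f u" and gv: "dual_pair g v"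
  shows "ereal ((\<integral>x. u x \<partial>\<alpha>) + (\<integral>y. v y \<partial>\<beta>) + \<epsilon> * (mass \<alpha> * mass \<beta>) - \<epsilon> * soft_mass f g \<alpha> \<beta>) \<le> OT X C \<epsilon> \<phi> \<alpha> \<beta>"
  unfolding OT_eq[OF \<alpha> \<beta>]
proof (rule INF_greatest)
  fix \<pi> assume \<pi>: "\<pi> \<in> Mplus (X \<times> X)"
  note [measurable_cong] = Mplus_sets[OF \<alpha>] Mplus_sets[OF \<beta>]
  have s\<pi>: "sets \<pi> = sets (\<alpha> \<Otimes>\<^sub>M \<beta>)" using \<pi> \<alpha> \<beta> by (rule Mplus_pair_sets)
  note fin = Mplus_finite[OF \<alpha>] Mplus_finite[OF \<beta>] Mplus_finite[OF \<pi>]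
  note sp = Mplus_space[OF \<alpha>] Mplus_space[OF \<beta>] Mplus_space[OF \<pi>]
  note mg = Mplus_marginals[OF \<pi>]
  have [measurable]: "f \<in> borel_measurable B" "u \<in> borel_measurable B" "g \<in> borel_measurable B" "v \<in> borel_measurable B"
    using fu gv by (auto simp: dual_pair_def)
  have fs: "ennreal (u x - \<epsilon> * f x * p) \<le> \<phi> p" "ennreal (v x - \<epsilon> * g x * p) \<le> \<phi> p" if "x \<in> X" "0 \<le> p" for x p
    using fu gv that by (auto simp: dual_pair_def)
  obtain K where K: "\<And>x. x \<in> X \<Longrightarrow> \<bar>f x\<bar> \<le> K \<and> \<bar>u x\<bar> \<le> K" using fu by (auto simp: dual_pair_def)
  obtain L where L: "\<And>x. x \<in> X \<Longrightarrow> \<bar>g x\<bar> \<le> L \<and> \<bar>v x\<bar> \<le> L" using gv by (auto simp: dual_pair_def)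
  have iu: "integrable \<alpha> u" using K sp by (intro bounded_integrable[OF fin(1), of _ K]) auto
  have iv: "integrable \<beta> v" using L sp by (intro bounded_integrable[OF fin(2), of _ L]) auto
  have if1: "integrable (distr \<pi> B fst) f"
    using K by (intro bounded_integrable[OF mg(3), of _ K]) (auto simp: space_restrict_space)
  have ig1: "integrable (distr \<pi> B snd) g"
    using L by (intro bounded_integrable[OF mg(4), of _ L]) (auto simp: space_restrict_space)
  have mpi[measurable]: "(\<lambda>z. C (fst z) (snd z)) \<in> borel_measurable \<pi>"
    "(\<lambda>z. f (fst z)) \<in> borel_measurable \<pi>" "(\<lambda>z. g (snd z)) \<in> borel_measurable \<pi>"
    unfolding measurable_cong_sets[OF s\<pi> refl] by measurable
  have ifp: "integrable \<pi> (\<lambda>z. f (fst z))" using K sp by (intro bounded_integrable[OF fin(3), of _ K]) auto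
  have igp: "integrable \<pi> (\<lambda>z. g (snd z))" using L sp by (intro bounded_integrable[OF fin(3), of _ L]) auto
  have iC: "integrable \<pi> (\<lambda>z. C (fst z) (snd z))"
    using sp C_bound by (intro bounded_integrable[OF fin(3), of _ cmax]) auto
  define T where "T z = f (fst z) + g (snd z) - C (fst z) (snd z) / \<epsilon>" for z
  have iT: "integrable \<pi> T" unfolding T_def using ifp igp iC by auto
  have iTval: "(\<integral>z. T z \<partial>\<pi>) = (\<integral>z. f (fst z) \<partial>\<pi>) + (\<integral>z. g (snd z) \<partial>\<pi>) - (\<integral>z. C (fst z) (snd z) \<partial>\<pi>) / \<epsilon>"
    unfolding T_def using ifp igp iC by simp
  have ieT: "integrable (\<alpha> \<Otimes>\<^sub>M \<beta>) (\<lambda>z. exp (T z))"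
  proof (rule bounded_integrable[OF finite_measure_pair[OF fin(1,2)], of _ "exp (K + L + cmax / \<epsilon>)"])
    show "(\<lambda>z. exp (T z)) \<in> borel_measurable (\<alpha> \<Otimes>\<^sub>M \<beta>)" unfolding T_def by measurable
    fix z assume "z \<in> space (\<alpha> \<Otimes>\<^sub>M \<beta>)"
    then have z: "fst z \<in> X" "snd z \<in> X" by (auto simp: space_pair_measure sp)
    have "- (C (fst z) (snd z)) / \<epsilon> \<le> cmax / \<epsilon>"
      using C_bound[OF z] eps by (intro divide_right_mono) auto
    then have "T z \<le> K + L + cmax / \<epsilon>" using K[OF z(1)] L[OF z(2)] unfolding T_def by auto
    then show "\<bar>exp (T z)\<bar> \<le> exp (K + L + cmax / \<epsilon>)" by simp
  qed
  define d1 d2 d3 where "d1 = phi_divergence \<phi> (distr \<pi> B fst) \<alpha>" and "d2 = phi_divergence \<phi> (distr \<pi> B snd) \<beta>"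
    and "d3 = phi_divergence kl_entropy \<pi> (\<alpha> \<Otimes>\<^sub>M \<beta>)"
  have 1: "ereal ((\<integral>x. u x \<partial>\<alpha>) - \<epsilon> * (\<integral>z. f (fst z) \<partial>\<pi>)) \<le> enn2ereal d1"
  proof -
    have "ereal ((\<integral>x. u x \<partial>\<alpha>) - (\<integral>x. \<epsilon> * f x \<partial>distr \<pi> B fst)) \<le> enn2ereal d1"
      unfolding d1_def using fs sp iu if1 Mplus_sets[OF \<alpha>] by (intro phi_divergence_ge mg fin) auto
    then show ?thesis by (simp add: integral_distr[OF mg(1)])
  qed
  have 2: "ereal ((\<integral>x. v x \<partial>\<beta>) - \<epsilon> * (\<integral>z. g (snd z) \<partial>\<pi>)) \<le> enn2ereal d2"
  proof -
    have "ereal ((\<integral>x. v x \<partial>\<beta>) - (\<integral>x. \<epsilon> * g x \<partial>distr \<pi> B snd)) \<le> enn2ereal d2"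
      unfolding d2_def using fs sp iv ig1 Mplus_sets[OF \<beta>] by (intro phi_divergence_ge mg fin) auto
    then show ?thesis by (simp add: integral_distr[OF mg(2)])
  qed
  have "ereal (mass (\<alpha> \<Otimes>\<^sub>M \<beta>) - (\<integral>z. exp (T z) \<partial>(\<alpha> \<Otimes>\<^sub>M \<beta>)) + (\<integral>z. T z \<partial>\<pi>)) \<le> enn2ereal d3"
    unfolding d3_def by (intro kl_divergence_ge finite_measure_pair fin s\<pi> iT ieT)
  then have 3: "ereal (mass \<alpha> * mass \<beta> - soft_mass f g \<alpha> \<beta> + (\<integral>z. T z \<partial>\<pi>)) \<le> enn2ereal d3"
    by (simp add: mass_pair[OF fin(1,2)] soft_mass_def T_def)
  have "ereal (\<epsilon> * (mass \<alpha> * mass \<beta> - soft_mass f g \<alpha> \<beta> + (\<integral>z. T z \<partial>\<pi>))) \<le> ereal \<epsilon> * enn2ereal d3"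
    using ereal_mult_left_mono[OF 3, of "ereal \<epsilon>"] eps by simp
  also have "\<dots> = enn2ereal (ennreal \<epsilon> * d3)" using eps by (simp add: times_ennreal.rep_eq enn2ereal_ennreal)
  finally have 3: "ereal (\<epsilon> * (mass \<alpha> * mass \<beta> - soft_mass f g \<alpha> \<beta> + (\<integral>z. T z \<partial>\<pi>))) \<le> enn2ereal (ennreal \<epsilon> * d3)" .
  have e: "\<epsilon> * (\<integral>z. T z \<partial>\<pi>) = \<epsilon> * (\<integral>z. f (fst z) \<partial>\<pi>) + \<epsilon> * (\<integral>z. g (snd z) \<partial>\<pi>) - (\<integral>z. C (fst z) (snd z) \<partial>\<pi>)"
    unfolding iTval using eps by (simp add: algebra_simps)
  have "ereal ((\<integral>x. u x \<partial>\<alpha>) + (\<integral>y. v y \<partial>\<beta>) + \<epsilon> * (mass \<alpha> * mass \<beta>) - \<epsilon> * soft_mass f g \<alpha> \<beta>) =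
     ereal (\<integral>z. C (fst z) (snd z) \<partial>\<pi>) + (ereal ((\<integral>x. u x \<partial>\<alpha>) - \<epsilon> * (\<integral>z. f (fst z) \<partial>\<pi>)) + ereal ((\<integral>x. v x \<partial>\<beta>) - \<epsilon> * (\<integral>z. g (snd z) \<partial>\<pi>))
     + ereal (\<epsilon> * (mass \<alpha> * mass \<beta> - soft_mass f g \<alpha> \<beta> + (\<integral>z. T z \<partial>\<pi>))))"
    unfolding distrib_left e by (simp add: algebra_simps)
  also have "\<dots> \<le> ereal (\<integral>z. C (fst z) (snd z) \<partial>\<pi>) + (enn2ereal d1 + enn2ereal d2 + enn2ereal (ennreal \<epsilon> * d3))"
    by (intro add_mono 1 2 3 order_refl)
  also have "\<dots> = ereal (\<integral>z. C (fst z) (snd z) \<partial>\<pi>) + enn2ereal (penalty \<pi> \<alpha> \<beta>)"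
    by (simp add: penalty_def plus_ennreal.rep_eq d1_def d2_def d3_def)
  finally show "ereal ((\<integral>x. u x \<partial>\<alpha>) + (\<integral>y. v y \<partial>\<beta>) + \<epsilon> * (mass \<alpha> * mass \<beta>) - \<epsilon> * soft_mass f g \<alpha> \<beta>) \<le>
      ereal (\<integral>z. C (fst z) (snd z) \<partial>\<pi>) + enn2ereal (penalty \<pi> \<alpha> \<beta>)" .
qed

lemma OT_not_MInf:
  assumes "\<alpha> \<in> Mplus X" "\<beta> \<in> Mplus X"
  shows "OT X C \<epsilon> \<phi> \<alpha> \<beta> \<noteq> -\<infinity>"
  using OT_ge[OF assms dual_pair_0 dual_pair_0] by auto

text \<open>The marginal penalties are jointly convex as they stand. The KL term is jointly convex
  in the plan and the reference measure, and \<open>prod\<close> supplies the missing fact that the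
  reference measure of the mixture is the mixture of the reference measures.\<close>

lemma penalty_mix:
  assumes \<alpha>: "\<alpha> \<in> Mplus X" "\<alpha>' \<in> Mplus X" and \<beta>: "\<beta> \<in> Mplus X" "\<beta>' \<in> Mplus X"
    and \<pi>: "\<pi> \<in> Mplus (X \<times> X)" "\<pi>' \<in> Mplus (X \<times> X)" and t: "0 \<le> t" "t \<le> 1"
    and prod: "mix t \<alpha> \<alpha>' \<Otimes>\<^sub>M mix t \<beta> \<beta>' = mix t (\<alpha> \<Otimes>\<^sub>M \<beta>) (\<alpha>' \<Otimes>\<^sub>M \<beta>')"
  shows "penalty (mix t \<pi> \<pi>') (mix t \<alpha> \<alpha>') (mix t \<beta> \<beta>') \<le> ennreal t * penalty \<pi> \<alpha> \<beta> + ennreal (1 - t) * penalty \<pi>' \<alpha>' \<beta>'"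
proof -
  have s: "sets \<pi> = sets \<pi>'" using Mplus_sets[OF \<pi>(1)] Mplus_sets[OF \<pi>(2)] by simp
  note sp = Mplus_pair_sets[OF \<pi>(1) \<alpha>(1) \<beta>(1)] Mplus_pair_sets[OF \<pi>(2) \<alpha>(2) \<beta>(2)]
  have 1: "phi_divergence \<phi> (distr (mix t \<pi> \<pi>') B fst) (mix t \<alpha> \<alpha>') \<le>
      ennreal t * phi_divergence \<phi> (distr \<pi> B fst) \<alpha> + ennreal (1 - t) * phi_divergence \<phi> (distr \<pi>' B fst) \<alpha>'"
    unfolding distr_mix[OF s Mplus_marginals(1)[OF \<pi>(1)]]
    using \<alpha> t by (intro phi_divergence_mix Mplus_marginals \<pi>) (auto dest: Mplus_finite Mplus_sets)
  have 2: "phi_divergence \<phi> (distr (mix t \<pi> \<pi>') B snd) (mix t \<beta> \<beta>') \<le>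
      ennreal t * phi_divergence \<phi> (distr \<pi> B snd) \<beta> + ennreal (1 - t) * phi_divergence \<phi> (distr \<pi>' B snd) \<beta>'"
    unfolding distr_mix[OF s Mplus_marginals(2)[OF \<pi>(1)]]
    using \<beta> t by (intro phi_divergence_mix Mplus_marginals \<pi>) (auto dest: Mplus_finite Mplus_sets)
  have 3: "phi_divergence kl_entropy (mix t \<pi> \<pi>') (mix t \<alpha> \<alpha>' \<Otimes>\<^sub>M mix t \<beta> \<beta>') \<le>
      ennreal t * phi_divergence kl_entropy \<pi> (\<alpha> \<Otimes>\<^sub>M \<beta>) + ennreal (1 - t) * phi_divergence kl_entropy \<pi>' (\<alpha>' \<Otimes>\<^sub>M \<beta>')"
    unfolding prod using \<alpha> \<beta> \<pi> t s sp
    by (intro kl.phi_divergence_mix finite_measure_pair) (auto dest: Mplus_finite)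
  have "penalty (mix t \<pi> \<pi>') (mix t \<alpha> \<alpha>') (mix t \<beta> \<beta>') \<le>
      (ennreal t * phi_divergence \<phi> (distr \<pi> B fst) \<alpha> + ennreal (1 - t) * phi_divergence \<phi> (distr \<pi>' B fst) \<alpha>') +
      (ennreal t * phi_divergence \<phi> (distr \<pi> B snd) \<beta> + ennreal (1 - t) * phi_divergence \<phi> (distr \<pi>' B snd) \<beta>') +
      ennreal \<epsilon> * (ennreal t * phi_divergence kl_entropy \<pi> (\<alpha> \<Otimes>\<^sub>M \<beta>) + ennreal (1 - t) * phi_divergence kl_entropy \<pi>' (\<alpha>' \<Otimes>\<^sub>M \<beta>'))"
    unfolding penalty_def by (intro add_mono 1 2 mult_left_mono 3) simp
  also have "\<dots> = ennreal t * penalty \<pi> \<alpha> \<beta> + ennreal (1 - t) * penalty \<pi>' \<alpha>' \<beta>'"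
    unfolding penalty_def by (simp add: distrib_left mult_ac add_ac)
  finally show ?thesis .
qed

lemma OT_mix:
  assumes \<alpha>: "\<alpha> \<in> Mplus X" "\<alpha>' \<in> Mplus X" and \<beta>: "\<beta> \<in> Mplus X" "\<beta>' \<in> Mplus X" and t: "0 < t" "t < 1"
    and prod: "mix t \<alpha> \<alpha>' \<Otimes>\<^sub>M mix t \<beta> \<beta>' = mix t (\<alpha> \<Otimes>\<^sub>M \<beta>) (\<alpha>' \<Otimes>\<^sub>M \<beta>')"
  shows "OT X C \<epsilon> \<phi> (mix t \<alpha> \<alpha>') (mix t \<beta> \<beta>') \<le> ereal t * OT X C \<epsilon> \<phi> \<alpha> \<beta> + ereal (1 - t) * OT X C \<epsilon> \<phi> \<alpha>' \<beta>'"
proof (cases "OT X C \<epsilon> \<phi> \<alpha> \<beta> = \<infinity> \<or> OT X C \<epsilon> \<phi> \<alpha>' \<beta>' = \<infinity>")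
  case True
  then have "ereal t * OT X C \<epsilon> \<phi> \<alpha> \<beta> + ereal (1 - t) * OT X C \<epsilon> \<phi> \<alpha>' \<beta>' = \<infinity>"
    using t OT_not_MInf[OF \<alpha>(1) \<beta>(1)] OT_not_MInf[OF \<alpha>(2) \<beta>(2)] by (auto simp: ereal_mult_eq_MInfty)
  then show ?thesis by (metis ereal_less_eq(1))
next
  case False
  then obtain a b where ab: "OT X C \<epsilon> \<phi> \<alpha> \<beta> = ereal a" "OT X C \<epsilon> \<phi> \<alpha>' \<beta>' = ereal b"
    using OT_not_MInf[OF \<alpha>(1) \<beta>(1)] OT_not_MInf[OF \<alpha>(2) \<beta>(2)]
    by (cases "OT X C \<epsilon> \<phi> \<alpha> \<beta>"; cases "OT X C \<epsilon> \<phi> \<alpha>' \<beta>'") auto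
  note m = mix_Mplus[OF \<alpha>, of t] mix_Mplus[OF \<beta>, of t]
  show ?thesis unfolding ab
  proof (rule ereal_le_epsilon2)
    \<comment> \<open>Optimal plans need not be at hand, so plans within e of the two infima are
      mixed.\<close>
    fix e :: real assume e: "0 < e"
    define J where "J \<pi> = (\<integral>z. C (fst z) (snd z) \<partial>\<pi>)" for \<pi> :: "('a \<times> 'a) measure"
    have "(INF \<pi>\<in>Mplus (X \<times> X). ereal (J \<pi>) + enn2ereal (penalty \<pi> \<alpha> \<beta>)) < ereal (a + e)"
      using ab(1) e unfolding J_def OT_eq[OF \<alpha>(1) \<beta>(1)] by simp
    then obtain \<pi> where \<pi>: "\<pi> \<in> Mplus (X \<times> X)" "ereal (J \<pi>) + enn2ereal (penalty \<pi> \<alpha> \<beta>) < ereal (a + e)"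
      unfolding INF_less_iff by blast
    have "(INF \<pi>\<in>Mplus (X \<times> X). ereal (J \<pi>) + enn2ereal (penalty \<pi> \<alpha>' \<beta>')) < ereal (b + e)"
      using ab(2) e unfolding J_def OT_eq[OF \<alpha>(2) \<beta>(2)] by simp
    then obtain \<pi>' where \<pi>': "\<pi>' \<in> Mplus (X \<times> X)" "ereal (J \<pi>') + enn2ereal (penalty \<pi>' \<alpha>' \<beta>') < ereal (b + e)"
      unfolding INF_less_iff by blast
    obtain p where p: "penalty \<pi> \<alpha> \<beta> = ennreal p" "0 \<le> p" "J \<pi> + p < a + e"
      using \<pi>(2) by (cases "penalty \<pi> \<alpha> \<beta>") (auto simp: enn2ereal_ennreal)
    obtain p' where p': "penalty \<pi>' \<alpha>' \<beta>' = ennreal p'" "0 \<le> p'" "J \<pi>' + p' < b + e"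
      using \<pi>'(2) by (cases "penalty \<pi>' \<alpha>' \<beta>'") (auto simp: enn2ereal_ennreal)
    have s: "sets \<pi> = sets \<pi>'" using Mplus_sets[OF \<pi>(1)] Mplus_sets[OF \<pi>'(1)] by simp
    have iC: "integrable \<pi> (\<lambda>z. C (fst z) (snd z))" if \<pi>: "\<pi> \<in> Mplus (X \<times> X)" for \<pi>
    proof -
      have [measurable]: "(\<lambda>z. C (fst z) (snd z)) \<in> borel_measurable \<pi>"
        using C_measurable Mplus_sets[OF \<pi>] sets_restrict_borel_Times[OF compact] by (auto cong: measurable_cong_sets)
      show ?thesis using Mplus_space[OF \<pi>] C_bound by (intro bounded_integrable[OF Mplus_finite[OF \<pi>], of _ cmax]) auto
    qed
    have J: "J (mix t \<pi> \<pi>') = t * J \<pi> + (1 - t) * J \<pi>'"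
      unfolding J_def using t by (intro integral_mix(2) s iC \<pi> \<pi>') auto
    have "OT X C \<epsilon> \<phi> (mix t \<alpha> \<alpha>') (mix t \<beta> \<beta>') \<le> ereal (J (mix t \<pi> \<pi>')) + enn2ereal (penalty (mix t \<pi> \<pi>') (mix t \<alpha> \<alpha>') (mix t \<beta> \<beta>'))"
      unfolding OT_eq[OF m] J_def by (intro INF_lower mix_Mplus \<pi> \<pi>')
    also have "\<dots> \<le> ereal (J (mix t \<pi> \<pi>')) + enn2ereal (ennreal t * ennreal p + ennreal (1 - t) * ennreal p')"
      using penalty_mix[OF \<alpha> \<beta> \<pi>(1) \<pi>'(1) _ _ prod] t p p'
      by (intro add_left_mono) (simp add: less_eq_ennreal.rep_eq)
    also have "ennreal t * ennreal p + ennreal (1 - t) * ennreal p' = ennreal (t * p + (1 - t) * p')"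
      using t p p' by (simp add: ennreal_mult)
    also have "enn2ereal \<dots> = ereal (t * p + (1 - t) * p')" using t p p' by (intro enn2ereal_ennreal) auto
    also have "ereal (J (mix t \<pi> \<pi>')) + ereal (t * p + (1 - t) * p') = ereal (t * (J \<pi> + p) + (1 - t) * (J \<pi>' + p'))"
      by (simp add: J algebra_simps)
    also have "\<dots> \<le> ereal (t * (a + e) + (1 - t) * (b + e))"
      unfolding ereal_less_eq by (rule add_mono; rule mult_left_mono) (use t p p' in auto)
    also have "\<dots> = ereal t * ereal a + ereal (1 - t) * ereal b + ereal e" by (simp add: algebra_simps)
    finally show "OT X C \<epsilon> \<phi> (mix t \<alpha> \<alpha>') (mix t \<beta> \<beta>') \<le> ereal t * ereal a + ereal (1 - t) * ereal b + ereal e" .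
  qed
qed

end

subsection \<open>The proximal map of an entropy function\<close>

context entropy
begin

text \<open>Where \<phi> is infinite this is the default value 0, so it represents \<phi> only
  together with finiteness, as in \<open>phi_eq\<close>.\<close>

definition phir :: "real \<Rightarrow> real" where "phir p = enn2real (\<phi> p)"

lemma phi_eq: "\<phi> p \<noteq> \<infinity> \<Longrightarrow> \<phi> p = ennreal (phir p)"
  by (simp add: phir_def less_top)

lemma phir_nonneg [simp]: "0 \<le> phir p" by (simp add: phir_def)

lemma phir_convex:
  assumes "\<phi> x \<noteq> \<infinity>" "\<phi> y \<noteq> \<infinity>" "0 \<le> t" "t \<le> 1"
  shows "\<phi> (t * x + (1 - t) * y) \<noteq> \<infinity>" "phir (t * x + (1 - t) * y) \<le> t * phir x + (1 - t) * phir y"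
proof -
  have "\<phi> (t * x + (1 - t) * y) \<le> ennreal (t * phir x + (1 - t) * phir y)"
    using conv[OF assms(3,4), of x y] assms
    unfolding phi_eq[OF assms(1)] phi_eq[OF assms(2)] by (simp add: ennreal_mult)
  then show *: "\<phi> (t * x + (1 - t) * y) \<noteq> \<infinity>" by (auto simp: top_unique)
  have "0 \<le> t * phir x + (1 - t) * phir y" using assms by simp
  then show "phir (t * x + (1 - t) * y) \<le> t * phir x + (1 - t) * phir y"
    using \<open>\<phi> (t * x + (1 - t) * y) \<le> _\<close> unfolding phi_eq[OF *] by (simp only: ennreal_le_iff)
qed

lemma phir_lsc:
  assumes p: "p \<longlonglongrightarrow> x" and fin: "\<And>n. \<phi> (p n) \<noteq> \<infinity>" and c: "c < 0 \<or> ennreal c < \<phi> x"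
  shows "\<forall>\<^sub>F n in sequentially. c < phir (p n)"
proof (cases "c < 0")
  case True
  then show ?thesis by (intro always_eventually allI) (auto intro: less_le_trans)
next
  case False
  then have "\<forall>\<^sub>F n in sequentially. p n \<in> {y. ennreal c < \<phi> y}"
    using c by (intro topological_tendstoD[OF p open_greater]) auto
  then show ?thesis
  proof (rule eventually_mono)
    fix n assume "p n \<in> {y. ennreal c < \<phi> y}"
    then show "c < phir (p n)" using False phi_eq[OF fin[of n]] by (simp add: ennreal_less_iff)
  qed
qed

text \<open>
  \<open>exp u\<close> minimises \<open>\<phi> p + \<epsilon> (p ln p - p - p v)\<close>; the condition is the first order condition,
  i.e. \<open>\<epsilon> (v - u)\<close> is a subgradient of \<open>\<phi>\<close> at \<open>exp u\<close>.
\<close>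

definition is_prox :: "real \<Rightarrow> real \<Rightarrow> real \<Rightarrow> bool" where
  "is_prox \<epsilon> v u \<longleftrightarrow> \<phi> (exp u) \<noteq> \<infinity> \<and>
     (\<forall>q\<ge>0. ennreal (phir (exp u) + \<epsilon> * (v - u) * (q - exp u)) \<le> \<phi> q)"

text \<open>The direct method: a coercive, lower semicontinuous objective has a minimiser x. It is
  positive because the entropy has slope minus infinity at 0, so x = exp u. The subgradient
  inequality follows by differentiating the smooth part along the segment from x to q.\<close>

lemma is_prox_exists:
  assumes eps: "0 < \<epsilon>"
  shows "\<exists>u. is_prox \<epsilon> v u"
proof -
  define e where "e p = \<epsilon> * (p * ln p - p - p * v)" for p :: real
  define D where "D = {p. 0 \<le> p \<and> \<phi> p \<noteq> \<infinity>}"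
  define F where "F p = phir p + e p" for p
  define I where "I = Inf (F ` D)"
  have 1: "1 \<in> D" by (simp add: D_def)
  \<comment> \<open>\<open>kl_Fenchel\<close> with s = v + 1: the extra 1 leaves the linear growth
    \<epsilon> p after the term p v is absorbed.\<close>
  have coer: "\<epsilon> * p - \<epsilon> * exp (v + 1) \<le> F p" if "p \<in> D" for p
  proof -
    have "p * (v + 1) - exp (v + 1) + 1 \<le> p * ln p - p + 1" using that by (intro kl_Fenchel) (simp add: D_def)
    then have "\<epsilon> * (p - exp (v + 1)) \<le> e p" unfolding e_def using eps by (intro mult_left_mono) (auto simp: algebra_simps)
    then have "\<epsilon> * p - \<epsilon> * exp (v + 1) \<le> e p" by (simp add: algebra_simps)
    then show ?thesis using phir_nonneg[of p] unfolding F_def by linarith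
  qed
  have "- \<epsilon> * exp (v + 1) \<le> F p" if "p \<in> D" for p
  proof -
    have "0 \<le> \<epsilon> * p" using that eps by (simp add: D_def)
    then show ?thesis using coer[OF that] by linarith
  qed
  then have bdd: "bdd_below (F ` D)" by (intro bdd_belowI2)
  have I: "I \<le> F p" if "p \<in> D" for p unfolding I_def using that bdd by (intro cInf_lower) auto
  have "\<exists>p\<in>D. F p < I + 1 / real (Suc n)" for n
  proof -
    have "Inf (F ` D) < I + 1 / real (Suc n)" by (simp add: I_def)
    then show ?thesis using 1 bdd by (subst (asm) cInf_less_iff) auto
  qed
  then obtain p where p: "\<And>n. p n \<in> D" "\<And>n. F (p n) < I + 1 / real (Suc n)" by metis
  define M where "M = (I + 1) / \<epsilon> + exp (v + 1)"
  have "p n \<in> {0..M}" for n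
  proof -
    have "\<epsilon> * p n - \<epsilon> * exp (v + 1) \<le> I + 1"
      using coer[OF p(1)[of n]] p(2)[of n] by (smt (verit) divide_le_eq_1 of_nat_0_le_iff of_nat_Suc)
    then have "p n \<le> M" unfolding M_def using eps by (simp add: field_simps)
    then show ?thesis using p(1)[of n] by (simp add: D_def)
  qed
  then obtain x r where x: "x \<in> {0..M}" and r: "strict_mono r" "(p \<circ> r) \<longlonglongrightarrow> x"
    using compact_Icc[of 0 M] unfolding compact_def by metis
  have pr: "(\<lambda>n. p (r n)) \<longlonglongrightarrow> x" using r(2) by (simp add: o_def)
  have fin: "\<phi> (p n) \<noteq> \<infinity>" "0 \<le> p n" for n using p(1)[of n] by (auto simp: D_def)
  have x0: "0 \<le> x" using x by simp
  define k where "k p = p * ln p - p + 1" for p :: real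
  \<comment> \<open>Lower semicontinuity is used through real strict lower bounds c of \<phi> x and
    d of the entropy part, since \<phi> x is not yet known to be finite. Negative c is listed apart
    because \<open>ennreal\<close> sends it to 0.\<close>
  have lim: "c + \<epsilon> * d \<le> I + \<epsilon> + \<epsilon> * v * x" if c: "c < 0 \<or> ennreal c < \<phi> x" and d: "d < k x" for c d
  proof -
    have "\<forall>\<^sub>F n in sequentially. c < phir (p (r n))" using phir_lsc[OF pr fin(1) c] .
    moreover have "\<forall>\<^sub>F n in sequentially. d < kl.phir (p (r n))"
    proof (rule kl.phir_lsc[OF pr])
      show "kl_entropy (p (r n)) \<noteq> \<infinity>" for n using fin(2)[of "r n"] by (simp add: kl_entropy_def)
      show "d < 0 \<or> ennreal d < kl_entropy x"
        using d x0 by (cases "d < 0") (auto simp: kl_entropy_def k_def intro: ennreal_lessI)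
    qed
    ultimately have "\<forall>\<^sub>F n in sequentially. c + \<epsilon> * d \<le> I + 1 / real (Suc n) + \<epsilon> + \<epsilon> * v * p (r n)"
    proof eventually_elim
      case (elim n)
      have "kl.phir (p (r n)) = k (p (r n))"
        using fin(2)[of "r n"] kl_nonneg[of "p (r n)"] by (simp add: kl.phir_def kl_entropy_def k_def)
      then have "\<epsilon> * d \<le> \<epsilon> * k (p (r n))" using elim eps by simp
      moreover have "e (p (r n)) = \<epsilon> * k (p (r n)) - \<epsilon> - \<epsilon> * v * p (r n)" by (simp add: e_def k_def algebra_simps)
      moreover have "1 / real (Suc (r n)) \<le> 1 / real (Suc n)"
        using seq_suble[OF r(1), of n] by (intro divide_left_mono) auto
      ultimately show ?case using elim p(2)[of "r n"] unfolding F_def by linarith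
    qed
    moreover have "(\<lambda>n. I + 1 / real (Suc n) + \<epsilon> + \<epsilon> * v * p (r n)) \<longlonglongrightarrow> I + 0 + \<epsilon> + \<epsilon> * v * x"
      using LIMSEQ_inverse_real_of_nat
      by (intro tendsto_add tendsto_mult tendsto_const pr) (simp add: inverse_eq_divide)
    ultimately show ?thesis by (intro tendsto_lowerbound) auto
  qed
  have lim': "c + \<epsilon> * k x \<le> I + \<epsilon> + \<epsilon> * v * x" if c: "c < 0 \<or> ennreal c < \<phi> x" for c
  proof (rule field_le_epsilon)
    fix a :: real assume a: "0 < a"
    have "c + \<epsilon> * (k x - a / \<epsilon>) \<le> I + \<epsilon> + \<epsilon> * v * x" using a eps by (intro lim c) auto
    then show "c + \<epsilon> * k x \<le> I + \<epsilon> + \<epsilon> * v * x + a" using eps by (simp add: algebra_simps)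
  qed
  have \<phi>x: "\<phi> x \<noteq> \<infinity>"
  proof
    assume "\<phi> x = \<infinity>"
    then have "(I + \<epsilon> + \<epsilon> * v * x - \<epsilon> * k x + 1) + \<epsilon> * k x \<le> I + \<epsilon> + \<epsilon> * v * x" by (intro lim') simp
    then show False by simp
  qed
  have "phir x + \<epsilon> * k x \<le> I + \<epsilon> + \<epsilon> * v * x"
  proof (rule field_le_epsilon)
    fix a :: real assume a: "0 < a"
    have "(phir x - a) + \<epsilon> * k x \<le> I + \<epsilon> + \<epsilon> * v * x"
    proof (rule lim', subst phi_eq[OF \<phi>x])
      show "phir x - a < 0 \<or> ennreal (phir x - a) < ennreal (phir x)"
        using a by (cases "phir x - a < 0") (auto simp: ennreal_less_iff)
    qed
    then show "phir x + \<epsilon> * k x \<le> I + \<epsilon> + \<epsilon> * v * x + a" by simp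
  qed
  then have Fx: "F x \<le> I" by (simp add: F_def e_def k_def algebra_simps)
  then have min: "F x \<le> F q" if "q \<in> D" for q using I[OF that] by simp
  have xpos: "0 < x"
  proof (rule ccontr)
    assume "\<not> 0 < x"
    then have x: "x = 0" using x0 by simp
    \<comment> \<open>With this t the entropy part at t is at most -\<epsilon> t, while it is 0 at
      0. Since t < 1, convexity and \<phi> 1 = 0 bound \<phi> t by (1 - t) \<phi> 0, so 0 cannot be
      the minimiser.\<close>
    define t where "t = exp (min v (-1))"
    have t: "0 < t" "t < 1" by (auto simp: t_def min_def)
    note c = phir_convex[of 1 0 t] 
    have "\<phi> 0 \<noteq> \<infinity>" using \<phi>x x by simp
    then have "t \<in> D" "phir t \<le> (1 - t) * phir 0" using c t by (auto simp: D_def phir_def)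
    then have "phir 0 \<le> (1 - t) * phir 0 + e t" using min[of t] by (simp add: F_def x e_def)
    then have "t * phir 0 \<le> t * (\<epsilon> * (ln t - 1 - v))" by (simp add: e_def algebra_simps)
    then have "phir 0 \<le> \<epsilon> * (ln t - 1 - v)" using t by simp
    moreover have "\<epsilon> * (ln t - 1 - v) < 0" using eps by (intro mult_pos_neg) (auto simp: t_def)
    ultimately show False using phir_nonneg[of 0] by linarith
  qed
  have "ennreal (phir x + \<epsilon> * (v - ln x) * (q - x)) \<le> \<phi> q" if q: "0 \<le> q" for q
  proof (cases "\<phi> q = \<infinity>")
    case False
    \<comment> \<open>Only the entropy part is differentiated; \<phi> is merely bounded along the
      segment by convexity, so only a one-sided limit at t = 0 is taken.\<close>
    define G where "G t = e (x + t * (q - x))" for t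
    have "(G has_real_derivative \<epsilon> * (ln x - v) * (q - x)) (at 0)"
      unfolding G_def e_def using xpos
      by (auto intro!: derivative_eq_intros simp: field_simps)
    then have "((\<lambda>t. (G t - G 0) / t) \<longlongrightarrow> \<epsilon> * (ln x - v) * (q - x)) (at 0)"
      by (simp add: has_field_derivative_iff)
    then have "((\<lambda>t. (G t - G 0) / t) \<longlongrightarrow> \<epsilon> * (ln x - v) * (q - x)) (at_right 0)"
      by (rule filterlim_mono) (auto simp: at_le)
    then have "((\<lambda>t. phir q + (G t - G 0) / t) \<longlongrightarrow> phir q + \<epsilon> * (ln x - v) * (q - x)) (at_right 0)"
      by (intro tendsto_add tendsto_const)
    moreover have "\<forall>\<^sub>F t in at_right 0. t \<in> {0<..<(1::real)}" by (rule eventually_at_right_real) simp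
    then have "\<forall>\<^sub>F t in at_right 0. phir x \<le> phir q + (G t - G 0) / t"
    proof (rule eventually_mono)
      fix t :: real assume t: "t \<in> {0<..<1}"
      define z where "z = t * q + (1 - t) * x"
      have z: "\<phi> z \<noteq> \<infinity>" "phir z \<le> t * phir q + (1 - t) * phir x"
        unfolding z_def using phir_convex[OF False \<phi>x, of t] t by auto
      have "0 \<le> z" using t q x0 by (simp add: z_def)
      then have "F x \<le> F z" using z by (intro min) (simp add: D_def)
      moreover have "G t = e z" "G 0 = e x" by (simp_all add: G_def z_def algebra_simps)
      moreover have "t * phir q + (1 - t) * phir x = phir x + t * phir q - t * phir x" by (simp add: algebra_simps)
      ultimately have "t * phir x \<le> t * phir q + (G t - G 0)" using z(2) unfolding F_def by linarith
      then show "phir x \<le> phir q + (G t - G 0) / t" using t by (simp add: field_simps)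
    qed
    ultimately have "phir x \<le> phir q + \<epsilon> * (ln x - v) * (q - x)" by (intro tendsto_lowerbound) auto
    then have "phir x + \<epsilon> * (v - ln x) * (q - x) \<le> phir q" by (simp add: algebra_simps)
    then show ?thesis unfolding phi_eq[OF False] by (rule ennreal_leI)
  qed simp
  then have "is_prox \<epsilon> v (ln x)" using \<phi>x xpos by (simp add: is_prox_def)
  then show ?thesis ..
qed

text \<open>Monotonicity of the subdifferential: each subgradient inequality is evaluated at the
  other minimiser, and the two are added.\<close>

lemma is_prox_monotone:
  assumes eps: "0 < \<epsilon>" and 1: "is_prox \<epsilon> v u" and 2: "is_prox \<epsilon> v' u'"
  shows "(exp u - exp u') * ((u - v) - (u' - v')) \<le> 0"
proof -
  have a: "phir (exp u) + \<epsilon> * (v - u) * (exp u' - exp u) \<le> phir (exp u')"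
  proof -
    have "ennreal (phir (exp u) + \<epsilon> * (v - u) * (exp u' - exp u)) \<le> \<phi> (exp u')" using 1 by (simp add: is_prox_def)
    also have "\<dots> = ennreal (phir (exp u'))" using 2 by (intro phi_eq) (simp add: is_prox_def)
    finally show ?thesis by simp
  qed
  have b: "phir (exp u') + \<epsilon> * (v' - u') * (exp u - exp u') \<le> phir (exp u)"
  proof -
    have "ennreal (phir (exp u') + \<epsilon> * (v' - u') * (exp u - exp u')) \<le> \<phi> (exp u)" using 2 by (simp add: is_prox_def)
    also have "\<dots> = ennreal (phir (exp u))" using 1 by (intro phi_eq) (simp add: is_prox_def)
    finally show ?thesis by simp
  qed
  from a b have "\<epsilon> * ((exp u - exp u') * ((u - v) - (u' - v'))) \<le> 0" by (simp add: algebra_simps)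
  then show ?thesis using eps by (simp add: mult_le_0_iff)
qed

section \<open>The proximal scaling and its slope\<close>

definition prox :: "real \<Rightarrow> real \<Rightarrow> real" where
  "prox \<epsilon> v = (SOME u. is_prox \<epsilon> v u)"

text \<open>This is the map R of the overview. If v is the logarithm of the integral in the Sinkhorn
  equation, then the density of the marginal, exp f times that integral, equals exp (prox
  v).\<close>

definition log_scale :: "real \<Rightarrow> real \<Rightarrow> real" where
  "log_scale \<epsilon> v = prox \<epsilon> v - v"

context
  fixes \<epsilon> :: real
  assumes eps: "0 < \<epsilon>"
begin

lemma is_prox_prox: "is_prox \<epsilon> v (prox \<epsilon> v)"
  unfolding prox_def using is_prox_exists[OF eps] by (rule someI_ex)

lemma log_scale_monotone:
  "(exp (log_scale \<epsilon> v + v) - exp (log_scale \<epsilon> v' + v')) * (log_scale \<epsilon> v - log_scale \<epsilon> v') \<le> 0"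
  using is_prox_monotone[OF eps is_prox_prox is_prox_prox, of v v'] by (simp add: log_scale_def)

text \<open>If it failed, both factors in \<open>log_scale_monotone\<close> would be negative. The
  same sign argument proves \<open>log_scale_add_mono\<close>; together they confine the slope to
  [-1, 0].\<close>

lemma log_scale_antimono: "v \<le> v' \<Longrightarrow> log_scale \<epsilon> v' \<le> log_scale \<epsilon> v"
proof (rule ccontr)
  assume "v \<le> v'" "\<not> log_scale \<epsilon> v' \<le> log_scale \<epsilon> v"
  then have "exp (log_scale \<epsilon> v + v) - exp (log_scale \<epsilon> v' + v') < 0" "log_scale \<epsilon> v - log_scale \<epsilon> v' < 0" by auto
  then have "0 < (exp (log_scale \<epsilon> v + v) - exp (log_scale \<epsilon> v' + v')) * (log_scale \<epsilon> v - log_scale \<epsilon> v')"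
    by (rule mult_neg_neg)
  then show False using log_scale_monotone[of v v'] by linarith
qed

lemma log_scale_add_mono: "v \<le> v' \<Longrightarrow> log_scale \<epsilon> v + v \<le> log_scale \<epsilon> v' + v'"
proof (rule ccontr)
  assume "v \<le> v'" "\<not> log_scale \<epsilon> v + v \<le> log_scale \<epsilon> v' + v'"
  then have "0 < exp (log_scale \<epsilon> v + v) - exp (log_scale \<epsilon> v' + v')" "0 < log_scale \<epsilon> v - log_scale \<epsilon> v'" by auto
  then have "0 < (exp (log_scale \<epsilon> v + v) - exp (log_scale \<epsilon> v' + v')) * (log_scale \<epsilon> v - log_scale \<epsilon> v')"
    by (rule mult_pos_pos)
  then show False using log_scale_monotone[of v v'] by linarith
qed

lemma log_scale_Lipschitz: "\<bar>log_scale \<epsilon> v - log_scale \<epsilon> v'\<bar> \<le> \<bar>v - v'\<bar>"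
  using log_scale_antimono[of v v'] log_scale_antimono[of v' v] log_scale_add_mono[of v v'] log_scale_add_mono[of v' v]
  by linarith

lemma measurable_log_scale [measurable]: "log_scale \<epsilon> \<in> borel_measurable borel"
proof (rule borel_measurable_continuous_onI)
  show "continuous_on UNIV (log_scale \<epsilon>)"
    by (rule continuous_on_iff[THEN iffD2]) (auto simp: dist_real_def intro: le_less_trans[OF log_scale_Lipschitz])
qed

text \<open>The subgradient inequality in the form required by \<open>dual_pair\<close>. At q = exp
  (log_scale v + v) the minorant touches \<phi>, which is what makes the dual value
  attained.\<close>

lemma phi_prox:
  assumes "0 \<le> q"
  shows "\<phi> (exp (log_scale \<epsilon> v + v)) \<noteq> \<infinity>"
    "ennreal (phir (exp (log_scale \<epsilon> v + v)) + \<epsilon> * log_scale \<epsilon> v * exp (log_scale \<epsilon> v + v) - \<epsilon> * log_scale \<epsilon> v * q) \<le> \<phi> q"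
proof -
  have e: "log_scale \<epsilon> v + v = prox \<epsilon> v" by (simp add: log_scale_def)
  show "\<phi> (exp (log_scale \<epsilon> v + v)) \<noteq> \<infinity>" using is_prox_prox[of v] by (simp add: is_prox_def e)
  have "ennreal (phir (exp (prox \<epsilon> v)) + \<epsilon> * (v - prox \<epsilon> v) * (q - exp (prox \<epsilon> v))) \<le> \<phi> q"
    using is_prox_prox[of v] assms by (simp add: is_prox_def)
  moreover have "\<epsilon> * (v - prox \<epsilon> v) * (q - exp (prox \<epsilon> v)) =
      \<epsilon> * log_scale \<epsilon> v * exp (prox \<epsilon> v) - \<epsilon> * log_scale \<epsilon> v * q"
    by (simp add: log_scale_def algebra_simps)
  ultimately show "ennreal (phir (exp (log_scale \<epsilon> v + v)) + \<epsilon> * log_scale \<epsilon> v * exp (log_scale \<epsilon> v + v) - \<epsilon> * log_scale \<epsilon> v * q) \<le> \<phi> q"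
    by (simp add: e add_diff_eq)
qed

end

end

subsection \<open>Symmetric Sinkhorn potentials\<close>

lemma exp_diff_le:
  assumes "(a::real) \<le> M" "b \<le> M"
  shows "\<bar>exp a - exp b\<bar> \<le> exp M * \<bar>a - b\<bar>"
proof -
  have *: "exp x - exp y \<le> exp M * (x - y)" if "x \<le> M" "y \<le> x" for x y :: real
  proof -
    have "exp x * (1 - exp (y - x)) \<le> exp x * (x - y)"
      using exp_ge_add_one_self[of "y - x"] by (intro mult_left_mono) (linarith, simp)
    also have "\<dots> \<le> exp M * (x - y)" using that by (intro mult_right_mono) auto
    finally show ?thesis by (simp add: right_diff_distrib exp_diff)
  qed
  show ?thesis using *[of a b] *[of b a] assms by (cases "a \<le> b") auto
qed

lemma exp_mult_diff_ge:
  assumes "M \<le> (a::real)" "M \<le> b"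
  shows "exp M * (a - b)\<^sup>2 \<le> (exp a - exp b) * (a - b)"
proof -
  have *: "exp M * (x - y)\<^sup>2 \<le> (exp x - exp y) * (x - y)" if "M \<le> y" "y \<le> x" for x y :: real
  proof -
    have "exp y * (x - y) \<le> exp y * (exp (x - y) - 1)"
      using exp_ge_add_one_self[of "x - y"] by (intro mult_left_mono) (linarith, simp)
    then have "exp y * (x - y) \<le> exp x - exp y" by (simp add: right_diff_distrib exp_diff)
    moreover have "exp M * (x - y) \<le> exp y * (x - y)" using that by (intro mult_right_mono) auto
    ultimately have "exp M * (x - y) * (x - y) \<le> (exp x - exp y) * (x - y)"
      using that by (intro mult_right_mono) auto
    then show ?thesis by (simp add: power2_eq_square)
  qed
  show ?thesis
  proof (cases "a \<le> b")
    case True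
    then show ?thesis using *[of a b] assms by (simp add: power2_commute algebra_simps)
  qed (use * assms in auto)
qed

lemma ln_diff_le:
  assumes "0 < m" "m \<le> a" "m \<le> (b::real)"
  shows "\<bar>ln a - ln b\<bar> \<le> \<bar>a - b\<bar> / m"
proof -
  have *: "ln x - ln y \<le> (x - y) / m" if "m \<le> y" "y \<le> x" for x y
  proof -
    have "ln x - ln y \<le> (x - y) / y" using that assms ln_diff_le[of x y] by simp
    also have "\<dots> \<le> (x - y) / m" using that assms by (intro divide_left_mono) auto
    finally show ?thesis .
  qed
  show ?thesis
  proof (cases "a \<le> b")
    case True
    then have "ln a \<le> ln b" using assms by simp
    then show ?thesis using *[of a b] True assms by simp
  next
    case False
    then have "ln b \<le> ln a" using assms by simp
    then show ?thesis using *[of b a] False assms by simp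
  qed
qed

section \<open>The Sinkhorn map and its approximate fixed points\<close>

context ot_problem
begin

abbreviation \<kappa> :: real where "\<kappa> \<equiv> cmax / \<epsilon>"

lemma cost_bound: "x \<in> X \<Longrightarrow> y \<in> X \<Longrightarrow> \<bar>C x y / \<epsilon>\<bar> \<le> \<kappa>"
  using C_bound[of x y] eps by (simp add: abs_divide divide_right_mono)

definition admissible :: "('a \<Rightarrow> real) \<Rightarrow> bool" where
  "admissible f \<longleftrightarrow> f \<in> borel_measurable B \<and> (\<exists>K. \<forall>x\<in>X. \<bar>f x\<bar> \<le> K)"

definition soft :: "'a measure \<Rightarrow> ('a \<Rightarrow> real) \<Rightarrow> 'a \<Rightarrow> real" where
  "soft \<alpha> f x = (\<integral>y. exp (f y - C x y / \<epsilon>) \<partial>\<alpha>)"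

definition sinkhorn_map :: "'a measure \<Rightarrow> ('a \<Rightarrow> real) \<Rightarrow> 'a \<Rightarrow> real" where
  "sinkhorn_map \<alpha> f x = log_scale \<epsilon> (ln (soft \<alpha> f x))"

lemma C_section: "x \<in> X \<Longrightarrow> C x \<in> borel_measurable B"
  using measurable_compose[OF measurable_Pair1'[of x B B] C_measurable] by (simp add: space_restrict_space)

context
  fixes \<alpha> :: "'a measure"
  assumes \<alpha>: "\<alpha> \<in> Mplus X"
begin

interpretation finite_measure \<alpha> using \<alpha> by (rule Mplus_finite)

lemma space_\<alpha>: "space \<alpha> = X" using \<alpha> by (rule Mplus_space)

lemma soft_integrable:
  assumes "admissible f" "x \<in> X"
  shows "integrable \<alpha> (\<lambda>y. exp (f y - C x y / \<epsilon>))"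
proof -
  obtain K where K: "\<forall>x\<in>X. \<bar>f x\<bar> \<le> K" and [measurable]: "f \<in> borel_measurable B"
    using assms by (auto simp: admissible_def)
  note C_section[OF assms(2), measurable] and Mplus_sets[OF \<alpha>, measurable_cong]
  show ?thesis
  proof (rule bounded_integrable[OF finite_measure_axioms, of _ "exp (K + \<kappa>)"])
    fix y assume "y \<in> space \<alpha>"
    then have y: "y \<in> X" by (simp add: space_\<alpha>)
    then have "f y \<le> K" using K by (auto simp: abs_le_iff)
    then have "f y - C x y / \<epsilon> \<le> K + \<kappa>" using cost_bound[OF assms(2) y] by linarith
    then show "\<bar>exp (f y - C x y / \<epsilon>)\<bar> \<le> exp (K + \<kappa>)" by simp
  qed measurable
qed

text \<open>Function and point may change together: x = x' gives nonexpansiveness, f = g gives the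
  oscillation bound.\<close>

lemma soft_mono:
  assumes "admissible f" "admissible g" "x \<in> X" "x' \<in> X"
    and "\<And>y. y \<in> X \<Longrightarrow> f y - C x y / \<epsilon> \<le> g y - C x' y / \<epsilon> + d"
  shows "soft \<alpha> f x \<le> exp d * soft \<alpha> g x'"
proof -
  have "soft \<alpha> f x \<le> (\<integral>y. exp d * exp (g y - C x' y / \<epsilon>) \<partial>\<alpha>)"
    unfolding soft_def
  proof (rule integral_mono)
    fix y assume "y \<in> space \<alpha>"
    then have "f y - C x y / \<epsilon> \<le> g y - C x' y / \<epsilon> + d" using assms(5) by (simp add: space_\<alpha>)
    then show "exp (f y - C x y / \<epsilon>) \<le> exp d * exp (g y - C x' y / \<epsilon>)" by (simp add: exp_add[symmetric] add_ac)
  qed (auto intro!: soft_integrable assms)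
  then show ?thesis by (simp add: soft_def)
qed

lemma soft_le:
  assumes "admissible f" "x \<in> X" "\<And>y. y \<in> X \<Longrightarrow> f y \<le> K"
  shows "soft \<alpha> f x \<le> exp (K + \<kappa>) * mass \<alpha>"
proof -
  have "soft \<alpha> f x \<le> (\<integral>y. exp (K + \<kappa>) \<partial>\<alpha>)"
    unfolding soft_def
  proof (rule integral_mono)
    fix y assume "y \<in> space \<alpha>"
    then have y: "y \<in> X" by (simp add: space_\<alpha>)
    have "f y - C x y / \<epsilon> \<le> K + \<kappa>" using assms(3)[OF y] cost_bound[OF assms(2) y] by linarith
    then show "exp (f y - C x y / \<epsilon>) \<le> exp (K + \<kappa>)" by simp
  qed (auto intro!: soft_integrable assms)
  then show ?thesis by (simp add: mult.commute)
qed

lemma soft_ge: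
  assumes "admissible f" "x \<in> X" "\<And>y. y \<in> X \<Longrightarrow> K \<le> f y"
  shows "exp (K - \<kappa>) * mass \<alpha> \<le> soft \<alpha> f x"
proof -
  have "(\<integral>y. exp (K - \<kappa>) \<partial>\<alpha>) \<le> soft \<alpha> f x"
    unfolding soft_def
  proof (rule integral_mono)
    fix y assume "y \<in> space \<alpha>"
    then have y: "y \<in> X" by (simp add: space_\<alpha>)
    have "K - \<kappa> \<le> f y - C x y / \<epsilon>" using assms(3)[OF y] cost_bound[OF assms(2) y] by linarith
    then show "exp (K - \<kappa>) \<le> exp (f y - C x y / \<epsilon>)" by simp
  qed (auto intro!: soft_integrable assms)
  then show ?thesis by (simp add: mult.commute)
qed

lemma soft_measurable:
  assumes [measurable]: "f \<in> borel_measurable B"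
  shows "soft \<alpha> f \<in> borel_measurable B"
proof -
  note Mplus_sets[OF \<alpha>, measurable_cong]
  have "(\<lambda>z. exp (f (snd z) - C (fst z) (snd z) / \<epsilon>)) \<in> borel_measurable (B \<Otimes>\<^sub>M \<alpha>)" by measurable
  then have "(\<lambda>x. \<integral>y. exp (f (snd (x, y)) - C (fst (x, y)) (snd (x, y)) / \<epsilon>) \<partial>\<alpha>) \<in> borel_measurable B"
    by (intro borel_measurable_lebesgue_integral) (simp add: case_prod_unfold)
  then show ?thesis by (simp add: soft_def[abs_def])
qed

context
  assumes m: "0 < mass \<alpha>"
begin

lemma soft_pos: "admissible f \<Longrightarrow> x \<in> X \<Longrightarrow> 0 < soft \<alpha> f x"
proof -
  assume f: "admissible f" and x: "x \<in> X"
  obtain K where K: "\<forall>x\<in>X. \<bar>f x\<bar> \<le> K" using f by (auto simp: admissible_def)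
  have "0 < exp (- K - \<kappa>) * mass \<alpha>" using m by simp
  also have "\<dots> \<le> soft \<alpha> f x" using K by (intro soft_ge f x) (auto simp: abs_le_iff minus_le_iff)
  finally show ?thesis .
qed

lemma ln_soft_mono:
  assumes "admissible f" "admissible g" "x \<in> X" "x' \<in> X"
    and "\<And>y. y \<in> X \<Longrightarrow> f y - C x y / \<epsilon> \<le> g y - C x' y / \<epsilon> + d"
  shows "ln (soft \<alpha> f x) \<le> ln (soft \<alpha> g x') + d"
proof -
  have "ln (soft \<alpha> f x) \<le> ln (exp d * soft \<alpha> g x')"
    using soft_mono[OF assms] soft_pos assms by (subst ln_le_cancel_iff) auto
  also have "\<dots> = ln (soft \<alpha> g x') + d" using soft_pos[OF assms(2,4)] by (simp add: ln_mult)
  finally show ?thesis .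
qed

lemma ln_soft_le:
  assumes "admissible f" "x \<in> X" "\<And>y. y \<in> X \<Longrightarrow> f y \<le> K"
  shows "ln (soft \<alpha> f x) \<le> K + \<kappa> + ln (mass \<alpha>)"
proof -
  have "ln (soft \<alpha> f x) \<le> ln (exp (K + \<kappa>) * mass \<alpha>)"
    using soft_le[OF assms] soft_pos[OF assms(1,2)] m by (subst ln_le_cancel_iff) auto
  then show ?thesis using m by (simp add: ln_mult)
qed

lemma ln_soft_ge:
  assumes "admissible f" "x \<in> X" "\<And>y. y \<in> X \<Longrightarrow> K \<le> f y"
  shows "K - \<kappa> + ln (mass \<alpha>) \<le> ln (soft \<alpha> f x)"
proof -
  have "ln (exp (K - \<kappa>) * mass \<alpha>) \<le> ln (soft \<alpha> f x)"
    using soft_ge[OF assms] soft_pos[OF assms(1,2)] m by (subst ln_le_cancel_iff) auto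
  then show ?thesis using m by (simp add: ln_mult)
qed

lemma sinkhorn_map_bound:
  "\<exists>L. \<forall>f. admissible f \<longrightarrow> (\<forall>x\<in>X. \<bar>f x\<bar> \<le> K) \<longrightarrow> (\<forall>x\<in>X. \<bar>sinkhorn_map \<alpha> f x\<bar> \<le> L)"
proof (intro exI allI impI ballI)
  let ?a = "log_scale \<epsilon> (K + \<kappa> + ln (mass \<alpha>))" and ?b = "log_scale \<epsilon> (- K - \<kappa> + ln (mass \<alpha>))"
  fix f x assume f: "admissible f" "\<forall>x\<in>X. \<bar>f x\<bar> \<le> K" and x: "x \<in> X"
  have "?a \<le> sinkhorn_map \<alpha> f x" unfolding sinkhorn_map_def
    using f x by (intro log_scale_antimono eps ln_soft_le) (auto simp: abs_le_iff)
  moreover have "sinkhorn_map \<alpha> f x \<le> ?b" unfolding sinkhorn_map_def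
    using f x by (intro log_scale_antimono eps ln_soft_ge) (auto simp: abs_le_iff minus_le_iff)
  ultimately show "\<bar>sinkhorn_map \<alpha> f x\<bar> \<le> \<bar>?a\<bar> + \<bar>?b\<bar>" by linarith
qed

lemma sinkhorn_map_admissible:
  assumes f: "admissible f"
  shows "admissible (sinkhorn_map \<alpha> f)"
proof -
  have "f \<in> borel_measurable B" and "\<exists>K. \<forall>x\<in>X. \<bar>f x\<bar> \<le> K" using f by (auto simp: admissible_def)
  moreover from this have [measurable]: "soft \<alpha> f \<in> borel_measurable B" by (intro soft_measurable)
  note measurable_log_scale[OF eps, measurable]
  have "sinkhorn_map \<alpha> f \<in> borel_measurable B" unfolding sinkhorn_map_def[abs_def] by measurable
  ultimately show ?thesis using sinkhorn_map_bound f unfolding admissible_def by metis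
qed

lemma sinkhorn_map_nonexpansive:
  assumes f: "admissible f" and g: "admissible g" and x: "x \<in> X" and d: "\<And>y. y \<in> X \<Longrightarrow> \<bar>f y - g y\<bar> \<le> d"
  shows "\<bar>sinkhorn_map \<alpha> f x - sinkhorn_map \<alpha> g x\<bar> \<le> d"
proof -
  have "ln (soft \<alpha> f x) \<le> ln (soft \<alpha> g x) + d"
    by (rule ln_soft_mono[OF f g x x]) (use d in \<open>smt (verit)\<close>)
  moreover have "ln (soft \<alpha> g x) \<le> ln (soft \<alpha> f x) + d"
    by (rule ln_soft_mono[OF g f x x]) (use d in \<open>smt (verit)\<close>)
  ultimately have "\<bar>ln (soft \<alpha> f x) - ln (soft \<alpha> g x)\<bar> \<le> d" by linarith
  then show ?thesis unfolding sinkhorn_map_def using log_scale_Lipschitz[OF eps] by (rule order_trans[rotated])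
qed

text \<open>Moving x changes only the cost, by at most 2 \<kappa> after division by \<epsilon>. The
  bound is independent of f, which is the starting point of the a priori bound below.\<close>

lemma sinkhorn_map_oscillation:
  assumes f: "admissible f" and x: "x \<in> X" "x' \<in> X"
  shows "\<bar>sinkhorn_map \<alpha> f x - sinkhorn_map \<alpha> f x'\<bar> \<le> 2 * \<kappa>"
proof -
  have *: "ln (soft \<alpha> f x) \<le> ln (soft \<alpha> f x') + 2 * \<kappa>" if x: "x \<in> X" "x' \<in> X" for x x'
  proof (rule ln_soft_mono[OF f f x])
    fix y assume "y \<in> X"
    then show "f y - C x y / \<epsilon> \<le> f y - C x' y / \<epsilon> + 2 * \<kappa>"
      using cost_bound[OF x(1), of y] cost_bound[OF x(2), of y] by linarith
  qed
  then have "\<bar>ln (soft \<alpha> f x) - ln (soft \<alpha> f x')\<bar> \<le> 2 * \<kappa>" using *[OF x] *[OF x(2,1)] by linarith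
  then show ?thesis unfolding sinkhorn_map_def using log_scale_Lipschitz[OF eps] by (rule order_trans[rotated])
qed

text \<open>
  The map is only nonexpansive, so we damp it to a contraction; a bound on the damped fixed points
  that is uniform in the damping parameter then yields approximate fixed points.
\<close>

lemma damped_approx_fixpoint:
  assumes l: "0 < l" "l \<le> 1" and d: "0 < d"
  shows "\<exists>f. admissible f \<and> (\<forall>x\<in>X. \<bar>f x - (1 - l) * sinkhorn_map \<alpha> f x\<bar> \<le> d)"
proof -
  define F where "F = rec_nat (\<lambda>_. 0) (\<lambda>n f x. (1 - l) * sinkhorn_map \<alpha> f x)"
  have F: "F 0 = (\<lambda>_. 0)" "\<And>n. F (Suc n) = (\<lambda>x. (1 - l) * sinkhorn_map \<alpha> (F n) x)" by (auto simp: F_def)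
  have adm: "admissible (F n)" for n
  proof (induction n)
    case 0 show ?case by (auto simp: F admissible_def)
  next
    case (Suc n)
    from sinkhorn_map_admissible[OF Suc] obtain K where K: "\<forall>x\<in>X. \<bar>sinkhorn_map \<alpha> (F n) x\<bar> \<le> K"
      and [measurable]: "sinkhorn_map \<alpha> (F n) \<in> borel_measurable B" by (auto simp: admissible_def)
    have "\<bar>(1 - l) * sinkhorn_map \<alpha> (F n) x\<bar> \<le> (1 - l) * K" if "x \<in> X" for x
      using K l that by (auto simp: abs_mult intro!: mult_left_mono)
    then show ?case unfolding F admissible_def by auto
  qed
  obtain D where D: "\<forall>x\<in>X. \<bar>F 1 x\<bar> \<le> D" using adm[of 1] by (auto simp: admissible_def)
  have step: "\<forall>x\<in>X. \<bar>F (Suc n) x - F n x\<bar> \<le> (1 - l) ^ n * D" for n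
  proof (induction n)
    case 0 then show ?case using D by (simp add: F(1))
  next
    case (Suc n)
    show ?case
    proof
      fix x assume x: "x \<in> X"
      have "\<bar>F (Suc (Suc n)) x - F (Suc n) x\<bar> = (1 - l) * \<bar>sinkhorn_map \<alpha> (F (Suc n)) x - sinkhorn_map \<alpha> (F n) x\<bar>"
        using l unfolding F(2)[of "Suc n"] F(2)[of n] by (simp add: abs_mult right_diff_distrib[symmetric] del: right_diff_distrib)
      also have "\<dots> \<le> (1 - l) * ((1 - l) ^ n * D)"
        using l Suc by (intro mult_left_mono sinkhorn_map_nonexpansive adm x) auto
      finally show "\<bar>F (Suc (Suc n)) x - F (Suc n) x\<bar> \<le> (1 - l) ^ Suc n * D" by (simp add: mult.assoc)
    qed
  qed
  have "(\<lambda>n. (1 - l) ^ n * D) \<longlonglongrightarrow> 0 * D" using l by (intro tendsto_mult LIMSEQ_power_zero tendsto_const) auto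
  then have "\<forall>\<^sub>F n in sequentially. (1 - l) ^ n * D < d" using d by (intro order_tendstoD) auto
  then obtain n where n: "(1 - l) ^ n * D < d" by (auto simp: eventually_sequentially)
  have "\<forall>x\<in>X. \<bar>F n x - (1 - l) * sinkhorn_map \<alpha> (F n) x\<bar> \<le> d"
  proof
    fix x assume "x \<in> X"
    then have "\<bar>F (Suc n) x - F n x\<bar> \<le> d" using step[of n] n by force
    then show "\<bar>F n x - (1 - l) * sinkhorn_map \<alpha> (F n) x\<bar> \<le> d" by (simp add: F(2) abs_minus_commute)
  qed
  then show ?thesis using adm by blast
qed

text \<open>The oscillation bound and antitonicity work together. If f x \<ge> 0 then f \<ge> -k
  everywhere, so the map at x is bounded above, and so is f x; the case f x < 0 is symmetric. The
  bound does not involve l. In k, the 2 beyond 2 \<kappa> accounts for the residual at two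
  points.\<close>

lemma damped_bound:
  "\<exists>K. \<forall>l f. 0 \<le> l \<longrightarrow> l \<le> 1 \<longrightarrow> admissible f \<longrightarrow> (\<forall>x\<in>X. \<bar>f x - (1 - l) * sinkhorn_map \<alpha> f x\<bar> \<le> 1) \<longrightarrow> (\<forall>x\<in>X. \<bar>f x\<bar> \<le> K)"
proof (intro exI allI impI ballI)
  define k where "k = 2 * \<kappa> + 2"
  let ?a = "log_scale \<epsilon> (- k - \<kappa> + ln (mass \<alpha>))" and ?b = "log_scale \<epsilon> (k + \<kappa> + ln (mass \<alpha>))"
  fix l f x assume l: "0 \<le> (l::real)" "l \<le> 1" and f: "admissible f"
    and fx: "\<forall>x\<in>X. \<bar>f x - (1 - l) * sinkhorn_map \<alpha> f x\<bar> \<le> 1" and x: "x \<in> X"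
  have osc: "\<bar>f x - f y\<bar> \<le> k" if y: "y \<in> X" for y
  proof -
    have "\<bar>(1 - l) * sinkhorn_map \<alpha> f x - (1 - l) * sinkhorn_map \<alpha> f y\<bar> = (1 - l) * \<bar>sinkhorn_map \<alpha> f x - sinkhorn_map \<alpha> f y\<bar>"
      using l by (simp add: abs_mult right_diff_distrib[symmetric])
    also have "\<dots> \<le> 1 * \<bar>sinkhorn_map \<alpha> f x - sinkhorn_map \<alpha> f y\<bar>" using l by (intro mult_right_mono) auto
    also have "\<dots> \<le> 2 * \<kappa>" using sinkhorn_map_oscillation[OF f x y] by simp
    finally show ?thesis using fx x y unfolding k_def by (smt (verit, best))
  qed
  have bd: "\<bar>(1 - l) * s\<bar> \<le> \<bar>s\<bar>" for s using l by (simp add: abs_mult mult_left_le_one_le)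
  show "\<bar>f x\<bar> \<le> 1 + \<bar>?a\<bar> + \<bar>?b\<bar>"
  proof (cases "0 \<le> f x")
    case True
    have "sinkhorn_map \<alpha> f x \<le> ?a" unfolding sinkhorn_map_def
      by (intro log_scale_antimono eps ln_soft_ge f x) (use osc True in \<open>smt (verit)\<close>)
    then have "(1 - l) * sinkhorn_map \<alpha> f x \<le> (1 - l) * ?a" using l by (intro mult_left_mono) auto
    then show ?thesis using bd[of ?a] fx x True by (smt (verit, best))
  next
    case False
    have "?b \<le> sinkhorn_map \<alpha> f x" unfolding sinkhorn_map_def
      by (intro log_scale_antimono eps ln_soft_le f x) (use osc False in \<open>smt (verit)\<close>)
    then have "(1 - l) * ?b \<le> (1 - l) * sinkhorn_map \<alpha> f x" using l by (intro mult_left_mono) auto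
    then show ?thesis using bd[of ?b] fx x False by (smt (verit, best))
  qed
qed

lemma approx_fixpoints:
  "\<exists>K. \<forall>d>0. \<exists>f. admissible f \<and> (\<forall>x\<in>X. \<bar>f x\<bar> \<le> K) \<and> (\<forall>x\<in>X. \<bar>f x - sinkhorn_map \<alpha> f x\<bar> \<le> d)"
proof -
  obtain K where K: "\<And>l f x. 0 \<le> l \<Longrightarrow> l \<le> 1 \<Longrightarrow> admissible f \<Longrightarrow>
      (\<forall>x\<in>X. \<bar>f x - (1 - l) * sinkhorn_map \<alpha> f x\<bar> \<le> 1) \<Longrightarrow> x \<in> X \<Longrightarrow> \<bar>f x\<bar> \<le> K"
    using damped_bound by metis
  obtain L where L: "\<And>f x. admissible f \<Longrightarrow> (\<forall>x\<in>X. \<bar>f x\<bar> \<le> K) \<Longrightarrow> x \<in> X \<Longrightarrow> \<bar>sinkhorn_map \<alpha> f x\<bar> \<le> L"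
    using sinkhorn_map_bound by metis
  show ?thesis
  proof (intro exI[of _ K] allI impI)
    fix d :: real assume d: "0 < d"
    \<comment> \<open>Removing the damping costs l times the map, which this choice keeps below d /
      2; adding 1 to \<bar>L\<bar> keeps the denominator positive.\<close>
    define l where "l = min 1 (d / (2 * (\<bar>L\<bar> + 1)))"
    have l: "0 < l" "l \<le> 1" using d by (auto simp: l_def)
    have "l * (\<bar>L\<bar> + 1) \<le> d / (2 * (\<bar>L\<bar> + 1)) * (\<bar>L\<bar> + 1)" by (intro mult_right_mono) (auto simp: l_def)
    moreover have "d / (2 * (\<bar>L\<bar> + 1)) * (\<bar>L\<bar> + 1) = d / 2" by (simp add: divide_simps)
    ultimately have lL: "l * (\<bar>L\<bar> + 1) \<le> d / 2" by (rule ord_le_eq_trans)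
    obtain f where f: "admissible f" "\<And>x. x \<in> X \<Longrightarrow> \<bar>f x - (1 - l) * sinkhorn_map \<alpha> f x\<bar> \<le> min 1 (d / 2)"
      using damped_approx_fixpoint[OF l, of "min 1 (d / 2)"] d by auto
    then have fK: "\<forall>x\<in>X. \<bar>f x\<bar> \<le> K" using K[of l f] l by auto
    have "\<bar>f x - sinkhorn_map \<alpha> f x\<bar> \<le> d" if x: "x \<in> X" for x
    proof -
      have "\<bar>l * sinkhorn_map \<alpha> f x\<bar> \<le> l * (\<bar>L\<bar> + 1)"
        using L[OF f(1) fK x] l by (auto simp: abs_mult intro!: mult_left_mono)
      moreover have "f x - sinkhorn_map \<alpha> f x = (f x - (1 - l) * sinkhorn_map \<alpha> f x) - l * sinkhorn_map \<alpha> f x"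
        by (simp add: algebra_simps)
      ultimately show ?thesis using f(2)[OF x] lL by linarith
    qed
    then show "\<exists>f. admissible f \<and> (\<forall>x\<in>X. \<bar>f x\<bar> \<le> K) \<and> (\<forall>x\<in>X. \<bar>f x - sinkhorn_map \<alpha> f x\<bar> \<le> d)"
      using f fK by blast
  qed
qed

end

end

end

section \<open>L2 stability and existence of an exact fixed point\<close>

locale symmetric_ot_problem = ot_problem +
  assumes C_sym: "x \<in> X \<Longrightarrow> y \<in> X \<Longrightarrow> C x y = C y x"
begin

context
  fixes \<alpha> :: "'a measure"
  assumes \<alpha>: "\<alpha> \<in> Mplus X" and m: "0 < mass \<alpha>"
begin

interpretation finite_measure \<alpha> using \<alpha> by (rule Mplus_finite)

interpretation pair: pair_sigma_finite \<alpha> \<alpha> ..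

text \<open>The difference of the two marginal densities is tested against D = f - g. Symmetry of C
  allows D x to be replaced by the average of D x and D y. As D x + D y is the difference of the
  exponents, strong monotonicity of exp bounds the double integral below by that of (D x + D
  y)^2.\<close>

lemma symmetrised_estimate:
  assumes f: "f \<in> borel_measurable B" "\<And>x. x \<in> X \<Longrightarrow> \<bar>f x\<bar> \<le> K"
    and g: "g \<in> borel_measurable B" "\<And>x. x \<in> X \<Longrightarrow> \<bar>g x\<bar> \<le> K"
    and le: "\<And>x. x \<in> X \<Longrightarrow> (exp (f x) * soft \<alpha> f x - exp (g x) * soft \<alpha> g x) * (f x - g x) \<le> d"
  shows "exp (- 2 * K - \<kappa>) * (\<integral>x. (f x - g x)\<^sup>2 \<partial>\<alpha>) \<le> d"
proof -
  note [measurable] = f(1) g(1) and Mplus_sets[OF \<alpha>, measurable_cong]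
  let ?P = "\<alpha> \<Otimes>\<^sub>M \<alpha>"
  have finP: "finite_measure ?P" by (intro finite_measure_pair finite_measure_axioms)
  define D where "D x = f x - g x" for x
  have Db: "\<bar>D x\<bar> \<le> 2 * K" if "x \<in> X" for x using f(2)[OF that] g(2)[OF that] unfolding D_def by linarith
  have [measurable]: "D \<in> borel_measurable B" unfolding D_def[abs_def] by measurable
  have K0: "0 \<le> K" if "x \<in> X" for x using f(2)[OF that] by linarith
  have adm: "admissible f" "admissible g" using f g by (auto simp: admissible_def)
  define G where "G h z = exp (h (fst z) + h (snd z) - C (fst z) (snd z) / \<epsilon>)" for h and z :: "'a \<times> 'a"
  have Gm[measurable]: "G f \<in> borel_measurable ?P" "G g \<in> borel_measurable ?P"
    unfolding G_def by measurable
  have Gb: "\<bar>G h z\<bar> \<le> exp (2 * K + \<kappa>)" if "z \<in> space ?P" "\<And>x. x \<in> X \<Longrightarrow> \<bar>h x\<bar> \<le> K" for h z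
  proof -
    have "fst z \<in> X" "snd z \<in> X" using that(1) by (auto simp: space_pair_measure Mplus_space[OF \<alpha>])
    then have "h (fst z) + h (snd z) - C (fst z) (snd z) / \<epsilon> \<le> 2 * K + \<kappa>"
      using that(2)[of "fst z"] that(2)[of "snd z"] cost_bound[of "fst z" "snd z"] by linarith
    then show ?thesis by (simp add: G_def)
  qed
  have zX: "fst z \<in> X" "snd z \<in> X" if "z \<in> space ?P" for z
    using that by (auto simp: space_pair_measure Mplus_space[OF \<alpha>])
  have iG: "integrable ?P (\<lambda>z. (G f z - G g z) * D (fst z))" "integrable ?P (\<lambda>z. (G f z - G g z) * D (snd z))"
  proof -
    have "\<bar>(G f z - G g z) * D x\<bar> \<le> 2 * exp (2 * K + \<kappa>) * (2 * K)" if "z \<in> space ?P" "x \<in> X" for z x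
    proof -
      have "\<bar>G f z\<bar> \<le> exp (2 * K + \<kappa>)" by (rule Gb[OF that(1)]) (rule f(2))
      moreover have "\<bar>G g z\<bar> \<le> exp (2 * K + \<kappa>)" by (rule Gb[OF that(1)]) (rule g(2))
      ultimately have "\<bar>G f z - G g z\<bar> \<le> 2 * exp (2 * K + \<kappa>)" by linarith
      then show ?thesis unfolding abs_mult using Db[OF that(2)] by (intro mult_mono) auto
    qed
    then show "integrable ?P (\<lambda>z. (G f z - G g z) * D (fst z))" "integrable ?P (\<lambda>z. (G f z - G g z) * D (snd z))"
      using zX by (auto intro!: bounded_integrable[OF finP, where K="2 * exp (2 * K + \<kappa>) * (2 * K)"])
  qed
  define J where "J = (\<integral>z. (G f z - G g z) * D (fst z) \<partial>?P)"
  have Gsoft: "(\<integral>y. G f (x, y) - G g (x, y) \<partial>\<alpha>) = exp (f x) * soft \<alpha> f x - exp (g x) * soft \<alpha> g x" if x: "x \<in> X" for x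
  proof -
    have "G h (x, y) = exp (h x) * exp (h y - C x y / \<epsilon>)" for h y by (simp add: G_def exp_add[symmetric])
    then show ?thesis
      using soft_integrable[OF \<alpha> adm(1) x] soft_integrable[OF \<alpha> adm(2) x] by (simp add: soft_def)
  qed
  have J1: "J = (\<integral>x. (exp (f x) * soft \<alpha> f x - exp (g x) * soft \<alpha> g x) * D x \<partial>\<alpha>)"
  proof -
    have "J = (\<integral>x. \<integral>y. (G f (x, y) - G g (x, y)) * D x \<partial>\<alpha> \<partial>\<alpha>)"
      unfolding J_def using pair.integral_fst'[OF iG(1)] by simp
    also have "\<dots> = (\<integral>x. (exp (f x) * soft \<alpha> f x - exp (g x) * soft \<alpha> g x) * D x \<partial>\<alpha>)"
      using Gsoft by (intro Bochner_Integration.integral_cong) (auto simp: Mplus_space[OF \<alpha>])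
    finally show ?thesis .
  qed
  have "integrable \<alpha> (\<lambda>x. \<integral>y. (G f (x, y) - G g (x, y)) * D x \<partial>\<alpha>)"
    using pair.integrable_fst'[OF iG(1)] by simp
  also have "?this \<longleftrightarrow> integrable \<alpha> (\<lambda>x. (exp (f x) * soft \<alpha> f x - exp (g x) * soft \<alpha> g x) * D x)"
    by (rule Bochner_Integration.integrable_cong) (simp_all add: Mplus_space[OF \<alpha>] Gsoft)
  finally have "J \<le> (\<integral>x. d \<partial>\<alpha>)"
    unfolding J1 using le by (intro integral_mono) (auto simp: Mplus_space[OF \<alpha>] D_def)
  then have Jd: "J \<le> d * mass \<alpha>" by (simp add: mult.commute)
  have "J = (\<integral>z. (G f z - G g z) * D (snd z) \<partial>?P)"
  proof -
    have "(\<integral>z. (G f z - G g z) * D (snd z) \<partial>?P) = (\<integral>(x, y). (G f (y, x) - G g (y, x)) * D x \<partial>?P)"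
      using pair.integral_product_swap[of "\<lambda>z. (G f z - G g z) * D (snd z)"] by (simp add: case_prod_unfold)
    also have "\<dots> = J" unfolding J_def
      using C_sym by (intro Bochner_Integration.integral_cong) (auto simp: G_def space_pair_measure Mplus_space[OF \<alpha>] add.commute)
    finally show ?thesis by simp
  qed
  then have J2: "2 * J = (\<integral>z. (G f z - G g z) * (D (fst z) + D (snd z)) \<partial>?P)"
    using iG by (simp add: J_def distrib_left)
  have iD: "integrable ?P (\<lambda>z. (D (fst z) + D (snd z))\<^sup>2)"
  proof (rule bounded_integrable[OF finP])
    fix z assume z: "z \<in> space ?P"
    have "\<bar>D (fst z) + D (snd z)\<bar> \<le> 4 * K" using Db[OF zX(1)[OF z]] Db[OF zX(2)[OF z]] by linarith
    then have "(D (fst z) + D (snd z))\<^sup>2 \<le> (4 * K)\<^sup>2" by (metis abs_ge_zero power2_abs power_mono)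
    then show "\<bar>(D (fst z) + D (snd z))\<^sup>2\<bar> \<le> (4 * K)\<^sup>2" by simp
  qed measurable
  have "exp (- 2 * K - \<kappa>) * (\<integral>z. (D (fst z) + D (snd z))\<^sup>2 \<partial>?P) = (\<integral>z. exp (- 2 * K - \<kappa>) * (D (fst z) + D (snd z))\<^sup>2 \<partial>?P)"
    by simp
  also have "\<dots> \<le> 2 * J" unfolding J2
  proof (rule integral_mono)
    show "integrable ?P (\<lambda>z. (G f z - G g z) * (D (fst z) + D (snd z)))" using iG by (simp add: distrib_left)
    fix z assume z: "z \<in> space ?P"
    define c where "c = C (fst z) (snd z) / \<epsilon>"
    define a b where "a = f (fst z) + f (snd z) - c" and "b = g (fst z) + g (snd z) - c"
    have c: "\<bar>c\<bar> \<le> \<kappa>" using cost_bound zX[OF z] by (simp add: c_def)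
    have "-2 * K - \<kappa> \<le> a" "-2 * K - \<kappa> \<le> b"
      using c f(2)[OF zX(1)[OF z]] f(2)[OF zX(2)[OF z]] g(2)[OF zX(1)[OF z]] g(2)[OF zX(2)[OF z]]
      unfolding a_def b_def by linarith+
    from exp_mult_diff_ge[OF this] have "exp (-2 * K - \<kappa>) * (a - b)\<^sup>2 \<le> (exp a - exp b) * (a - b)" .
    moreover have "a - b = D (fst z) + D (snd z)" by (simp add: a_def b_def D_def)
    moreover have "exp a = G f z" "exp b = G g z" by (simp_all add: a_def b_def G_def c_def)
    ultimately show "exp (- 2 * K - \<kappa>) * (D (fst z) + D (snd z))\<^sup>2 \<le> (G f z - G g z) * (D (fst z) + D (snd z))" by simp
  qed (use iD in simp)
  finally have lower: "exp (- 2 * K - \<kappa>) * (\<integral>z. (D (fst z) + D (snd z))\<^sup>2 \<partial>?P) \<le> 2 * (d * mass \<alpha>)" using Jd by linarith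
  have iD1: "integrable \<alpha> D" using Db by (intro bounded_integrable[OF finite_measure_axioms]) (auto simp: Mplus_space[OF \<alpha>])
  have iD2: "integrable \<alpha> (\<lambda>x. (D x)\<^sup>2)"
  proof (rule bounded_integrable[OF finite_measure_axioms])
    fix x assume "x \<in> space \<alpha>"
    then have "\<bar>D x\<bar> \<le> 2 * K" using Db by (simp add: Mplus_space[OF \<alpha>])
    then have "(D x)\<^sup>2 \<le> (2 * K)\<^sup>2" by (metis abs_ge_zero power2_abs power_mono)
    then show "\<bar>(D x)\<^sup>2\<bar> \<le> (2 * K)\<^sup>2" by simp
  qed measurable
  have "(\<integral>z. (D (fst z) + D (snd z))\<^sup>2 \<partial>?P) = (\<integral>x. \<integral>y. (D x + D y)\<^sup>2 \<partial>\<alpha> \<partial>\<alpha>)"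
    using pair.integral_fst'[OF iD] by simp
  also have "\<dots> = (\<integral>x. (D x)\<^sup>2 * mass \<alpha> + 2 * D x * (\<integral>y. D y \<partial>\<alpha>) + (\<integral>y. (D y)\<^sup>2 \<partial>\<alpha>) \<partial>\<alpha>)"
    using iD1 iD2 by (simp add: power2_sum mult.commute mult.left_commute add_ac)
  also have "\<dots> = 2 * mass \<alpha> * (\<integral>x. (D x)\<^sup>2 \<partial>\<alpha>) + 2 * (\<integral>y. D y \<partial>\<alpha>)\<^sup>2"
  proof -
    have "(\<integral>x. (D x)\<^sup>2 * a + 2 * D x * b + c \<partial>\<alpha>) = (\<integral>x. (D x)\<^sup>2 \<partial>\<alpha>) * a + 2 * (\<integral>x. D x \<partial>\<alpha>) * b + mass \<alpha> * c" for a b c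
      using iD1 iD2 by simp
    then show ?thesis by (simp add: power2_eq_square[of "integral\<^sup>L \<alpha> D"] mult.commute)
  qed
  finally have "2 * mass \<alpha> * (\<integral>x. (D x)\<^sup>2 \<partial>\<alpha>) \<le> (\<integral>z. (D (fst z) + D (snd z))\<^sup>2 \<partial>?P)" by simp
  then have "exp (- 2 * K - \<kappa>) * (2 * mass \<alpha> * (\<integral>x. (D x)\<^sup>2 \<partial>\<alpha>)) \<le> exp (- 2 * K - \<kappa>) * (\<integral>z. (D (fst z) + D (snd z))\<^sup>2 \<partial>?P)"
    by (intro mult_left_mono) auto
  with lower have "exp (- 2 * K - \<kappa>) * (2 * mass \<alpha> * (\<integral>x. (D x)\<^sup>2 \<partial>\<alpha>)) \<le> 2 * (d * mass \<alpha>)"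
    by (rule order_trans[rotated])
  then have "(exp (- 2 * K - \<kappa>) * (\<integral>x. (D x)\<^sup>2 \<partial>\<alpha>)) * (2 * mass \<alpha>) \<le> d * (2 * mass \<alpha>)"
    by (simp only: mult_ac)
  then show ?thesis using m by (simp add: D_def)
qed

text \<open>For exact fixed points \<open>log_scale_monotone\<close> makes the tested difference
  nonpositive, so they agree in L2. Residuals of size d perturb this by a multiple of d, giving L1
  distance of order sqrt d. One more application of the map, which integrates its argument, turns
  this into a sup bound.\<close>

lemma approx_fixpoint_stability:
  "\<exists>A. \<forall>f g d. admissible f \<longrightarrow> admissible g \<longrightarrow> 0 < d \<longrightarrow> d \<le> 1 \<longrightarrow>
     (\<forall>x\<in>X. \<bar>f x\<bar> \<le> K \<and> \<bar>g x\<bar> \<le> K \<and> \<bar>f x - sinkhorn_map \<alpha> f x\<bar> \<le> d \<and> \<bar>g x - sinkhorn_map \<alpha> g x\<bar> \<le> d) \<longrightarrow>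
     (\<forall>x\<in>X. \<bar>f x - g x\<bar> \<le> A * sqrt d)"
proof -
  \<comment> \<open>H bounds \<open>soft\<close>, and b bounds f and its image since the residual is
    at most 1. K1, K2 and K3 are the constants of the pointwise, the L2 and the sup
    estimate.\<close>
  define H where "H = exp (K + \<kappa>) * mass \<alpha>"
  define b where "b = K + 1"
  define K1 where "K1 = 4 * (H * exp b) * K + 4 * (H * exp b)"
  define K2 where "K2 = K1 * exp (2 * K + \<kappa>)"
  define K3 where "K3 = exp (K + \<kappa>) * ((K2 + mass \<alpha>) / 2) / (exp (- K - \<kappa>) * mass \<alpha>)"
  show ?thesis
  proof (intro exI allI impI)
    fix f g :: "'a \<Rightarrow> real" and d :: real
    assume f: "admissible f" and g: "admissible g" and d: "0 < d" "d \<le> 1"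
      and all: "\<forall>x\<in>X. \<bar>f x\<bar> \<le> K \<and> \<bar>g x\<bar> \<le> K \<and> \<bar>f x - sinkhorn_map \<alpha> f x\<bar> \<le> d \<and> \<bar>g x - sinkhorn_map \<alpha> g x\<bar> \<le> d"
    note Mplus_sets[OF \<alpha>, measurable_cong]
    have fm[measurable]: "f \<in> borel_measurable B" "g \<in> borel_measurable B" using f g by (auto simp: admissible_def)
    let ?S = "sinkhorn_map \<alpha>"
    have H0: "0 \<le> H" using m by (simp add: H_def)
    have pt: "(exp (f x) * soft \<alpha> f x - exp (g x) * soft \<alpha> g x) * (f x - g x) \<le> K1 * d" if x: "x \<in> X" for x
    proof -
      have K0: "0 \<le> K" using all x by fastforce
      have *: "\<bar>exp (u x) * soft \<alpha> u x - exp (?S u x) * soft \<alpha> u x\<bar> \<le> H * exp b * d \<and>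
          \<bar>exp (?S u x) * soft \<alpha> u x\<bar> \<le> H * exp b"
        if u: "admissible u" "\<forall>x\<in>X. \<bar>u x\<bar> \<le> K \<and> \<bar>u x - ?S u x\<bar> \<le> d" for u
      proof -
        have s: "0 < soft \<alpha> u x" "soft \<alpha> u x \<le> H"
          using soft_pos[OF \<alpha> m u(1) x] soft_le[OF \<alpha> u(1) x, of K] u(2) by (auto simp: H_def abs_le_iff)
        have sb: "u x \<le> b" "?S u x \<le> b" using u(2) x d(2) unfolding b_def by (smt (verit))+
        have "\<bar>exp (u x) - exp (?S u x)\<bar> \<le> exp b * \<bar>u x - ?S u x\<bar>" by (rule exp_diff_le[OF sb])
        also have "\<dots> \<le> exp b * d" using u(2) x by (intro mult_left_mono) auto
        finally have "\<bar>exp (u x) - exp (?S u x)\<bar> * soft \<alpha> u x \<le> (exp b * d) * H"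
          using s d by (intro mult_mono) auto
        moreover have "exp (?S u x) * soft \<alpha> u x \<le> exp b * H" using s sb by (intro mult_mono) auto
        moreover have "\<bar>exp (u x) * soft \<alpha> u x - exp (?S u x) * soft \<alpha> u x\<bar> = \<bar>exp (u x) - exp (?S u x)\<bar> * soft \<alpha> u x"
          using s by (simp only: left_diff_distrib[symmetric] abs_mult abs_of_pos)
        ultimately show ?thesis using s by (simp add: mult_ac)
      qed
      define P P' p p' where "P = exp (f x) * soft \<alpha> f x" and "P' = exp (g x) * soft \<alpha> g x"
        and "p = exp (?S f x) * soft \<alpha> f x" and "p' = exp (?S g x) * soft \<alpha> g x"
      have 1: "\<bar>P - p\<bar> \<le> H * exp b * d" "\<bar>p\<bar> \<le> H * exp b" using *[OF f] all by (auto simp: P_def p_def)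
      have 2: "\<bar>P' - p'\<bar> \<le> H * exp b * d" "\<bar>p'\<bar> \<le> H * exp b" using *[OF g] all by (auto simp: P'_def p'_def)
      have p: "p = exp (?S f x + ln (soft \<alpha> f x))" "p' = exp (?S g x + ln (soft \<alpha> g x))"
        using soft_pos[OF \<alpha> m f x] soft_pos[OF \<alpha> m g x] by (simp_all add: p_def p'_def exp_add)
      have mono: "(p - p') * (?S f x - ?S g x) \<le> 0"
        unfolding p sinkhorn_map_def by (rule log_scale_monotone[OF eps])
      \<comment> \<open>f and g are replaced by their images under the map: the main term has a sign
        by monotonicity, and each remaining term carries a residual of size d.\<close>
      have "(P - P') * (f x - g x) = (p - p') * (?S f x - ?S g x) + ((P - p) - (P' - p')) * (f x - g x)
          + (p - p') * ((f x - ?S f x) - (g x - ?S g x))"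
        by (simp add: algebra_simps)
      moreover have "((P - p) - (P' - p')) * (f x - g x) \<le> (2 * (H * exp b * d)) * (2 * K)"
      proof -
        have "\<bar>((P - p) - (P' - p')) * (f x - g x)\<bar> \<le> (2 * (H * exp b * d)) * (2 * K)"
          unfolding abs_mult using 1 2 all x by (intro mult_mono) (smt (verit))+
        then show ?thesis by linarith
      qed
      moreover have "(p - p') * ((f x - ?S f x) - (g x - ?S g x)) \<le> (2 * (H * exp b)) * (2 * d)"
      proof -
        have "\<bar>(p - p') * ((f x - ?S f x) - (g x - ?S g x))\<bar> \<le> (2 * (H * exp b)) * (2 * d)"
          unfolding abs_mult using 1 2 all x by (intro mult_mono) (smt (verit))+
        then show ?thesis by linarith
      qed
      ultimately have "(P - P') * (f x - g x) \<le> K1 * d" using mono unfolding K1_def by (simp add: algebra_simps)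
      then show ?thesis by (simp add: P_def P'_def)
    qed
    have "exp (- 2 * K - \<kappa>) * (\<integral>x. (f x - g x)\<^sup>2 \<partial>\<alpha>) \<le> K1 * d"
      using all by (intro symmetrised_estimate fm pt) auto
    then have "exp (2 * K + \<kappa>) * (exp (- 2 * K - \<kappa>) * (\<integral>x. (f x - g x)\<^sup>2 \<partial>\<alpha>)) \<le> exp (2 * K + \<kappa>) * (K1 * d)"
      by (intro mult_left_mono) auto
    moreover have "exp (2 * K + \<kappa>) * (exp (- 2 * K - \<kappa>) * I) = I" for I :: real
      by (simp add: mult.assoc[symmetric] exp_add[symmetric] del: exp_add)
    ultimately have "(\<integral>x. (f x - g x)\<^sup>2 \<partial>\<alpha>) \<le> exp (2 * K + \<kappa>) * (K1 * d)" by metis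
    then have l2: "(\<integral>x. (f x - g x)\<^sup>2 \<partial>\<alpha>) \<le> K2 * d" by (simp only: K2_def mult_ac)
    have Db: "\<bar>f x - g x\<bar> \<le> 2 * K" if "x \<in> X" for x using all that by (smt (verit))
    have i1: "integrable \<alpha> (\<lambda>x. \<bar>f x - g x\<bar>)"
      using Db by (intro bounded_integrable[OF finite_measure_axioms]) (auto simp: Mplus_space[OF \<alpha>])
    have i2: "integrable \<alpha> (\<lambda>x. (f x - g x)\<^sup>2)"
    proof (rule bounded_integrable[OF finite_measure_axioms])
      fix x assume "x \<in> space \<alpha>"
      then have "\<bar>f x - g x\<bar> \<le> 2 * K" using Db by (simp add: Mplus_space[OF \<alpha>])
      then have "(f x - g x)\<^sup>2 \<le> (2 * K)\<^sup>2" by (metis abs_ge_zero power2_abs power_mono)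
      then show "\<bar>(f x - g x)\<^sup>2\<bar> \<le> (2 * K)\<^sup>2" by simp
    qed measurable
    have sd: "0 < sqrt d" "sqrt d * sqrt d = d" using d by auto
    \<comment> \<open>Weighted Young inequality; the weight sqrt d balances an L2 bound of order d
      against the constant term.\<close>
    have "(\<integral>x. \<bar>f x - g x\<bar> \<partial>\<alpha>) \<le> (\<integral>x. ((f x - g x)\<^sup>2 / sqrt d + sqrt d) / 2 \<partial>\<alpha>)"
    proof (rule integral_mono)
      fix x
      have "0 \<le> (\<bar>f x - g x\<bar> - sqrt d)\<^sup>2" by simp
      then have "2 * \<bar>f x - g x\<bar> * sqrt d \<le> (f x - g x)\<^sup>2 + sqrt d * sqrt d"
        by (simp add: power2_diff power2_eq_square[of "sqrt d"])
      then show "\<bar>f x - g x\<bar> \<le> ((f x - g x)\<^sup>2 / sqrt d + sqrt d) / 2" using sd(1) by (simp add: field_simps)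
    qed (use i1 i2 in auto)
    also have "\<dots> = ((\<integral>x. (f x - g x)\<^sup>2 \<partial>\<alpha>) / sqrt d + mass \<alpha> * sqrt d) / 2"
      using i2 by simp
    also have "\<dots> \<le> (K2 * d / sqrt d + mass \<alpha> * sqrt d) / 2"
      using l2 sd by (intro divide_right_mono add_mono) auto
    also have "\<dots> = (K2 + mass \<alpha>) / 2 * sqrt d" using sd by (simp add: field_simps)
    finally have l1: "(\<integral>x. \<bar>f x - g x\<bar> \<partial>\<alpha>) \<le> (K2 + mass \<alpha>) / 2 * sqrt d" .
    show "\<forall>x\<in>X. \<bar>f x - g x\<bar> \<le> (K3 + 2) * sqrt d"
    proof
      fix x assume x: "x \<in> X"
      note if' = soft_integrable[OF \<alpha> f x] soft_integrable[OF \<alpha> g x]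
      \<comment> \<open>\<open>soft\<close> sees f and g only under the integral, so the L1 bound
        controls it at every x of X, including \<alpha>-null points.\<close>
      have "\<bar>soft \<alpha> f x - soft \<alpha> g x\<bar> = \<bar>\<integral>y. exp (f y - C x y / \<epsilon>) - exp (g y - C x y / \<epsilon>) \<partial>\<alpha>\<bar>"
        using if' by (simp add: soft_def)
      also have "\<dots> \<le> (\<integral>y. \<bar>exp (f y - C x y / \<epsilon>) - exp (g y - C x y / \<epsilon>)\<bar> \<partial>\<alpha>)"
        by (rule integral_abs_bound)
      also have "\<dots> \<le> (\<integral>y. exp (K + \<kappa>) * \<bar>f y - g y\<bar> \<partial>\<alpha>)"
      proof (rule integral_mono)
        fix y assume "y \<in> space \<alpha>"
        then have y: "y \<in> X" by (simp add: Mplus_space[OF \<alpha>])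
        have "f y \<le> K" "g y \<le> K" using all y by (auto simp: abs_le_iff)
        then have "f y - C x y / \<epsilon> \<le> K + \<kappa>" "g y - C x y / \<epsilon> \<le> K + \<kappa>"
          using cost_bound[OF x y] by linarith+
        from exp_diff_le[OF this] show "\<bar>exp (f y - C x y / \<epsilon>) - exp (g y - C x y / \<epsilon>)\<bar> \<le> exp (K + \<kappa>) * \<bar>f y - g y\<bar>" by simp
      qed (use if' i1 in auto)
      also have "\<dots> = exp (K + \<kappa>) * (\<integral>y. \<bar>f y - g y\<bar> \<partial>\<alpha>)" by simp
      also have "\<dots> \<le> exp (K + \<kappa>) * ((K2 + mass \<alpha>) / 2 * sqrt d)" by (intro mult_left_mono l1) simp
      finally have sdiff: "\<bar>soft \<alpha> f x - soft \<alpha> g x\<bar> \<le> exp (K + \<kappa>) * ((K2 + mass \<alpha>) / 2 * sqrt d)" .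
      have lo: "exp (- K - \<kappa>) * mass \<alpha> \<le> soft \<alpha> f x" "exp (- K - \<kappa>) * mass \<alpha> \<le> soft \<alpha> g x"
        using all by (auto intro!: soft_ge[OF \<alpha>] f g x simp: abs_le_iff minus_le_iff)
      have "\<bar>?S f x - ?S g x\<bar> \<le> \<bar>ln (soft \<alpha> f x) - ln (soft \<alpha> g x)\<bar>"
        unfolding sinkhorn_map_def by (rule log_scale_Lipschitz[OF eps])
      also have "\<dots> \<le> \<bar>soft \<alpha> f x - soft \<alpha> g x\<bar> / (exp (- K - \<kappa>) * mass \<alpha>)"
        using m by (intro ln_diff_le lo) auto
      also have "\<dots> \<le> exp (K + \<kappa>) * ((K2 + mass \<alpha>) / 2 * sqrt d) / (exp (- K - \<kappa>) * mass \<alpha>)"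
        using m by (intro divide_right_mono sdiff) auto
      also have "\<dots> = K3 * sqrt d" by (simp add: K3_def)
      finally have "\<bar>?S f x - ?S g x\<bar> \<le> K3 * sqrt d" .
      moreover have "d \<le> sqrt d" using d by (simp add: real_le_rsqrt power2_eq_square mult_left_le)
      moreover have "\<bar>f x - ?S f x\<bar> \<le> d" "\<bar>g x - ?S g x\<bar> \<le> d" using all x by auto
      ultimately have "\<bar>f x - g x\<bar> \<le> K3 * sqrt d + 2 * sqrt d" by linarith
      then show "\<bar>f x - g x\<bar> \<le> (K3 + 2) * sqrt d" by (simp add: distrib_right)
    qed
  qed
qed

text \<open>Approximate fixed points with residual 1 / (n + 1) are uniformly Cauchy by stability,
  and nonexpansiveness carries the equation to their limit.\<close>

lemma sinkhorn_fixpoint: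
  "\<exists>f. admissible f \<and> (\<forall>x\<in>X. sinkhorn_map \<alpha> f x = f x)"
proof -
  obtain K where "\<forall>d>0. \<exists>f. admissible f \<and> (\<forall>x\<in>X. \<bar>f x\<bar> \<le> K) \<and> (\<forall>x\<in>X. \<bar>f x - sinkhorn_map \<alpha> f x\<bar> \<le> d)"
    using approx_fixpoints[OF \<alpha> m] by blast
  then have "\<forall>n. \<exists>f. admissible f \<and> (\<forall>x\<in>X. \<bar>f x\<bar> \<le> K) \<and> (\<forall>x\<in>X. \<bar>f x - sinkhorn_map \<alpha> f x\<bar> \<le> 1 / real (Suc n))"
    by simp
  then obtain F where F: "\<And>n. admissible (F n)" "\<And>n x. x \<in> X \<Longrightarrow> \<bar>F n x\<bar> \<le> K"
      "\<And>n x. x \<in> X \<Longrightarrow> \<bar>F n x - sinkhorn_map \<alpha> (F n) x\<bar> \<le> 1 / real (Suc n)"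
    by metis
  obtain A where A: "\<And>f g d x. admissible f \<Longrightarrow> admissible g \<Longrightarrow> 0 < d \<Longrightarrow> d \<le> 1 \<Longrightarrow>
     (\<forall>x\<in>X. \<bar>f x\<bar> \<le> K \<and> \<bar>g x\<bar> \<le> K \<and> \<bar>f x - sinkhorn_map \<alpha> f x\<bar> \<le> d \<and> \<bar>g x - sinkhorn_map \<alpha> g x\<bar> \<le> d) \<Longrightarrow>
     x \<in> X \<Longrightarrow> \<bar>f x - g x\<bar> \<le> A * sqrt d"
    using approx_fixpoint_stability[of K] by metis
  define e where "e n = A * sqrt (1 / real (Suc n))" for n
  have dist: "\<bar>F n x - F k x\<bar> \<le> e n" if "n \<le> k" "x \<in> X" for n k x
    unfolding e_def
  proof (rule A[OF F(1) F(1)])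
    have "1 / real (Suc k) \<le> 1 / real (Suc n)" using that by (intro divide_left_mono) auto
    then show "\<forall>x\<in>X. \<bar>F n x\<bar> \<le> K \<and> \<bar>F k x\<bar> \<le> K \<and> \<bar>F n x - sinkhorn_map \<alpha> (F n) x\<bar> \<le> 1 / real (Suc n)
        \<and> \<bar>F k x - sinkhorn_map \<alpha> (F k) x\<bar> \<le> 1 / real (Suc n)"
      using F by (meson order_trans)
  qed (use that in auto)
  have "(\<lambda>n. A * sqrt (inverse (real (Suc n)))) \<longlonglongrightarrow> A * sqrt 0"
    by (intro tendsto_mult tendsto_const tendsto_real_sqrt LIMSEQ_inverse_real_of_nat)
  then have e0: "e \<longlonglongrightarrow> 0" unfolding e_def by (simp add: inverse_eq_divide)
  have conv: "convergent (\<lambda>n. F n x)" if x: "x \<in> X" for x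
  proof (rule real_Cauchy_convergent, rule CauchyI)
    fix r :: real assume "0 < r"
    then have "\<forall>\<^sub>F n in sequentially. e n < r / 2" using e0 by (intro order_tendstoD) auto
    then obtain N where N: "e N < r / 2" by (auto simp: eventually_sequentially)
    show "\<exists>N. \<forall>m\<ge>N. \<forall>n\<ge>N. norm (F m x - F n x) < r"
    proof (intro exI allI impI)
      fix m n assume "N \<le> m" "N \<le> n"
      then show "norm (F m x - F n x) < r" using dist[of N m x] dist[of N n x] x N by auto
    qed
  qed
  define f where "f x = lim (\<lambda>n. F n x)" for x
  have lim: "(\<lambda>n. F n x) \<longlonglongrightarrow> f x" if "x \<in> X" for x
    using conv[OF that] unfolding f_def by (simp add: convergent_LIMSEQ_iff)
  have fb: "\<bar>f x\<bar> \<le> K" if x: "x \<in> X" for x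
    using tendsto_rabs[OF lim[OF x]] F(2)[OF x] by (intro tendsto_upperbound[of "\<lambda>n. \<bar>F n x\<bar>"]) auto
  have fF: "\<bar>F n x - f x\<bar> \<le> e n" if x: "x \<in> X" for n x
  proof (rule tendsto_upperbound)
    show "(\<lambda>k. \<bar>F n x - F k x\<bar>) \<longlonglongrightarrow> \<bar>F n x - f x\<bar>" by (intro tendsto_intros lim x)
    show "\<forall>\<^sub>F k in sequentially. \<bar>F n x - F k x\<bar> \<le> e n"
      using eventually_ge_at_top[of n] by eventually_elim (rule dist[OF _ x])
  qed simp
  have "f \<in> borel_measurable B"
    using F(1) lim by (intro borel_measurable_LIMSEQ_real[of B F f]) (auto simp: space_restrict_space admissible_def)
  then have f: "admissible f" using fb by (auto simp: admissible_def)
  have "sinkhorn_map \<alpha> f x = f x" if x: "x \<in> X" for x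
  proof -
    have "\<bar>f x - sinkhorn_map \<alpha> f x\<bar> \<le> 2 * e n + 1 / real (Suc n)" for n
    proof -
      have "\<bar>sinkhorn_map \<alpha> (F n) x - sinkhorn_map \<alpha> f x\<bar> \<le> e n"
        by (rule sinkhorn_map_nonexpansive[OF \<alpha> m F(1) f x fF])
      then show ?thesis using F(3)[OF x, of n] fF[OF x, of n] by linarith
    qed
    moreover have "(\<lambda>n. 2 * e n + 1 / real (Suc n)) \<longlonglongrightarrow> 2 * 0 + 0"
      using LIMSEQ_inverse_real_of_nat by (intro tendsto_add tendsto_mult tendsto_const e0) (simp add: inverse_eq_divide)
    ultimately have "\<bar>f x - sinkhorn_map \<alpha> f x\<bar> \<le> 2 * 0 + 0" by (intro tendsto_lowerbound) auto
    then show ?thesis by simp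
  qed
  then show ?thesis using f by blast
qed

end

end

section \<open>Optimality on the diagonal and existence of potentials\<close>

context symmetric_ot_problem
begin

text \<open>
  The primal candidate is \<open>exp (f \<oplus> f - C / \<epsilon>) (\<alpha> \<otimes> \<alpha>)\<close>: equality in the pointwise Fenchel
  inequalities behind weak duality makes its cost equal to the dual value of \<open>(f, u)\<close>.
\<close>

lemma OT_diag:
  assumes \<alpha>: "\<alpha> \<in> Mplus X" and fu: "dual_pair f u"
    and opt: "AE x in \<alpha>. \<phi> (exp (f x) * soft \<alpha> f x) = ennreal (u x - \<epsilon> * f x * (exp (f x) * soft \<alpha> f x))
      \<and> 0 \<le> u x - \<epsilon> * f x * (exp (f x) * soft \<alpha> f x)"
  shows "OT X C \<epsilon> \<phi> \<alpha> \<alpha> = ereal (2 * (\<integral>x. u x \<partial>\<alpha>) + \<epsilon> * (mass \<alpha>)\<^sup>2 - \<epsilon> * soft_mass f f \<alpha> \<alpha>)"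
proof (rule antisym)
  interpret finite_measure \<alpha> using \<alpha> by (rule Mplus_finite)
  interpret pair: pair_sigma_finite \<alpha> \<alpha> ..
  note Mplus_sets[OF \<alpha>, measurable_cong]
  note sp = Mplus_space[OF \<alpha>]
  let ?P = "\<alpha> \<Otimes>\<^sub>M \<alpha>"
  have finP: "finite_measure ?P" by (intro finite_measure_pair finite_measure_axioms)
  have [measurable]: "f \<in> borel_measurable B" "u \<in> borel_measurable B" using fu by (auto simp: dual_pair_def)
  obtain K where K: "\<And>x. x \<in> X \<Longrightarrow> \<bar>f x\<bar> \<le> K" "\<And>x. x \<in> X \<Longrightarrow> \<bar>u x\<bar> \<le> K" using fu by (auto simp: dual_pair_def)
  have adm: "admissible f" using fu by (auto simp: dual_pair_def admissible_def)
  have [measurable]: "soft \<alpha> f \<in> borel_measurable B" by (rule soft_measurable[OF \<alpha>]) measurable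
  define T where "T z = f (fst z) + f (snd z) - C (fst z) (snd z) / \<epsilon>" for z
  have [measurable]: "T \<in> borel_measurable ?P" unfolding T_def[abs_def] by measurable
  have eTm: "(\<lambda>z. ennreal (exp (T z))) \<in> borel_measurable ?P" by measurable
  have zX: "fst z \<in> X" "snd z \<in> X" if "z \<in> space ?P" for z using that by (auto simp: space_pair_measure sp)
  have Tb: "\<bar>T z\<bar> \<le> 2 * K + \<kappa>" if "z \<in> space ?P" for z
    using K(1)[OF zX(1)[OF that]] K(1)[OF zX(2)[OF that]] cost_bound[OF zX[OF that]] unfolding T_def by linarith
  define \<pi> where "\<pi> = density ?P (\<lambda>z. ennreal (exp (T z)))"
  have ieT: "integrable ?P (\<lambda>z. exp (T z))"
    using Tb by (intro bounded_integrable[OF finP, where K="exp (2 * K + \<kappa>)"]) (auto simp: abs_le_iff)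
  have "emeasure \<pi> (space \<pi>) = (\<integral>\<^sup>+z. ennreal (exp (T z)) \<partial>?P)"
    unfolding \<pi>_def by (subst emeasure_density) (auto intro!: nn_integral_cong)
  also have "\<dots> = ennreal (\<integral>z. exp (T z) \<partial>?P)" using ieT by (intro nn_integral_eq_integral) auto
  finally have fin\<pi>: "finite_measure \<pi>" by (intro finite_measureI) simp
  have \<pi>: "\<pi> \<in> Mplus (X \<times> X)"
    using fin\<pi> sets_restrict_borel_Times[OF compact] sets_pair_measure_cong[OF Mplus_sets[OF \<alpha>] Mplus_sets[OF \<alpha>]]
    by (simp add: Mplus_def \<pi>_def)
  note mg = Mplus_marginals[OF \<pi>]
  have s\<pi>: "sets \<pi> = sets ?P" by (simp add: \<pi>_def)
  \<comment> \<open>The density of both marginals of the plan with respect to \<alpha>; for the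
    second marginal this uses the symmetry of C.\<close>
  define p where "p x = exp (f x) * soft \<alpha> f x" for x
  have p0: "0 \<le> p x" for x unfolding p_def soft_def by (intro mult_nonneg_nonneg integral_nonneg) auto
  have [measurable]: "p \<in> borel_measurable B" unfolding p_def[abs_def] by measurable
  have inner: "(\<integral>\<^sup>+y. ennreal (exp (T (x, y))) \<partial>\<alpha>) = ennreal (p x)" if x: "x \<in> X" for x
  proof -
    have "(\<integral>\<^sup>+y. ennreal (exp (T (x, y))) \<partial>\<alpha>) = (\<integral>\<^sup>+y. ennreal (exp (f x) * exp (f y - C x y / \<epsilon>)) \<partial>\<alpha>)"
      by (simp add: T_def exp_add[symmetric] add_diff_eq)
    also have "\<dots> = ennreal (\<integral>y. exp (f x) * exp (f y - C x y / \<epsilon>) \<partial>\<alpha>)"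
      using soft_integrable[OF \<alpha> adm x] by (intro nn_integral_eq_integral) auto
    finally show ?thesis by (simp add: p_def soft_def)
  qed
  have inner': "(\<integral>\<^sup>+x. ennreal (exp (T (x, y))) \<partial>\<alpha>) = ennreal (p y)" if y: "y \<in> X" for y
  proof -
    have "(\<integral>\<^sup>+x. ennreal (exp (T (x, y))) \<partial>\<alpha>) = (\<integral>\<^sup>+x. ennreal (exp (T (y, x))) \<partial>\<alpha>)"
      using C_sym y by (intro nn_integral_cong) (simp add: T_def sp add.commute)
    then show ?thesis using inner[OF y] by simp
  qed
  have m1: "distr \<pi> B fst = density \<alpha> (\<lambda>x. ennreal (p x))"
  proof (rule measure_eqI)
    fix A assume "A \<in> sets (distr \<pi> B fst)"
    then have A[measurable]: "A \<in> sets B" by simp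
    have "emeasure (distr \<pi> B fst) A = (\<integral>\<^sup>+z. ennreal (exp (T z)) * indicator A (fst z) \<partial>?P)"
      using mg(1) measurable_sets[OF mg(1) A] unfolding s\<pi>
      by (simp add: emeasure_distr) (auto simp: \<pi>_def emeasure_density indicator_def intro!: nn_integral_cong)
    also have "\<dots> = (\<integral>\<^sup>+x. \<integral>\<^sup>+y. ennreal (exp (T (x, y))) * indicator A x \<partial>\<alpha> \<partial>\<alpha>)"
      by (subst nn_integral_fst[symmetric]) auto
    also have "\<dots> = (\<integral>\<^sup>+x. ennreal (p x) * indicator A x \<partial>\<alpha>)"
    proof (rule nn_integral_cong)
      fix x assume "x \<in> space \<alpha>"
      then have x: "x \<in> X" by (simp add: sp)
      then have "(\<lambda>y. ennreal (exp (T (x, y)))) \<in> borel_measurable \<alpha>"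
        using measurable_compose[OF measurable_Pair1'[of x \<alpha> \<alpha>] eTm] by (simp add: sp)
      then show "(\<integral>\<^sup>+y. ennreal (exp (T (x, y))) * indicator A x \<partial>\<alpha>) = ennreal (p x) * indicator A x"
        using inner[OF x] by (simp add: nn_integral_multc)
    qed
    finally show "emeasure (distr \<pi> B fst) A = emeasure (density \<alpha> (\<lambda>x. ennreal (p x))) A"
      by (simp add: emeasure_density)
  qed (simp add: Mplus_sets[OF \<alpha>])
  have m2: "distr \<pi> B snd = density \<alpha> (\<lambda>x. ennreal (p x))"
  proof (rule measure_eqI)
    fix A assume "A \<in> sets (distr \<pi> B snd)"
    then have A[measurable]: "A \<in> sets B" by simp
    have "emeasure (distr \<pi> B snd) A = (\<integral>\<^sup>+z. ennreal (exp (T z)) * indicator A (snd z) \<partial>?P)"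
      using mg(2) measurable_sets[OF mg(2) A] unfolding s\<pi>
      by (simp add: emeasure_distr) (auto simp: \<pi>_def emeasure_density indicator_def intro!: nn_integral_cong)
    also have "\<dots> = (\<integral>\<^sup>+y. \<integral>\<^sup>+x. ennreal (exp (T (x, y))) * indicator A y \<partial>\<alpha> \<partial>\<alpha>)"
      by (subst pair.nn_integral_snd[symmetric]) auto
    also have "\<dots> = (\<integral>\<^sup>+y. ennreal (p y) * indicator A y \<partial>\<alpha>)"
    proof (rule nn_integral_cong)
      fix y assume "y \<in> space \<alpha>"
      then have y: "y \<in> X" by (simp add: sp)
      then have "(\<lambda>x. ennreal (exp (T (x, y)))) \<in> borel_measurable \<alpha>"
        using measurable_compose[OF measurable_Pair2'[of y \<alpha> \<alpha>] eTm] by (simp add: sp)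
      then show "(\<integral>\<^sup>+x. ennreal (exp (T (x, y))) * indicator A y \<partial>\<alpha>) = ennreal (p y) * indicator A y"
        using inner'[OF y] by (simp add: nn_integral_multc)
    qed
    finally show "emeasure (distr \<pi> B snd) A = emeasure (density \<alpha> (\<lambda>x. ennreal (p x))) A"
      by (simp add: emeasure_density)
  qed (simp add: Mplus_sets[OF \<alpha>])
  have pb: "p x \<le> exp K * (exp (K + \<kappa>) * mass \<alpha>)" if x: "x \<in> X" for x
    unfolding p_def using K(1) x soft_le[OF \<alpha> adm x, of K] by (intro mult_mono) (auto simp: abs_le_iff soft_def)
  have ifp: "integrable \<alpha> (\<lambda>x. f x * p x)"
    using K(1) pb p0 by (intro bounded_integrable[OF finite_measure_axioms, where K="K * (exp K * (exp (K + \<kappa>) * mass \<alpha>))"])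
      (auto simp: sp abs_mult intro!: mult_mono intro: order_trans[OF abs_ge_zero])
  have iu: "integrable \<alpha> u" using K by (intro bounded_integrable[OF finite_measure_axioms]) (auto simp: sp)
  have div: "phi_divergence \<phi> (density \<alpha> (\<lambda>x. ennreal (p x))) \<alpha> = ennreal ((\<integral>x. u x \<partial>\<alpha>) - \<epsilon> * (\<integral>x. f x * p x \<partial>\<alpha>))"
    and div0: "0 \<le> (\<integral>x. u x \<partial>\<alpha>) - \<epsilon> * (\<integral>x. f x * p x \<partial>\<alpha>)"
  proof -
    have iw: "integrable \<alpha> (\<lambda>x. u x - \<epsilon> * (f x * p x))" using iu ifp by auto
    \<comment> \<open>Nonnegativity allows the \<open>ennreal\<close> integral of the divergence to
      be read as a real integral.\<close>
    have ae0: "AE x in \<alpha>. 0 \<le> u x - \<epsilon> * (f x * p x)" using opt by eventually_elim (simp add: p_def mult.assoc)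
    have v: "(\<integral>x. u x - \<epsilon> * (f x * p x) \<partial>\<alpha>) = (\<integral>x. u x \<partial>\<alpha>) - \<epsilon> * (\<integral>x. f x * p x \<partial>\<alpha>)" using iu ifp by simp
    have "phi_divergence \<phi> (density \<alpha> (\<lambda>x. ennreal (p x))) \<alpha> = (\<integral>\<^sup>+x. \<phi> (p x) \<partial>\<alpha>)"
      using p0 mg(3) unfolding m1 by (intro phi_divergence_density_self finite_measure_axioms) auto
    also have "\<dots> = (\<integral>\<^sup>+x. ennreal (u x - \<epsilon> * (f x * p x)) \<partial>\<alpha>)"
      using opt by (intro nn_integral_cong_AE, eventually_elim) (simp add: p_def mult.assoc)
    also have "\<dots> = ennreal (\<integral>x. u x - \<epsilon> * (f x * p x) \<partial>\<alpha>)"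
      using iw ae0 by (rule nn_integral_eq_integral)
    finally show "phi_divergence \<phi> (density \<alpha> (\<lambda>x. ennreal (p x))) \<alpha> = ennreal ((\<integral>x. u x \<partial>\<alpha>) - \<epsilon> * (\<integral>x. f x * p x \<partial>\<alpha>))"
      by (simp add: v)
    show "0 \<le> (\<integral>x. u x \<partial>\<alpha>) - \<epsilon> * (\<integral>x. f x * p x \<partial>\<alpha>)" using integral_nonneg_AE[OF ae0] by (simp add: v)
  qed
  have fm: "(\<lambda>z. f (fst z)) \<in> borel_measurable \<pi>" "(\<lambda>z. f (snd z)) \<in> borel_measurable \<pi>"
    "(\<lambda>z. C (fst z) (snd z)) \<in> borel_measurable \<pi>"
    unfolding measurable_cong_sets[OF s\<pi> refl] by measurable
  have spi: "space \<pi> = X \<times> X" using \<pi> by (rule Mplus_space)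
  have i: "integrable \<pi> (\<lambda>z. f (fst z))" "integrable \<pi> (\<lambda>z. f (snd z))" "integrable \<pi> (\<lambda>z. C (fst z) (snd z))"
    using K(1) C_bound fm by (auto intro!: bounded_integrable[OF fin\<pi>] simp: spi)
  have If: "(\<integral>z. f (fst z) \<partial>\<pi>) = (\<integral>x. f x * p x \<partial>\<alpha>)"
  proof -
    have "(\<integral>z. f (fst z) \<partial>\<pi>) = (\<integral>x. f x \<partial>distr \<pi> B fst)" by (rule integral_distr[OF mg(1), symmetric]) simp
    then show ?thesis unfolding m1 using p0 by (simp add: integral_density mult.commute)
  qed
  have Ig: "(\<integral>z. f (snd z) \<partial>\<pi>) = (\<integral>x. f x * p x \<partial>\<alpha>)"
  proof -
    have "(\<integral>z. f (snd z) \<partial>\<pi>) = (\<integral>x. f x \<partial>distr \<pi> B snd)" by (rule integral_distr[OF mg(2), symmetric]) simp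
    then show ?thesis unfolding m2 using p0 by (simp add: integral_density mult.commute)
  qed
  define J where "J = (\<integral>z. C (fst z) (snd z) \<partial>\<pi>)"
  have "(\<integral>z. exp (T z) * T z \<partial>?P) = (\<integral>z. T z \<partial>\<pi>)" unfolding \<pi>_def by (simp add: integral_density)
  also have "\<dots> = 2 * (\<integral>x. f x * p x \<partial>\<alpha>) - J / \<epsilon>" unfolding T_def J_def using i by (simp add: If Ig)
  finally have IT: "(\<integral>z. exp (T z) * T z \<partial>?P) = 2 * (\<integral>x. f x * p x \<partial>\<alpha>) - J / \<epsilon>" .
  have kl: "enn2ereal (phi_divergence kl_entropy \<pi> ?P) =
      ereal (2 * (\<integral>x. f x * p x \<partial>\<alpha>) - J / \<epsilon> - soft_mass f f \<alpha> \<alpha> + (mass \<alpha>)\<^sup>2)"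
  proof -
    have "enn2ereal (phi_divergence kl_entropy \<pi> ?P) = KL \<pi> ?P" by (rule KL_eq_divergence[OF fin\<pi> finP s\<pi>, symmetric])
    also have "\<dots> = ereal ((\<integral>z. exp (T z) * T z \<partial>?P) - (\<integral>z. exp (T z) \<partial>?P) + mass ?P)"
      unfolding \<pi>_def using Tb by (intro KL_density finP) auto
    moreover have "soft_mass f f \<alpha> \<alpha> = (\<integral>z. exp (T z) \<partial>?P)" by (simp add: soft_mass_def T_def)
    ultimately show ?thesis
      by (simp add: IT mass_pair[OF finite_measure_axioms finite_measure_axioms] power2_eq_square)
  qed
  have "OT X C \<epsilon> \<phi> \<alpha> \<alpha> \<le> ereal J + enn2ereal (penalty \<pi> \<alpha> \<alpha>)"
    unfolding OT_eq[OF \<alpha> \<alpha>] J_def by (rule INF_lower[OF \<pi>])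
  also have "\<dots> = ereal J + (ereal ((\<integral>x. u x \<partial>\<alpha>) - \<epsilon> * (\<integral>x. f x * p x \<partial>\<alpha>)) + ereal ((\<integral>x. u x \<partial>\<alpha>) - \<epsilon> * (\<integral>x. f x * p x \<partial>\<alpha>))
      + ereal \<epsilon> * ereal (2 * (\<integral>x. f x * p x \<partial>\<alpha>) - J / \<epsilon> - soft_mass f f \<alpha> \<alpha> + (mass \<alpha>)\<^sup>2))"
    using div0 eps by (simp only: penalty_def m1 m2 div plus_ennreal.rep_eq times_ennreal.rep_eq kl enn2ereal_ennreal less_imp_le)
  also have "\<dots> = ereal (2 * (\<integral>x. u x \<partial>\<alpha>) + \<epsilon> * (mass \<alpha>)\<^sup>2 - \<epsilon> * soft_mass f f \<alpha> \<alpha>)"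
    using eps by (simp add: algebra_simps)
  finally show "OT X C \<epsilon> \<phi> \<alpha> \<alpha> \<le> ereal (2 * (\<integral>x. u x \<partial>\<alpha>) + \<epsilon> * (mass \<alpha>)\<^sup>2 - \<epsilon> * soft_mass f f \<alpha> \<alpha>)" .
  show "ereal (2 * (\<integral>x. u x \<partial>\<alpha>) + \<epsilon> * (mass \<alpha>)\<^sup>2 - \<epsilon> * soft_mass f f \<alpha> \<alpha>) \<le> OT X C \<epsilon> \<phi> \<alpha> \<alpha>"
    using OT_ge[OF \<alpha> \<alpha> fu fu] by (simp add: power2_eq_square)
qed

text \<open>The Sinkhorn equation is demanded only for positive mass: for the zero measure
  \<open>soft\<close> vanishes and its logarithm is a default value.\<close>

definition potential :: "'a measure \<Rightarrow> ('a \<Rightarrow> real) \<Rightarrow> ('a \<Rightarrow> real) \<Rightarrow> bool" where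
  "potential \<alpha> f u \<longleftrightarrow> dual_pair f u \<and>
     OT X C \<epsilon> \<phi> \<alpha> \<alpha> = ereal (2 * (\<integral>x. u x \<partial>\<alpha>) + \<epsilon> * (mass \<alpha>)\<^sup>2 - \<epsilon> * soft_mass f f \<alpha> \<alpha>) \<and>
     (0 < mass \<alpha> \<longrightarrow> (\<forall>x\<in>X. f x = sinkhorn_map \<alpha> f x))"

lemma potential_exists:
  assumes \<alpha>: "\<alpha> \<in> Mplus X"
  shows "\<exists>f u. potential \<alpha> f u"
proof (cases "0 < mass \<alpha>")
  case False
  interpret finite_measure \<alpha> using \<alpha> by (rule Mplus_finite)
  have "mass \<alpha> = 0" using False zero_less_measure_iff by metis
  then have "AE x in \<alpha>. False" using emeasure_eq_measure[of "space \<alpha>"]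
    by (intro AE_I[of _ _ "space \<alpha>"]) auto
  then have "AE x in \<alpha>. \<phi> (exp 0 * soft \<alpha> (\<lambda>_. 0) x) = ennreal (0 - \<epsilon> * 0 * (exp 0 * soft \<alpha> (\<lambda>_. 0) x))
      \<and> 0 \<le> 0 - \<epsilon> * 0 * (exp 0 * soft \<alpha> (\<lambda>_. 0) x)" by eventually_elim simp
  from OT_diag[OF \<alpha> dual_pair_0 this] show ?thesis using False dual_pair_0 unfolding potential_def by blast
next
  case m: True
  obtain f where f: "admissible f" and fx: "\<And>x. x \<in> X \<Longrightarrow> sinkhorn_map \<alpha> f x = f x"
    using sinkhorn_fixpoint[OF \<alpha> m] by blast
  have fm[measurable]: "f \<in> borel_measurable B" using f by (simp add: admissible_def)
  obtain K where K: "\<And>x. x \<in> X \<Longrightarrow> \<bar>f x\<bar> \<le> K" using f by (auto simp: admissible_def)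
  have [measurable]: "soft \<alpha> f \<in> borel_measurable B" by (rule soft_measurable[OF \<alpha>]) measurable
  define p where "p x = exp (f x) * soft \<alpha> f x" for x
  \<comment> \<open>The constant for which the minorant q \<mapsto> u x - \<epsilon> f x q touches
    \<phi> at q = p x.\<close>
  define u where "u x = phir (p x) + \<epsilon> * f x * p x" for x
  have [measurable]: "p \<in> borel_measurable B" unfolding p_def[abs_def] by measurable
  have um[measurable]: "u \<in> borel_measurable B" unfolding u_def[abs_def] phir_def by measurable
  have pp: "p x = exp (log_scale \<epsilon> (ln (soft \<alpha> f x)) + ln (soft \<alpha> f x))" "log_scale \<epsilon> (ln (soft \<alpha> f x)) = f x" if x: "x \<in> X" for x
    using fx[OF x] soft_pos[OF \<alpha> m f x] by (simp_all add: p_def sinkhorn_map_def exp_add)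
  have feas: "ennreal (u x - \<epsilon> * f x * q) \<le> \<phi> q" if x: "x \<in> X" and q: "0 \<le> q" for x q
    using phi_prox(2)[OF eps q, of "ln (soft \<alpha> f x)"] unfolding u_def pp(1)[OF x] pp(2)[OF x] .
  have fin: "\<phi> (p x) \<noteq> \<infinity>" if x: "x \<in> X" for x
    using phi_prox(1)[OF eps order_refl, of "ln (soft \<alpha> f x)"] unfolding pp(1)[OF x] .
  have pb: "0 \<le> p x" "p x \<le> exp K * (exp (K + \<kappa>) * mass \<alpha>)" if x: "x \<in> X" for x
    unfolding p_def using K x soft_le[OF \<alpha> f x, of K] soft_pos[OF \<alpha> m f x] by (auto simp: abs_le_iff intro!: mult_mono)
  have "\<bar>u x\<bar> \<le> \<epsilon> * K + \<epsilon> * (K * (exp K * (exp (K + \<kappa>) * mass \<alpha>)))" if x: "x \<in> X" for x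
  proof -
    \<comment> \<open>Feasibility at q = 1, where \<phi> vanishes, bounds u from above without any
      bound on \<phi> (p x).\<close>
    have "ennreal (u x - \<epsilon> * f x * 1) \<le> 0" using feas[OF x, of 1] by simp
    then have "u x \<le> \<epsilon> * f x" by (simp add: ennreal_eq_0_iff)
    also have "\<dots> \<le> \<epsilon> * K" using K[OF x] eps by (intro mult_left_mono) auto
    finally have 1: "u x \<le> \<epsilon> * K" .
    have "\<bar>\<epsilon> * (f x * p x)\<bar> = \<epsilon> * (\<bar>f x\<bar> * p x)" using eps pb(1)[OF x] by (simp add: abs_mult)
    also have "\<dots> \<le> \<epsilon> * (K * (exp K * (exp (K + \<kappa>) * mass \<alpha>)))"
      using eps K[OF x] pb[OF x] by (intro mult_left_mono mult_mono) auto
    finally have "- (\<epsilon> * (K * (exp K * (exp (K + \<kappa>) * mass \<alpha>)))) \<le> u x"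
      using phir_nonneg[of "p x"] unfolding u_def mult.assoc by linarith
    moreover have "0 \<le> K" using K[OF x] by linarith
    then have "0 \<le> \<epsilon> * K" "0 \<le> \<epsilon> * (K * (exp K * (exp (K + \<kappa>) * mass \<alpha>)))" using eps by auto
    ultimately show ?thesis using 1 by linarith
  qed
  then have "\<forall>x\<in>X. \<bar>f x\<bar> \<le> K + (\<epsilon> * K + \<epsilon> * (K * (exp K * (exp (K + \<kappa>) * mass \<alpha>)))) \<and>
      \<bar>u x\<bar> \<le> K + (\<epsilon> * K + \<epsilon> * (K * (exp K * (exp (K + \<kappa>) * mass \<alpha>))))"
    using K by (smt (verit))
  then have dp: "dual_pair f u" unfolding dual_pair_def using feas fm um by blast
  have "AE x in \<alpha>. \<phi> (exp (f x) * soft \<alpha> f x) = ennreal (u x - \<epsilon> * f x * (exp (f x) * soft \<alpha> f x))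
      \<and> 0 \<le> u x - \<epsilon> * f x * (exp (f x) * soft \<alpha> f x)"
  proof (rule AE_I2)
    fix x assume "x \<in> space \<alpha>"
    then have x: "x \<in> X" using Mplus_space[OF \<alpha>] by simp
    have "u x - \<epsilon> * f x * p x = phir (p x)" by (simp add: u_def)
    then show "\<phi> (exp (f x) * soft \<alpha> f x) = ennreal (u x - \<epsilon> * f x * (exp (f x) * soft \<alpha> f x))
        \<and> 0 \<le> u x - \<epsilon> * f x * (exp (f x) * soft \<alpha> f x)"
      unfolding p_def[symmetric] using phi_eq[OF fin[OF x]] by simp
  qed
  from OT_diag[OF \<alpha> dp this] show ?thesis using dp fx unfolding potential_def by metis
qed

end

subsection \<open>Finite measures are determined by continuous functions\<close>

text \<open>Indicators of closed sets are limits of the continuous functions max 0 (1 - n infdist x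
  K), and closed sets form a generator of the Borel sets that is stable under intersection.\<close>

lemma Mplus_eqI_continuous:
  fixes X :: "'a::metric_space set"
  assumes X: "closed X" and \<mu>: "\<mu> \<in> Mplus X" and \<nu>: "\<nu> \<in> Mplus X"
    and eq: "\<And>F. continuous_on X F \<Longrightarrow> (\<integral>x. F x \<partial>\<mu>) = (\<integral>x. (F x :: real) \<partial>\<nu>)"
  shows "\<mu> = \<nu>"
proof -
  have K: "emeasure \<mu> (K \<inter> X) = emeasure \<nu> (K \<inter> X)" if "closed K" for K
  \<comment> \<open>The distance to the empty set has the default value 0, so the approximation
    would fail there.\<close>
  proof (cases "K = {}")
    case False
    define F where "F n x = max 0 (1 - real n * infdist x K)" for n x
    have c: "continuous_on X (F n)" for n unfolding F_def by (intro continuous_intros)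
    have lim: "(\<lambda>n. F n x) \<longlonglongrightarrow> indicator (K \<inter> X) x" if x: "x \<in> X" for x
    proof (cases "x \<in> K")
      case True
      then show ?thesis using x by (simp add: F_def)
    next
      case 2: False
      then have "0 < infdist x K"
        using \<open>closed K\<close> False in_closed_iff_infdist_zero[of K x] infdist_nonneg[of x K] by (auto simp: less_le)
      then obtain N where N: "1 < real N * infdist x K" using reals_Archimedean3 by blast
      have "\<forall>\<^sub>F n in sequentially. F n x = 0"
        using eventually_ge_at_top[of N]
      proof eventually_elim
        case (elim n)
        then have "real N * infdist x K \<le> real n * infdist x K" by (intro mult_right_mono) (auto simp: infdist_nonneg)
        then show ?case using N by (simp add: F_def)
      qed
      then show ?thesis using 2 by (simp add: tendsto_eventually)
    qed
    have *: "(\<lambda>n. \<integral>x. F n x \<partial>M) \<longlonglongrightarrow> measure M (K \<inter> X)" and KM: "K \<inter> X \<in> sets M" if M: "M \<in> Mplus X" for M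
    proof -
      interpret finite_measure M using M by (rule Mplus_finite)
      show KX: "K \<inter> X \<in> sets M" using \<open>closed K\<close> X Mplus_sets[OF M] by (auto simp: sets_restrict_space)
      have "(\<lambda>n. \<integral>x. F n x \<partial>M) \<longlonglongrightarrow> (\<integral>x. indicator (K \<inter> X) x \<partial>M)"
      proof (rule integral_dominated_convergence[where w="\<lambda>_. 1"])
        show "F n \<in> borel_measurable M" for n
          using borel_measurable_continuous_on_restrict[OF c] Mplus_sets[OF M] by (simp cong: measurable_cong_sets)
        show "AE x in M. (\<lambda>n. F n x) \<longlonglongrightarrow> indicator (K \<inter> X) x" using lim Mplus_space[OF M] by auto
        show "AE x in M. norm (F n x) \<le> 1" for n by (auto simp: F_def infdist_nonneg)
      qed (use KX in auto)
      then show "(\<lambda>n. \<integral>x. F n x \<partial>M) \<longlonglongrightarrow> measure M (K \<inter> X)"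
        using sets.sets_into_space[OF KX] by (simp add: Int_absorb2)
    qed
    have "measure \<mu> (K \<inter> X) = measure \<nu> (K \<inter> X)"
      using *[OF \<mu>] *[OF \<nu>] eq[OF c] by (metis (no_types, lifting) LIMSEQ_unique ext)
    then show ?thesis
      using finite_measure.emeasure_eq_measure[OF Mplus_finite] \<mu> \<nu> by metis
  qed simp
  \<comment> \<open>Extension to the whole type, where the closed sets generate the Borel
    sets.\<close>
  define E where "E M = distr M borel (\<lambda>x. x)" for M :: "'a measure"
  have id: "(\<lambda>x. x) \<in> borel_measurable M" if "M \<in> Mplus X" for M
    using Mplus_sets[OF that] by (simp add: measurable_restrict_space1 cong: measurable_cong_sets)
  have E: "emeasure (E M) A = emeasure M (A \<inter> X)" if "M \<in> Mplus X" "A \<in> sets borel" for M A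
    unfolding E_def using id[OF that(1)] that(2) by (simp add: emeasure_distr Mplus_space[OF that(1)])
  have "E \<mu> = E \<nu>"
  proof (rule measure_eqI_generator_eq[where E="Collect closed" and \<Omega>=UNIV and A="\<lambda>_. UNIV"])
    show "Int_stable (Collect (closed :: 'a set \<Rightarrow> bool))" by (auto simp: Int_stable_def)
    show "sets (E \<mu>) = sigma_sets UNIV (Collect closed)" "sets (E \<nu>) = sigma_sets UNIV (Collect closed)"
      by (auto simp: E_def borel_eq_closed)
    show "emeasure (E \<mu>) A = emeasure (E \<nu>) A" if "A \<in> Collect closed" for A
      using that K[of A] E[OF \<mu>, of A] E[OF \<nu>, of A] by simp
    show "emeasure (E \<mu>) UNIV \<noteq> \<infinity>"
      using E[OF \<mu>, of UNIV] finite_measure.emeasure_finite[OF Mplus_finite[OF \<mu>]] by simp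
  qed auto
  show ?thesis
  proof (rule measure_eqI)
    show "sets \<mu> = sets \<nu>" using Mplus_sets[OF \<mu>] Mplus_sets[OF \<nu>] by simp
    fix A assume "A \<in> sets \<mu>"
    then obtain A' where A: "A = A' \<inter> X" "A' \<in> sets borel" using Mplus_sets[OF \<mu>] by (auto simp: sets_restrict_space)
    then show "emeasure \<mu> A = emeasure \<nu> A" using E[OF \<mu> A(2)] E[OF \<nu> A(2)] \<open>E \<mu> = E \<nu>\<close> by simp
  qed
qed

subsection \<open>The energy of the kernel\<close>

locale sinkhorn = symmetric_ot_problem +
  assumes pos: "positive_kernel X (\<lambda>x y. exp (- C x y / \<epsilon>))"
    and univ: "universal_kernel X (\<lambda>x y. exp (- C x y / \<epsilon>))"
begin

definition kform :: "'a measure \<Rightarrow> 'a measure \<Rightarrow> real" where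
  "kform \<mu> \<nu> = (\<integral>z. exp (- C (fst z) (snd z) / \<epsilon>) \<partial>(\<mu> \<Otimes>\<^sub>M \<nu>))"

lemma kernel_bound:
  assumes "x \<in> X" "y \<in> X"
  shows "\<bar>exp (- C x y / \<epsilon>)\<bar> \<le> exp \<kappa>"
proof -
  have "- (C x y / \<epsilon>) \<le> \<kappa>" using cost_bound[OF assms] by linarith
  then show ?thesis by simp
qed

lemma kernel_integrable:
  assumes "\<mu> \<in> Mplus X" "\<nu> \<in> Mplus X"
  shows "integrable (\<mu> \<Otimes>\<^sub>M \<nu>) (\<lambda>z. exp (- C (fst z) (snd z) / \<epsilon>))"
proof (rule bounded_integrable[OF finite_measure_pair])
  note Mplus_sets[OF assms(1), measurable_cong] Mplus_sets[OF assms(2), measurable_cong]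
  show "(\<lambda>z. exp (- C (fst z) (snd z) / \<epsilon>)) \<in> borel_measurable (\<mu> \<Otimes>\<^sub>M \<nu>)" by measurable
  fix z assume "z \<in> space (\<mu> \<Otimes>\<^sub>M \<nu>)"
  then have "fst z \<in> X" "snd z \<in> X" using assms by (auto simp: space_pair_measure Mplus_space)
  then show "\<bar>exp (- C (fst z) (snd z) / \<epsilon>)\<bar> \<le> exp \<kappa>" by (rule kernel_bound)
qed (use assms in \<open>auto dest: Mplus_finite\<close>)

lemma kform_sym:
  assumes "\<mu> \<in> Mplus X" "\<nu> \<in> Mplus X"
  shows "kform \<mu> \<nu> = kform \<nu> \<mu>"
proof -
  interpret m: finite_measure \<mu> using assms(1) by (rule Mplus_finite)
  interpret n: finite_measure \<nu> using assms(2) by (rule Mplus_finite)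
  interpret pair_sigma_finite \<mu> \<nu> ..
  have "kform \<mu> \<nu> = (\<integral>z. exp (- C (snd z) (fst z) / \<epsilon>) \<partial>(\<nu> \<Otimes>\<^sub>M \<mu>))"
    using integral_product_swap[of "\<lambda>z. exp (- C (fst z) (snd z) / \<epsilon>)"] kernel_integrable[OF assms]
    by (simp add: kform_def case_prod_unfold)
  also have "\<dots> = kform \<nu> \<mu>" unfolding kform_def
    using assms C_sym by (intro Bochner_Integration.integral_cong) (auto simp: space_pair_measure Mplus_space)
  finally show ?thesis .
qed

lemma kform_pos:
  assumes "\<mu> \<in> Mplus X" "\<nu> \<in> Mplus X"
  shows "0 \<le> kform \<mu> \<mu> + kform \<nu> \<nu> - 2 * kform \<mu> \<nu>"
proof -
  have "0 \<le> kform \<mu> \<mu> - kform \<mu> \<nu> - kform \<nu> \<mu> + kform \<nu> \<nu>"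
    using pos assms unfolding positive_kernel_def kform_def case_prod_unfold by blast
  then show ?thesis using kform_sym[OF assms] by linarith
qed

lemma kform_mix_left:
  assumes "\<mu> \<in> Mplus X" "\<mu>' \<in> Mplus X" "\<nu> \<in> Mplus X" and t: "0 \<le> t" "t \<le> 1"
  shows "kform (mix t \<mu> \<mu>') \<nu> = t * kform \<mu> \<nu> + (1 - t) * kform \<mu>' \<nu>"
proof -
  have s: "sets \<mu> = sets \<mu>'" using assms by (simp add: Mplus_sets)
  have s': "sets (\<mu> \<Otimes>\<^sub>M \<nu>) = sets (\<mu>' \<Otimes>\<^sub>M \<nu>)" using s by (intro sets_pair_measure_cong) auto
  have "mix t \<mu> \<mu>' \<Otimes>\<^sub>M \<nu> = mix t (\<mu> \<Otimes>\<^sub>M \<nu>) (\<mu>' \<Otimes>\<^sub>M \<nu>)"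
    using assms by (intro pair_mix_left s) (auto dest: Mplus_finite)
  then show ?thesis unfolding kform_def
    using integral_mix(2)[OF s' t kernel_integrable kernel_integrable] assms by simp
qed

lemma kform_mix_right:
  assumes "\<mu> \<in> Mplus X" "\<nu> \<in> Mplus X" "\<nu>' \<in> Mplus X" and t: "0 \<le> t" "t \<le> 1"
  shows "kform \<mu> (mix t \<nu> \<nu>') = t * kform \<mu> \<nu> + (1 - t) * kform \<mu> \<nu>'"
  using assms kform_mix_left[OF assms(2,3,1) t] by (simp add: kform_sym mix_Mplus)

text \<open>The gap is t (1 - t) times the energy of \<mu> - \<mu>', which is nonnegative by
  positivity of the kernel.\<close>

lemma kform_mix_convex:
  assumes "\<mu> \<in> Mplus X" "\<mu>' \<in> Mplus X" and t: "0 \<le> t" "t \<le> 1"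
  shows "kform (mix t \<mu> \<mu>') (mix t \<mu> \<mu>') \<le> t * kform \<mu> \<mu> + (1 - t) * kform \<mu>' \<mu>'"
proof -
  have "kform (mix t \<mu> \<mu>') (mix t \<mu> \<mu>') =
      t * (t * kform \<mu> \<mu> + (1 - t) * kform \<mu> \<mu>') + (1 - t) * (t * kform \<mu> \<mu>' + (1 - t) * kform \<mu>' \<mu>')"
    using assms kform_sym[OF assms(1,2)] by (simp add: kform_mix_left kform_mix_right mix_Mplus)
  also have "\<dots> = t * kform \<mu> \<mu> + (1 - t) * kform \<mu>' \<mu>' - t * (1 - t) * (kform \<mu> \<mu> + kform \<mu>' \<mu>' - 2 * kform \<mu> \<mu>')"
    by (simp add: algebra_simps)
  also have "\<dots> \<le> t * kform \<mu> \<mu> + (1 - t) * kform \<mu>' \<mu>'"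
    using t kform_pos[OF assms(1,2)] by simp
  finally show ?thesis .
qed

section \<open>Kernel mean embeddings and universality\<close>

definition dirac :: "'a \<Rightarrow> 'a measure" where
  "dirac x = distr (count_space {()}) B (\<lambda>_. x)"

lemma dirac_Mplus: "x \<in> X \<Longrightarrow> dirac x \<in> Mplus X"
  by (auto simp: Mplus_def dirac_def space_restrict_space intro!: finite_measure.finite_measure_distr finite_measure_count_space)

lemma null_Mplus: "null_measure B \<in> Mplus X"
  by (auto simp: Mplus_def intro!: finite_measureI)

lemma kform_null:
  assumes "\<mu> \<in> Mplus X"
  shows "kform \<mu> (null_measure B) = 0"
proof -
  have "mass (\<mu> \<Otimes>\<^sub>M null_measure B) = 0"
    using assms null_Mplus by (subst mass_pair) (auto dest: Mplus_finite)
  then have "emeasure (\<mu> \<Otimes>\<^sub>M null_measure B) (space (\<mu> \<Otimes>\<^sub>M null_measure B)) = 0"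
    using finite_measure.emeasure_eq_measure[OF finite_measure_pair[OF Mplus_finite[OF assms] Mplus_finite[OF null_Mplus]]] by simp
  then have "AE z in \<mu> \<Otimes>\<^sub>M null_measure B. exp (- C (fst z) (snd z) / \<epsilon>) = 0"
    by (intro AE_I[OF _ _ sets.top]) auto
  then show ?thesis unfolding kform_def by (rule integral_eq_zero_AE)
qed

lemma kform_dirac:
  assumes \<mu>: "\<mu> \<in> Mplus X" and x: "x \<in> X"
  shows "kform \<mu> (dirac x) = (\<integral>z. exp (- C z x / \<epsilon>) \<partial>\<mu>)"
proof -
  interpret m: finite_measure \<mu> using \<mu> by (rule Mplus_finite)
  interpret n: finite_measure "dirac x" using dirac_Mplus[OF x] by (rule Mplus_finite)
  interpret pair_sigma_finite \<mu> "dirac x" ..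
  have "kform \<mu> (dirac x) = (\<integral>z. \<integral>y. exp (- C z y / \<epsilon>) \<partial>dirac x \<partial>\<mu>)"
    unfolding kform_def using integral_fst'[OF kernel_integrable[OF \<mu> dirac_Mplus[OF x]]] by simp
  also have "\<dots> = (\<integral>z. exp (- C z x / \<epsilon>) \<partial>\<mu>)"
  proof (rule Bochner_Integration.integral_cong[OF refl])
    fix z assume "z \<in> space \<mu>"
    then have "z \<in> X" using Mplus_space[OF \<mu>] by simp
    note C_section[OF this, measurable]
    show "(\<integral>y. exp (- C z y / \<epsilon>) \<partial>dirac x) = exp (- C z x / \<epsilon>)"
      unfolding dirac_def using x by (subst integral_distr) (auto simp: space_restrict_space lebesgue_integral_count_space_finite)
  qed
  finally show ?thesis .
qed

lemma kernel_section_integrable: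
  assumes \<mu>: "\<mu> \<in> Mplus X" and x: "x \<in> X"
  shows "integrable \<mu> (\<lambda>z. exp (- C z x / \<epsilon>))"
proof (rule bounded_integrable[OF Mplus_finite[OF \<mu>]])
  note Mplus_sets[OF \<mu>, measurable_cong] C_section[OF x, measurable]
  have "(\<lambda>z. exp (- C x z / \<epsilon>)) \<in> borel_measurable \<mu>" by measurable
  then show "(\<lambda>z. exp (- C z x / \<epsilon>)) \<in> borel_measurable \<mu>"
    using C_sym x Mplus_space[OF \<mu>] by (subst measurable_cong[of _ _ "\<lambda>z. exp (- C x z / \<epsilon>)"]) auto
  fix z assume "z \<in> space \<mu>"
  then show "\<bar>exp (- C z x / \<epsilon>)\<bar> \<le> exp \<kappa>" using x Mplus_space[OF \<mu>] by (intro kernel_bound) auto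
qed

text \<open>
  Testing positivity on \<open>t (\<mu> - \<nu>) + (1 - t) \<delta>\<^sub>x\<close> with \<open>t \<rightarrow> 1\<close> shows that the kernel mean
  embeddings of \<open>\<mu>\<close> and \<open>\<nu>\<close> are ordered, hence equal.
\<close>

lemma zero_energy_embedding:
  assumes \<mu>: "\<mu> \<in> Mplus X" and \<nu>: "\<nu> \<in> Mplus X" and zero: "kform \<mu> \<mu> + kform \<nu> \<nu> - 2 * kform \<mu> \<nu> = 0" and x: "x \<in> X"
  shows "kform \<nu> (dirac x) \<le> kform \<mu> (dirac x)"
proof -
  let ?d = "dirac x" and ?n = "null_measure B"
  note M = \<mu> \<nu> dirac_Mplus[OF x] null_Mplus
  define a where "a = kform \<mu> ?d - kform \<nu> ?d"
  have "0 \<le> (1 - t) * kform ?d ?d + 2 * t * a" if t: "0 < t" "t < 1" for t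
  proof -
    have k0: "kform \<mu> ?n = 0" "kform \<nu> ?n = 0" "kform ?d ?n = 0" "kform ?n ?n = 0"
      "kform ?n \<mu> = 0" "kform ?n \<nu> = 0" "kform ?n ?d = 0"
      using M by (auto simp: kform_null kform_sym[OF null_Mplus])
    \<comment> \<open>Pairing \<nu> with the zero measure gives it the same weight t as \<mu>. The
      t^2 term is the vanishing energy, and the rest has the factor 1 - t, which is divided out
      before t tends to 1.\<close>
    have "0 \<le> kform (mix t \<mu> ?d) (mix t \<mu> ?d) + kform (mix t \<nu> ?n) (mix t \<nu> ?n) - 2 * kform (mix t \<mu> ?d) (mix t \<nu> ?n)"
      using M by (intro kform_pos mix_Mplus)
    also have "\<dots> = t * t * (kform \<mu> \<mu> + kform \<nu> \<nu> - 2 * kform \<mu> \<nu>) + (1 - t) * ((1 - t) * kform ?d ?d + 2 * t * a)"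
      using M t kform_sym[OF M(1) M(3)] kform_sym[OF M(2) M(3)]
      by (simp add: kform_mix_left kform_mix_right mix_Mplus k0 a_def algebra_simps)
    finally show ?thesis using zero t by (simp add: zero_le_mult_iff)
  qed
  then have "\<forall>\<^sub>F t in at_left 1. 0 \<le> (1 - t) * kform ?d ?d + 2 * t * a"
    by (intro eventually_mono[OF eventually_at_left_real[of 0 1]]) auto
  moreover have "((\<lambda>t. (1 - t) * kform ?d ?d + 2 * t * a) \<longlongrightarrow> (1 - 1) * kform ?d ?d + 2 * 1 * a) (at_left 1)"
    by (intro tendsto_intros)
  ultimately have "0 \<le> (1 - 1) * kform ?d ?d + 2 * 1 * a" by (intro tendsto_lowerbound) auto
  then show ?thesis by (simp add: a_def)
qed

text \<open>The embedding inequality, used with \<mu> and \<nu> exchanged, becomes an equality: the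
  measures integrate every kernel section alike, and by universality every continuous
  function.\<close>

lemma zero_energy_eq:
  assumes \<mu>: "\<mu> \<in> Mplus X" and \<nu>: "\<nu> \<in> Mplus X" and zero: "kform \<mu> \<mu> + kform \<nu> \<nu> - 2 * kform \<mu> \<nu> = 0"
  shows "\<mu> = \<nu>"
proof (rule Mplus_eqI_continuous[OF compact_imp_closed[OF compact] \<mu> \<nu>])
  fix F :: "'a \<Rightarrow> real" assume F: "continuous_on X F"
  interpret m: finite_measure \<mu> using \<mu> by (rule Mplus_finite)
  interpret n: finite_measure \<nu> using \<nu> by (rule Mplus_finite)
  have emb: "(\<integral>z. exp (- C z x / \<epsilon>) \<partial>\<mu>) = (\<integral>z. exp (- C z x / \<epsilon>) \<partial>\<nu>)" if x: "x \<in> X" for x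
    using zero_energy_embedding[OF \<mu> \<nu> zero x] zero_energy_embedding[OF \<nu> \<mu> _ x] zero kform_sym[OF \<mu> \<nu>]
    by (simp add: kform_dirac[OF \<mu> x] kform_dirac[OF \<nu> x])
  have Fm: "F \<in> borel_measurable M" if "M \<in> Mplus X" for M
    using borel_measurable_continuous_on_restrict[OF F] Mplus_sets[OF that] by (simp cong: measurable_cong_sets)
  have "bounded (F ` X)" using compact F by (intro compact_imp_bounded compact_continuous_image)
  then obtain b where b: "\<And>x. x \<in> X \<Longrightarrow> \<bar>F x\<bar> \<le> b" by (auto simp: bounded_iff)
  have iF: "integrable M F" if "M \<in> Mplus X" for M
    using b Mplus_space[OF that] by (intro bounded_integrable[OF Mplus_finite[OF that] Fm[OF that]]) auto
  have "\<bar>(\<integral>x. F x \<partial>\<mu>) - (\<integral>x. F x \<partial>\<nu>)\<bar> \<le> 0 + e" if e: "0 < e" for e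
  proof -
    \<comment> \<open>Chosen so that the approximation errors, d times the two masses, add up to at
      most e; the 1 keeps the denominator positive.\<close>
    define d where "d = e / (mass \<mu> + mass \<nu> + 1)"
    have mm: "0 < mass \<mu> + mass \<nu> + 1" using measure_nonneg[of \<mu>] measure_nonneg[of \<nu>] by (smt (verit))
    then have d: "0 < d" using e by (simp add: d_def)
    obtain T c where T: "finite T" "T \<subseteq> X" and Tc: "\<And>x. x \<in> X \<Longrightarrow> \<bar>F x - (\<Sum>y\<in>T. c y * exp (- C x y / \<epsilon>))\<bar> < d"
      using univ F d unfolding universal_kernel_def by metis
    define G where "G x = (\<Sum>y\<in>T. c y * exp (- C x y / \<epsilon>))" for x
    have TG: "\<bar>F x - G x\<bar> \<le> d" if "x \<in> X" for x using Tc[OF that] unfolding G_def by (rule less_imp_le)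
    have ik: "integrable M (\<lambda>x. c y * exp (- C x y / \<epsilon>))" if "M \<in> Mplus X" "y \<in> T" for M y
      using kernel_section_integrable[OF that(1), of y] that(2) T(2) by (intro integrable_mult_right) auto
    have iG: "integrable M G" if "M \<in> Mplus X" for M
      unfolding G_def[abs_def] using that by (intro Bochner_Integration.integrable_sum ik)
    have IG: "(\<integral>x. G x \<partial>M) = (\<Sum>y\<in>T. c y * (\<integral>x. exp (- C x y / \<epsilon>) \<partial>M))" if "M \<in> Mplus X" for M
    proof -
      have "(\<integral>x. G x \<partial>M) = (\<Sum>y\<in>T. \<integral>x. c y * exp (- C x y / \<epsilon>) \<partial>M)"
        unfolding G_def by (rule Bochner_Integration.integral_sum) (rule ik[OF that])
      then show ?thesis by simp
    qed
    have dist: "\<bar>(\<integral>x. F x \<partial>M) - (\<integral>x. G x \<partial>M)\<bar> \<le> d * mass M" if M: "M \<in> Mplus X" for M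
    proof -
      interpret finite_measure M using M by (rule Mplus_finite)
      have "\<bar>(\<integral>x. F x \<partial>M) - (\<integral>x. G x \<partial>M)\<bar> = \<bar>\<integral>x. F x - G x \<partial>M\<bar>" using iF[OF M] iG[OF M] by simp
      also have "\<dots> \<le> (\<integral>x. \<bar>F x - G x\<bar> \<partial>M)" by (rule integral_abs_bound)
      also have "\<dots> \<le> (\<integral>x. d \<partial>M)"
        using iF[OF M] iG[OF M] TG Mplus_space[OF M] by (intro integral_mono) auto
      finally show ?thesis by (simp add: mult.commute)
    qed
    have "(\<integral>x. G x \<partial>\<mu>) = (\<integral>x. G x \<partial>\<nu>)" using emb T unfolding IG[OF \<mu>] IG[OF \<nu>] by (intro sum.cong) auto
    then have "\<bar>(\<integral>x. F x \<partial>\<mu>) - (\<integral>x. F x \<partial>\<nu>)\<bar> \<le> d * mass \<mu> + d * mass \<nu>" using dist[OF \<mu>] dist[OF \<nu>] by linarith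
    also have "\<dots> \<le> d * (mass \<mu> + mass \<nu> + 1)" using d by (simp add: distrib_left)
    also have "\<dots> = e" using mm by (simp add: d_def)
    finally show ?thesis by simp
  qed
  then have "\<bar>(\<integral>x. F x \<partial>\<mu>) - (\<integral>x. F x \<partial>\<nu>)\<bar> \<le> 0" by (rule field_le_epsilon)
  then show "(\<integral>x. F x \<partial>\<mu>) = (\<integral>x. F x \<partial>\<nu>)" by simp
qed

subsection \<open>Positivity and definiteness\<close>

definition weigh :: "('a \<Rightarrow> real) \<Rightarrow> 'a measure \<Rightarrow> 'a measure" where
  "weigh f \<alpha> = density \<alpha> (\<lambda>x. ennreal (exp (f x)))"

lemma weigh_Mplus:
  assumes \<alpha>: "\<alpha> \<in> Mplus X" and f: "admissible f"
  shows "weigh f \<alpha> \<in> Mplus X"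
proof -
  note Mplus_sets[OF \<alpha>, measurable_cong]
  obtain K where K: "\<And>x. x \<in> X \<Longrightarrow> \<bar>f x\<bar> \<le> K" and [measurable]: "f \<in> borel_measurable B" using f by (auto simp: admissible_def)
  have i: "integrable \<alpha> (\<lambda>x. exp (f x))"
    using K Mplus_space[OF \<alpha>] by (intro bounded_integrable[OF Mplus_finite[OF \<alpha>], where K="exp K"]) (auto simp: abs_le_iff)
  have "emeasure (weigh f \<alpha>) (space (weigh f \<alpha>)) = (\<integral>\<^sup>+x. ennreal (exp (f x)) \<partial>\<alpha>)"
    unfolding weigh_def by (subst emeasure_density) (auto intro!: nn_integral_cong)
  also have "\<dots> = ennreal (\<integral>x. exp (f x) \<partial>\<alpha>)" using i by (intro nn_integral_eq_integral) auto
  finally have "finite_measure (weigh f \<alpha>)" by (intro finite_measureI) simp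
  then show ?thesis using Mplus_sets[OF \<alpha>] by (simp add: Mplus_def weigh_def)
qed

text \<open>In the variables exp f \<alpha> and exp g \<beta> the exponential term of the dual
  becomes bilinear, so positivity of the kernel applies to it.\<close>

lemma soft_mass_eq_kform:
  assumes \<alpha>: "\<alpha> \<in> Mplus X" and \<beta>: "\<beta> \<in> Mplus X" and f: "admissible f" and g: "admissible g"
  shows "soft_mass f g \<alpha> \<beta> = kform (weigh f \<alpha>) (weigh g \<beta>)"
proof -
  note Mplus_sets[OF \<alpha>, measurable_cong] Mplus_sets[OF \<beta>, measurable_cong]
  have [measurable]: "f \<in> borel_measurable B" "g \<in> borel_measurable B" using f g by (auto simp: admissible_def)
  interpret b: finite_measure \<beta> using \<beta> by (rule Mplus_finite)
  interpret w: finite_measure "weigh g \<beta>" using weigh_Mplus[OF \<beta> g] by (rule Mplus_finite)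
  have "weigh f \<alpha> \<Otimes>\<^sub>M weigh g \<beta> = density (\<alpha> \<Otimes>\<^sub>M \<beta>) (\<lambda>(x, y). ennreal (exp (f x)) * ennreal (exp (g y)))"
    using b.sigma_finite_measure_axioms w.sigma_finite_measure_axioms unfolding weigh_def by (intro pair_measure_density) auto
  also have "(\<lambda>(x, y). ennreal (exp (f x)) * ennreal (exp (g y))) = (\<lambda>z. ennreal (exp (f (fst z) + g (snd z))))"
    by (auto simp: fun_eq_iff exp_add ennreal_mult)
  finally show ?thesis
    by (simp add: kform_def soft_mass_def integral_density exp_add[symmetric])
qed

text \<open>\<open>soft\<close> depends on (\<alpha>, f) only through the weighted measure. Equal
  weighted measures therefore give equal right-hand sides of the Sinkhorn equation.\<close>

lemma soft_eq_kform:
  assumes \<alpha>: "\<alpha> \<in> Mplus X" and f: "admissible f" and x: "x \<in> X"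
  shows "soft \<alpha> f x = kform (weigh f \<alpha>) (dirac x)"
proof -
  note Mplus_sets[OF \<alpha>, measurable_cong] C_section[OF x, measurable]
  have [measurable]: "f \<in> borel_measurable B" using f by (auto simp: admissible_def)
  define k where "k z = exp (- C z x / \<epsilon>)" for z
  have [measurable]: "k \<in> borel_measurable \<alpha>"
    using borel_measurable_integrable[OF kernel_section_integrable[OF \<alpha> x]] unfolding k_def .
  have "kform (weigh f \<alpha>) (dirac x) = (\<integral>z. exp (f z) * k z \<partial>\<alpha>)"
    unfolding kform_dirac[OF weigh_Mplus[OF \<alpha> f] x] k_def[symmetric] unfolding weigh_def by (simp add: integral_density)
  also have "\<dots> = soft \<alpha> f x" unfolding soft_def k_def
    using C_sym[OF x] Mplus_space[OF \<alpha>] by (intro Bochner_Integration.integral_cong) (auto simp: exp_add[symmetric])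
  finally show ?thesis by simp
qed

lemma potential_admissible: "potential \<alpha> f u \<Longrightarrow> admissible f"
  by (auto simp: potential_def dual_pair_def admissible_def)

lemma potential_OT:
  assumes "\<alpha> \<in> Mplus X" "potential \<alpha> f u"
  shows "OT X C \<epsilon> \<phi> \<alpha> \<alpha> = ereal (2 * (\<integral>x. u x \<partial>\<alpha>) + \<epsilon> * (mass \<alpha>)\<^sup>2 - \<epsilon> * kform (weigh f \<alpha>) (weigh f \<alpha>))"
  using assms soft_mass_eq_kform[OF assms(1,1) potential_admissible[OF assms(2)] potential_admissible[OF assms(2)]]
  by (simp add: potential_def)

text \<open>The integrals of u and v cancel against half the diagonal values, and the masses cancel
  because \<epsilon> m(\<alpha>) m(\<beta>) - \<epsilon> / 2 (m(\<alpha>)^2 + m(\<beta>)^2) is minus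
  the correction term. Only the kernel energy remains.\<close>

lemma sinkhorn_divergence_ge:
  assumes \<alpha>: "\<alpha> \<in> Mplus X" and \<beta>: "\<beta> \<in> Mplus X" and f: "potential \<alpha> f u" and g: "potential \<beta> g v"
  shows "ereal (\<epsilon> / 2 * (kform (weigh f \<alpha>) (weigh f \<alpha>) + kform (weigh g \<beta>) (weigh g \<beta>) - 2 * kform (weigh f \<alpha>) (weigh g \<beta>)))
    \<le> sinkhorn_divergence X C \<epsilon> \<phi> \<alpha> \<beta>"
proof -
  note af = potential_admissible[OF f] and ag = potential_admissible[OF g]
  have le: "ereal ((\<integral>x. u x \<partial>\<alpha>) + (\<integral>y. v y \<partial>\<beta>) + \<epsilon> * (mass \<alpha> * mass \<beta>) - \<epsilon> * kform (weigh f \<alpha>) (weigh g \<beta>)) \<le> OT X C \<epsilon> \<phi> \<alpha> \<beta>"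
    using OT_ge[OF \<alpha> \<beta>, of f u g v] f g soft_mass_eq_kform[OF \<alpha> \<beta> af ag] by (simp add: potential_def)
  show ?thesis
  proof (cases "OT X C \<epsilon> \<phi> \<alpha> \<beta>")
    case (real r)
    then show ?thesis using le
      by (simp add: sinkhorn_divergence_def potential_OT[OF \<alpha> f] potential_OT[OF \<beta> g] power2_eq_square algebra_simps)
  next
    case PInf
    then show ?thesis by (simp add: sinkhorn_divergence_def potential_OT[OF \<alpha> f] potential_OT[OF \<beta> g])
  next
    case MInf
    then show ?thesis using OT_not_MInf[OF \<alpha> \<beta>] by simp
  qed
qed

theorem sinkhorn_divergence_nonneg:
  assumes \<alpha>: "\<alpha> \<in> Mplus X" and \<beta>: "\<beta> \<in> Mplus X"
  shows "0 \<le> sinkhorn_divergence X C \<epsilon> \<phi> \<alpha> \<beta>"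
proof -
  obtain f u g v where p: "potential \<alpha> f u" "potential \<beta> g v" using potential_exists[OF \<alpha>] potential_exists[OF \<beta>] by blast
  have "0 \<le> \<epsilon> / 2 * (kform (weigh f \<alpha>) (weigh f \<alpha>) + kform (weigh g \<beta>) (weigh g \<beta>) - 2 * kform (weigh f \<alpha>) (weigh g \<beta>))"
    using eps kform_pos[OF weigh_Mplus[OF \<alpha> potential_admissible[OF p(1)]] weigh_Mplus[OF \<beta> potential_admissible[OF p(2)]]] by simp
  then show ?thesis using order_trans[OF _ sinkhorn_divergence_ge[OF \<alpha> \<beta> p]] by (simp add: zero_ereal_def)
qed

lemma weigh_minus:
  assumes \<alpha>: "\<alpha> \<in> Mplus X" and f: "admissible f"
  shows "weigh (\<lambda>x. - f x) (weigh f \<alpha>) = \<alpha>"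
proof -
  note Mplus_sets[OF \<alpha>, measurable_cong]
  have [measurable]: "f \<in> borel_measurable B" using f by (auto simp: admissible_def)
  have "weigh (\<lambda>x. - f x) (weigh f \<alpha>) = density \<alpha> (\<lambda>x. ennreal (exp (f x)) * ennreal (exp (- f x)))"
    unfolding weigh_def by (intro density_density_eq) auto
  then show ?thesis by (simp add: ennreal_mult[symmetric] exp_add[symmetric] density_1)
qed

lemma weigh_cong:
  assumes \<alpha>: "\<alpha> \<in> Mplus X" and f: "admissible f" and g: "admissible g" and eq: "\<And>x. x \<in> X \<Longrightarrow> f x = g x"
  shows "weigh f \<alpha> = weigh g \<alpha>"
proof -
  note Mplus_sets[OF \<alpha>, measurable_cong]
  have [measurable]: "f \<in> borel_measurable B" "g \<in> borel_measurable B" using f g by (auto simp: admissible_def)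
  show ?thesis unfolding weigh_def using eq Mplus_space[OF \<alpha>] by (intro density_cong) auto
qed

lemma weigh_zero_mass:
  assumes \<alpha>: "\<alpha> \<in> Mplus X" and f: "admissible f" and m: "mass \<alpha> = 0"
  shows "weigh f \<alpha> = \<alpha>"
proof -
  interpret finite_measure \<alpha> using \<alpha> by (rule Mplus_finite)
  have "AE x in \<alpha>. False" using emeasure_eq_measure[of "space \<alpha>"] m by (intro AE_I[of _ _ "space \<alpha>"]) auto
  note Mplus_sets[OF \<alpha>, measurable_cong]
  have [measurable]: "f \<in> borel_measurable B" using f by (auto simp: admissible_def)
  have "weigh f \<alpha> = density \<alpha> (\<lambda>_. 1)" unfolding weigh_def
  proof (rule density_cong)
    show "AE x in \<alpha>. ennreal (exp (f x)) = 1" using \<open>AE x in \<alpha>. False\<close> by eventually_elim simp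
  qed auto
  then show ?thesis by (simp add: density_1)
qed

theorem sinkhorn_divergence_definite:
  assumes \<alpha>: "\<alpha> \<in> Mplus X" and \<beta>: "\<beta> \<in> Mplus X"
  shows "sinkhorn_divergence X C \<epsilon> \<phi> \<alpha> \<beta> = 0 \<longleftrightarrow> \<alpha> = \<beta>"
proof
  obtain f u g v where p: "potential \<alpha> f u" "potential \<beta> g v" using potential_exists[OF \<alpha>] potential_exists[OF \<beta>] by blast
  note af = potential_admissible[OF p(1)] and ag = potential_admissible[OF p(2)]
  note W = weigh_Mplus[OF \<alpha> af] weigh_Mplus[OF \<beta> ag]
  assume "sinkhorn_divergence X C \<epsilon> \<phi> \<alpha> \<beta> = 0"
  then have "\<epsilon> / 2 * (kform (weigh f \<alpha>) (weigh f \<alpha>) + kform (weigh g \<beta>) (weigh g \<beta>) - 2 * kform (weigh f \<alpha>) (weigh g \<beta>)) \<le> 0"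
    using sinkhorn_divergence_ge[OF \<alpha> \<beta> p] by (simp add: zero_ereal_def)
  then have "kform (weigh f \<alpha>) (weigh f \<alpha>) + kform (weigh g \<beta>) (weigh g \<beta>) - 2 * kform (weigh f \<alpha>) (weigh g \<beta>) = 0"
    using kform_pos[OF W] eps by (simp add: mult_le_0_iff)
  then have eq: "weigh f \<alpha> = weigh g \<beta>" by (rule zero_energy_eq[OF W])
  \<comment> \<open>Without mass there is no Sinkhorn equation to compare, but weighting does not
    change a zero measure.\<close>
  have mz: "\<gamma> = weigh h \<gamma>" if "\<gamma> \<in> Mplus X" "admissible h" "\<not> 0 < mass \<gamma>" for \<gamma> h
    using weigh_zero_mass[OF that(1,2)] that(3) by (simp add: zero_less_measure_iff)
  have neg: "admissible (\<lambda>x. - h x)" if "admissible h" for h using that by (auto simp: admissible_def)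
  show "\<alpha> = \<beta>"
  proof (cases "0 < mass \<alpha> \<and> 0 < mass \<beta>")
    case True
    have "f x = g x" if x: "x \<in> X" for x
    proof -
      have "soft \<alpha> f x = soft \<beta> g x" using soft_eq_kform[OF \<alpha> af x] soft_eq_kform[OF \<beta> ag x] eq by simp
      then show ?thesis using p x True by (simp add: potential_def sinkhorn_map_def)
    qed
    then have "weigh (\<lambda>x. - f x) (weigh f \<alpha>) = weigh (\<lambda>x. - g x) (weigh g \<beta>)"
      unfolding eq by (intro weigh_cong W neg af ag) auto
    then show ?thesis using weigh_minus[OF \<alpha> af] weigh_minus[OF \<beta> ag] by simp
  next
    case False
    then consider "\<not> 0 < mass \<alpha>" | "\<not> 0 < mass \<beta>" by blast
    then show ?thesis
    proof cases
      case 1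
      then have "\<alpha> = weigh g \<beta>" using mz[OF \<alpha> af] eq by simp
      moreover from this have "weigh (\<lambda>x. - g x) \<alpha> = \<beta>" using weigh_minus[OF \<beta> ag] by simp
      ultimately show ?thesis using mz[OF \<alpha> neg[OF ag]] 1 by simp
    next
      case 2
      then have "\<beta> = weigh f \<alpha>" using mz[OF \<beta> ag] eq by simp
      moreover from this have "weigh (\<lambda>x. - f x) \<beta> = \<alpha>" using weigh_minus[OF \<alpha> af] by simp
      ultimately show ?thesis using mz[OF \<beta> neg[OF af]] 2 by simp
    qed
  qed
next
  assume "\<alpha> = \<beta>"
  moreover obtain f u where "potential \<alpha> f u" using potential_exists[OF \<alpha>] by blast
  ultimately show "sinkhorn_divergence X C \<epsilon> \<phi> \<alpha> \<beta> = 0"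
    using potential_OT[OF \<alpha>] by (simp add: sinkhorn_divergence_def)
qed

end

subsection \<open>Convexity\<close>

context sinkhorn
begin

text \<open>
  After the change of variable \<open>\<mu> = exp f \<alpha>\<close> the dual functional is jointly concave in
  \<open>(\<alpha>, \<mu>)\<close>, so the candidate for the mixture is \<open>ln (w exp f + (1 - w) exp f')\<close>, where \<open>w\<close> is the
  density of \<open>t \<alpha>\<close> with respect to the mixture.
\<close>

lemma OT_diag_mix:
  assumes \<alpha>: "\<alpha> \<in> Mplus X" "\<alpha>' \<in> Mplus X" and t: "0 < t" "t < 1"
    and p: "potential \<alpha> f u" "potential \<alpha>' f' u'"
  shows "ereal (2 * (t * (\<integral>x. u x \<partial>\<alpha>) + (1 - t) * (\<integral>x. u' x \<partial>\<alpha>')) + \<epsilon> * (mass (mix t \<alpha> \<alpha>'))\<^sup>2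
      - \<epsilon> * (t * kform (weigh f \<alpha>) (weigh f \<alpha>) + (1 - t) * kform (weigh f' \<alpha>') (weigh f' \<alpha>')))
    \<le> OT X C \<epsilon> \<phi> (mix t \<alpha> \<alpha>') (mix t \<alpha> \<alpha>')"
proof -
  define M where "M = mix t \<alpha> \<alpha>'"
  have MX: "M \<in> Mplus X" unfolding M_def by (intro mix_Mplus \<alpha>)
  note Mplus_sets[OF MX, measurable_cong]
  have s: "sets \<alpha> = sets \<alpha>'" "sets \<alpha> = sets M" "sets \<alpha>' = sets M"
    using Mplus_sets[OF \<alpha>(1)] Mplus_sets[OF \<alpha>(2)] Mplus_sets[OF MX] by simp_all
  have spM: "space M = X" using MX by (rule Mplus_space)
  interpret M: finite_measure M using MX by (rule Mplus_finite)
  have ac: "emeasure \<alpha> A = 0" "emeasure \<alpha>' A = 0" if "A \<in> sets M" "emeasure M A = 0" for A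
  proof -
    have "ennreal t * emeasure \<alpha> A + ennreal (1 - t) * emeasure \<alpha>' A = 0"
      using emeasure_mix[OF s(1), of A t] that unfolding M_def by simp
    then show "emeasure \<alpha> A = 0" "emeasure \<alpha>' A = 0" using t by (auto simp: ennreal_eq_0_iff)
  qed
  obtain y where y[measurable]: "y \<in> borel_measurable M" "\<And>x. 0 \<le> (y x :: real)" "\<alpha> = density M (\<lambda>x. ennreal (y x))"
    using finite_real_density[OF M.finite_measure_axioms Mplus_finite[OF \<alpha>(1)] s(2) ac(1)] by metis
  obtain y' where y'[measurable]: "y' \<in> borel_measurable M" "\<And>x. 0 \<le> (y' x :: real)" "\<alpha>' = density M (\<lambda>x. ennreal (y' x))"
    using finite_real_density[OF M.finite_measure_axioms Mplus_finite[OF \<alpha>(2)] s(3) ac(2)] by metis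
  have "density M (\<lambda>x. ennreal (t * y x + (1 - t) * y' x)) = density M (\<lambda>_. 1)"
  proof -
    have "density M (\<lambda>x. ennreal (t * y x + (1 - t) * y' x)) =
        mix t (density M (\<lambda>x. ennreal (y x))) (density M (\<lambda>x. ennreal (y' x)))"
      using t by (intro mix_density[symmetric] y y') auto
    then show ?thesis by (simp only: y(3)[symmetric] y'(3)[symmetric] M_def[symmetric] density_1)
  qed
  then have "AE x in M. ennreal (t * y x + (1 - t) * y' x) = 1" by (intro M.density_unique) auto
  then have ae: "AE x in M. t * y x + (1 - t) * y' x = 1"
  proof eventually_elim
    case (elim x)
    then have "ennreal (t * y x + (1 - t) * y' x) = ennreal 1" by (simp only: ennreal_1)
    then show ?case using t y(2)[of x] y'(2)[of x] by (subst (asm) ennreal_inj) auto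
  qed
  \<comment> \<open>The identity t y + (1 - t) y' = 1 holds only almost everywhere; truncation puts
    w in [0, 1] everywhere, as pointwise feasibility requires.\<close>
  define w where "w x = min 1 (t * y x)" for x
  have w: "0 \<le> w x" "w x \<le> 1" for x using t y(2) by (auto simp: w_def)
  have aew: "AE x in M. t * y x = w x \<and> (1 - t) * y' x = 1 - w x"
    using ae
  proof eventually_elim
    case (elim x)
    have "0 \<le> (1 - t) * y' x" using t y'(2) by simp
    then show ?case using elim by (auto simp: w_def)
  qed
  have wm[measurable]: "w \<in> borel_measurable M" unfolding w_def[abs_def] by measurable
  note af = potential_admissible[OF p(1)] potential_admissible[OF p(2)]
  have dp: "dual_pair f u" "dual_pair f' u'" using p by (auto simp: potential_def)
  have fm: "f \<in> borel_measurable B" "u \<in> borel_measurable B" "f' \<in> borel_measurable B" "u' \<in> borel_measurable B"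
    using dp by (auto simp: dual_pair_def)
  have [measurable]: "f \<in> borel_measurable M" "u \<in> borel_measurable M" "f' \<in> borel_measurable M" "u' \<in> borel_measurable M"
    using fm Mplus_sets[OF MX] by (simp_all cong: measurable_cong_sets)
  obtain K where K: "\<And>x. x \<in> X \<Longrightarrow> \<bar>f x\<bar> \<le> K \<and> \<bar>u x\<bar> \<le> K" using dp(1) by (auto simp: dual_pair_def)
  obtain K' where K': "\<And>x. x \<in> X \<Longrightarrow> \<bar>f' x\<bar> \<le> K' \<and> \<bar>u' x\<bar> \<le> K'" using dp(2) by (auto simp: dual_pair_def)
  define L where "L = max K K'"
  have L: "\<bar>f x\<bar> \<le> L" "\<bar>u x\<bar> \<le> L" "\<bar>f' x\<bar> \<le> L" "\<bar>u' x\<bar> \<le> L" if "x \<in> X" for x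
    using K[OF that] K'[OF that] by (auto simp: L_def)
  define E where "E x = w x * exp (f x) + (1 - w x) * exp (f' x)" for x
  \<comment> \<open>Convexity of exp, which makes F at least the convex combination of f and
    f'.\<close>
  have comb: "exp (w x * f x + (1 - w x) * f' x) \<le> E x" for x
    using convex_onD[OF exp_convex, of "1 - w x" "f x" "f' x"] w[of x] by (simp add: E_def)
  then have E0: "0 < E x" for x using exp_gt_zero less_le_trans by blast
  define F where "F x = ln (E x)" for x
  define U where "U x = w x * u x + (1 - w x) * u' x" for x
  have eF: "exp (F x) = E x" for x using E0 by (simp add: F_def)
  have FM: "F \<in> borel_measurable M" "U \<in> borel_measurable M" unfolding F_def[abs_def] E_def U_def[abs_def] by measurable
  have conv_le: "w x * a + (1 - w x) * b \<le> c" if "a \<le> c" "b \<le> c" for x a b c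
  proof -
    have "w x * a + (1 - w x) * b \<le> w x * c + (1 - w x) * c" using that w[of x] by (intro add_mono mult_left_mono) auto
    then show ?thesis by (simp add: algebra_simps)
  qed
  have conv_ge: "c \<le> w x * a + (1 - w x) * b" if "c \<le> a" "c \<le> b" for x a b c
    using conv_le[of "- a" "- c" "- b" x] that by simp
  have dF: "w x * f x + (1 - w x) * f' x \<le> F x" for x
    using comb[of x] E0[of x] by (simp add: F_def ln_ge_iff)
  have Fb: "\<bar>F x\<bar> \<le> L" if x: "x \<in> X" for x
  proof -
    have "- L \<le> w x * f x + (1 - w x) * f' x" using L[OF x] by (intro conv_ge) (auto simp: abs_le_iff)
    then have "- L \<le> F x" using dF[of x] by linarith
    moreover have "E x \<le> exp L" unfolding E_def using L[OF x] by (intro conv_le) (auto simp: abs_le_iff)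
    then have "F x \<le> L" using E0[of x] eF[of x] by (metis exp_le_cancel_iff)
    ultimately show ?thesis by simp
  qed
  have Ub: "\<bar>U x\<bar> \<le> L" if x: "x \<in> X" for x
  proof -
    have "- L \<le> U x" unfolding U_def using L[OF x] by (intro conv_ge) (auto simp: abs_le_iff)
    moreover have "U x \<le> L" unfolding U_def using L[OF x] by (intro conv_le) (auto simp: abs_le_iff)
    ultimately show ?thesis by simp
  qed
  \<comment> \<open>Enlarging the potential lowers the minorant because q \<ge> 0, so it lies below
    a convex combination of two feasible minorants.\<close>
  have feas: "ennreal (U x - \<epsilon> * F x * q) \<le> \<phi> q" if x: "x \<in> X" and q: "0 \<le> q" for x q
  proof -
    define a b where "a = u x - \<epsilon> * f x * q" and "b = u' x - \<epsilon> * f' x * q"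
    have "\<epsilon> * q * (w x * f x + (1 - w x) * f' x) \<le> \<epsilon> * q * F x" using eps q dF by (intro mult_left_mono) auto
    then have "U x - \<epsilon> * F x * q \<le> w x * a + (1 - w x) * b" by (simp add: U_def a_def b_def algebra_simps)
    also have "\<dots> \<le> max a b" by (intro conv_le) auto
    finally have "ennreal (U x - \<epsilon> * F x * q) \<le> ennreal (max a b)" by (rule ennreal_leI)
    also have "\<dots> \<le> \<phi> q" using dp x q by (auto simp: max_def a_def b_def dual_pair_def)
    finally show ?thesis .
  qed
  have "F \<in> borel_measurable B" "U \<in> borel_measurable B" using FM Mplus_sets[OF MX] by (simp_all cong: measurable_cong_sets)
  then have dpF: "dual_pair F U" unfolding dual_pair_def using Fb Ub feas by blast
  then have aF: "admissible F" by (auto simp: dual_pair_def admissible_def)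
  \<comment> \<open>This linearity is the reason for the choice of F: the weighted measures mix
    exactly.\<close>
  have "weigh F M = mix t (weigh f \<alpha>) (weigh f' \<alpha>')"
  proof -
    have "weigh f \<alpha> = density M (\<lambda>x. ennreal (y x * exp (f x)))"
      unfolding y(3) weigh_def using y(2) by (subst density_density_eq) (auto simp: ennreal_mult)
    moreover have "weigh f' \<alpha>' = density M (\<lambda>x. ennreal (y' x * exp (f' x)))"
      unfolding y'(3) weigh_def using y'(2) by (subst density_density_eq) (auto simp: ennreal_mult)
    ultimately have "mix t (weigh f \<alpha>) (weigh f' \<alpha>') = density M (\<lambda>x. ennreal (t * (y x * exp (f x)) + (1 - t) * (y' x * exp (f' x))))"
      using t y(2) y'(2) by (simp add: mix_density)
    also have "\<dots> = weigh F M" unfolding weigh_def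
    proof (rule density_cong)
      show "AE x in M. ennreal (t * (y x * exp (f x)) + (1 - t) * (y' x * exp (f' x))) = ennreal (exp (F x))"
        using aew
      proof eventually_elim
        case (elim x)
        then show ?case unfolding eF E_def by (simp add: mult.assoc[symmetric])
      qed
    qed (use FM in auto)
    finally show ?thesis by simp
  qed
  then have kF: "kform (weigh F M) (weigh F M) \<le> t * kform (weigh f \<alpha>) (weigh f \<alpha>) + (1 - t) * kform (weigh f' \<alpha>') (weigh f' \<alpha>')"
    using kform_mix_convex[OF weigh_Mplus[OF \<alpha>(1) af(1)] weigh_Mplus[OF \<alpha>(2) af(2)]] t by simp
  have IU: "(\<integral>x. U x \<partial>M) = t * (\<integral>x. u x \<partial>\<alpha>) + (1 - t) * (\<integral>x. u' x \<partial>\<alpha>')"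
  proof -
    have 1: "integrable M (\<lambda>x. w x * u x)" "integrable M (\<lambda>x. (1 - w x) * u' x)"
    proof -
      have *: "\<bar>c * r\<bar> \<le> L" if "0 \<le> c" "c \<le> 1" "\<bar>r\<bar> \<le> L" for c r :: real
      proof -
        have "c * \<bar>r\<bar> \<le> \<bar>r\<bar>" using that by (intro mult_left_le_one_le) auto
        then show ?thesis using that by (simp add: abs_mult)
      qed
      show "integrable M (\<lambda>x. w x * u x)"
        using w L(2) spM by (intro bounded_integrable[OF M.finite_measure_axioms, where K=L] *) auto
      show "integrable M (\<lambda>x. (1 - w x) * u' x)"
        using w L(4) spM by (intro bounded_integrable[OF M.finite_measure_axioms, where K=L] *) auto
    qed
    have "(\<integral>x. w x * u x \<partial>M) = (\<integral>x. t * (y x * u x) \<partial>M)"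
      using aew by (intro integral_cong_AE) (auto simp: mult.assoc[symmetric])
    also have "\<dots> = t * (\<integral>x. u x \<partial>\<alpha>)" unfolding y(3) using y(2) by (simp add: integral_density)
    finally have 2: "(\<integral>x. w x * u x \<partial>M) = t * (\<integral>x. u x \<partial>\<alpha>)" .
    have "(\<integral>x. (1 - w x) * u' x \<partial>M) = (\<integral>x. (1 - t) * (y' x * u' x) \<partial>M)"
      using aew by (intro integral_cong_AE) (auto simp: mult.assoc[symmetric])
    also have "\<dots> = (1 - t) * (\<integral>x. u' x \<partial>\<alpha>')" unfolding y'(3) using y'(2) by (simp add: integral_density)
    finally have 3: "(\<integral>x. (1 - w x) * u' x \<partial>M) = (1 - t) * (\<integral>x. u' x \<partial>\<alpha>')" .
    show ?thesis unfolding U_def using 1 2 3 by simp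
  qed
  have "2 * (t * (\<integral>x. u x \<partial>\<alpha>) + (1 - t) * (\<integral>x. u' x \<partial>\<alpha>')) + \<epsilon> * (mass M)\<^sup>2
      - \<epsilon> * (t * kform (weigh f \<alpha>) (weigh f \<alpha>) + (1 - t) * kform (weigh f' \<alpha>') (weigh f' \<alpha>'))
      \<le> (\<integral>x. U x \<partial>M) + (\<integral>x. U x \<partial>M) + \<epsilon> * (mass M * mass M) - \<epsilon> * soft_mass F F M M"
    using mult_left_mono[OF kF, of \<epsilon>] eps unfolding soft_mass_eq_kform[OF MX MX aF aF] IU by (simp add: power2_eq_square)
  then show ?thesis using order_trans[OF _ OT_ge[OF MX MX dpF dpF]] unfolding M_def[symmetric] by simp
qed

definition self_cost :: "'a measure \<Rightarrow> real" where "self_cost \<alpha> = real_of_ereal (OT X C \<epsilon> \<phi> \<alpha> \<alpha>)"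

lemma OT_diag_eq_self_cost: "\<alpha> \<in> Mplus X \<Longrightarrow> OT X C \<epsilon> \<phi> \<alpha> \<alpha> = ereal (self_cost \<alpha>)"
  using potential_exists[of \<alpha>] potential_OT[of \<alpha>] by (auto simp: self_cost_def)

lemma OT_diag_concave:
  assumes \<alpha>: "\<alpha> \<in> Mplus X" "\<alpha>' \<in> Mplus X" and t: "0 < t" "t < 1"
  shows "t * (self_cost \<alpha> - \<epsilon> * (mass \<alpha>)\<^sup>2) + (1 - t) * (self_cost \<alpha>' - \<epsilon> * (mass \<alpha>')\<^sup>2)
    \<le> self_cost (mix t \<alpha> \<alpha>') - \<epsilon> * (mass (mix t \<alpha> \<alpha>'))\<^sup>2"
proof -
  obtain f u f' u' where p: "potential \<alpha> f u" "potential \<alpha>' f' u'" using potential_exists \<alpha> by metis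
  have a: "self_cost \<alpha> - \<epsilon> * (mass \<alpha>)\<^sup>2 = 2 * (\<integral>x. u x \<partial>\<alpha>) - \<epsilon> * kform (weigh f \<alpha>) (weigh f \<alpha>)"
    using potential_OT[OF \<alpha>(1) p(1)] by (simp add: self_cost_def)
  have b: "self_cost \<alpha>' - \<epsilon> * (mass \<alpha>')\<^sup>2 = 2 * (\<integral>x. u' x \<partial>\<alpha>') - \<epsilon> * kform (weigh f' \<alpha>') (weigh f' \<alpha>')"
    using potential_OT[OF \<alpha>(2) p(2)] by (simp add: self_cost_def)
  show ?thesis
    using OT_diag_mix[OF \<alpha> t p] unfolding OT_diag_eq_self_cost[OF mix_Mplus[OF \<alpha>]] ereal_less_eq a b by (simp add: algebra_simps)
qed

lemma sinkhorn_divergence_eq: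
  assumes "\<alpha> \<in> Mplus X" "\<beta> \<in> Mplus X"
  shows "sinkhorn_divergence X C \<epsilon> \<phi> \<alpha> \<beta> = OT X C \<epsilon> \<phi> \<alpha> \<beta> +
    ereal (- self_cost \<alpha> / 2 - self_cost \<beta> / 2 + \<epsilon> / 2 * (mass \<alpha> - mass \<beta>)\<^sup>2)"
  by (cases "OT X C \<epsilon> \<phi> \<alpha> \<beta>") (simp_all add: sinkhorn_divergence_def OT_diag_eq_self_cost[OF assms(1)] OT_diag_eq_self_cost[OF assms(2)])

text \<open>OT is convex under \<open>prod\<close>, and the diagonal costs minus \<epsilon> times
  the squared mass are concave. After this split the only mass term left is -\<epsilon> m(\<alpha>)
  m(\<beta>), and \<open>prod\<close> makes it affine along the mixture.\<close>

lemma sinkhorn_divergence_mix: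
  assumes \<alpha>: "\<alpha> \<in> Mplus X" "\<alpha>' \<in> Mplus X" and \<beta>: "\<beta> \<in> Mplus X" "\<beta>' \<in> Mplus X" and t: "t \<in> {0..1}"
    and prod: "mix t \<alpha> \<alpha>' \<Otimes>\<^sub>M mix t \<beta> \<beta>' = mix t (\<alpha> \<Otimes>\<^sub>M \<beta>) (\<alpha>' \<Otimes>\<^sub>M \<beta>')"
  shows "sinkhorn_divergence X C \<epsilon> \<phi> (mix t \<alpha> \<alpha>') (mix t \<beta> \<beta>') \<le>
    ereal t * sinkhorn_divergence X C \<epsilon> \<phi> \<alpha> \<beta> + ereal (1 - t) * sinkhorn_divergence X C \<epsilon> \<phi> \<alpha>' \<beta>'"
proof -
  have s: "sets \<alpha> = sets \<alpha>'" "sets \<beta> = sets \<beta>'" using \<alpha> \<beta> by (simp_all add: Mplus_sets)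
  consider "t = 0" | "t = 1" | "0 < t" "t < 1" using t by fastforce
  then show ?thesis
  proof cases
    case 1
    then show ?thesis by (simp add: mix_0 s zero_ereal_def[symmetric] one_ereal_def[symmetric])
  next
    case 2
    then show ?thesis by (simp add: mix_1 s zero_ereal_def[symmetric] one_ereal_def[symmetric])
  next
    case 3
    define c where "c \<alpha> \<beta> = - self_cost \<alpha> / 2 - self_cost \<beta> / 2 + \<epsilon> / 2 * (mass \<alpha> - mass \<beta>)\<^sup>2" for \<alpha> \<beta> :: "'a measure"
    let ?a = "mix t \<alpha> \<alpha>'" and ?b = "mix t \<beta> \<beta>'"
    note fin = Mplus_finite[OF \<alpha>(1)] Mplus_finite[OF \<alpha>(2)] Mplus_finite[OF \<beta>(1)] Mplus_finite[OF \<beta>(2)]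
    have t': "0 \<le> t" "t \<le> 1" using 3 by auto
    have "mass (\<alpha> \<Otimes>\<^sub>M \<beta>) = mass \<alpha> * mass \<beta>" "mass (\<alpha>' \<Otimes>\<^sub>M \<beta>') = mass \<alpha>' * mass \<beta>'"
      using fin by (simp_all add: mass_pair)
    moreover have "mass (?a \<Otimes>\<^sub>M ?b) = mass ?a * mass ?b"
      using fin s by (intro mass_pair finite_measure_mix) auto
    moreover have "mass (mix t (\<alpha> \<Otimes>\<^sub>M \<beta>) (\<alpha>' \<Otimes>\<^sub>M \<beta>')) = t * mass (\<alpha> \<Otimes>\<^sub>M \<beta>) + (1 - t) * mass (\<alpha>' \<Otimes>\<^sub>M \<beta>')"
      using fin s t' by (intro mass_mix finite_measure_pair) (auto intro: sets_pair_measure_cong)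
    \<comment> \<open>Obtained by taking total masses on both sides of \<open>prod\<close>.\<close>
    ultimately have mm: "mass ?a * mass ?b = t * (mass \<alpha> * mass \<beta>) + (1 - t) * (mass \<alpha>' * mass \<beta>')"
      unfolding prod by simp
    define A A' AA where "A = self_cost \<alpha> - \<epsilon> * (mass \<alpha>)\<^sup>2" and "A' = self_cost \<alpha>' - \<epsilon> * (mass \<alpha>')\<^sup>2" and "AA = self_cost ?a - \<epsilon> * (mass ?a)\<^sup>2"
    define D D' DD where "D = self_cost \<beta> - \<epsilon> * (mass \<beta>)\<^sup>2" and "D' = self_cost \<beta>' - \<epsilon> * (mass \<beta>')\<^sup>2" and "DD = self_cost ?b - \<epsilon> * (mass ?b)\<^sup>2"
    have 1: "t * A + (1 - t) * A' \<le> AA" "t * D + (1 - t) * D' \<le> DD"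
      unfolding A_def A'_def AA_def D_def D'_def DD_def by (intro OT_diag_concave \<alpha> \<beta> 3)+
    have ceq: "c \<mu> \<nu> = - (self_cost \<mu> - \<epsilon> * (mass \<mu>)\<^sup>2) / 2 - (self_cost \<nu> - \<epsilon> * (mass \<nu>)\<^sup>2) / 2 - \<epsilon> * (mass \<mu> * mass \<nu>)" for \<mu> \<nu>
      unfolding c_def power2_diff by (simp add: field_simps)
    have ct: "c ?a ?b \<le> t * c \<alpha> \<beta> + (1 - t) * c \<alpha>' \<beta>'"
    proof -
      have "c ?a ?b = - AA / 2 - DD / 2 - \<epsilon> * (mass ?a * mass ?b)" by (simp add: ceq AA_def DD_def)
      also have "\<dots> \<le> - (t * A + (1 - t) * A') / 2 - (t * D + (1 - t) * D') / 2 - \<epsilon> * (mass ?a * mass ?b)"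
      proof -
        have "- AA / 2 - DD / 2 - r \<le> - p / 2 - q / 2 - r" if "p \<le> AA" "q \<le> DD" for p q r :: real
          using that by simp
        then show ?thesis using 1 by blast
      qed
      also have "\<dots> = t * (- A / 2 - D / 2 - \<epsilon> * (mass \<alpha> * mass \<beta>)) + (1 - t) * (- A' / 2 - D' / 2 - \<epsilon> * (mass \<alpha>' * mass \<beta>'))"
        unfolding mm by (simp add: field_simps)
      also have "\<dots> = t * c \<alpha> \<beta> + (1 - t) * c \<alpha>' \<beta>'" by (simp add: ceq A_def A'_def D_def D'_def)
      finally show ?thesis .
    qed
    have "sinkhorn_divergence X C \<epsilon> \<phi> ?a ?b = OT X C \<epsilon> \<phi> ?a ?b + ereal (c ?a ?b)"
      using sinkhorn_divergence_eq[OF mix_Mplus[OF \<alpha>] mix_Mplus[OF \<beta>]] by (simp add: c_def)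
    also have "\<dots> \<le> (ereal t * OT X C \<epsilon> \<phi> \<alpha> \<beta> + ereal (1 - t) * OT X C \<epsilon> \<phi> \<alpha>' \<beta>') + ereal (t * c \<alpha> \<beta> + (1 - t) * c \<alpha>' \<beta>')"
      using ct by (intro add_mono OT_mix \<alpha> \<beta> 3 prod) simp
    also have "\<dots> = ereal t * (OT X C \<epsilon> \<phi> \<alpha> \<beta> + ereal (c \<alpha> \<beta>)) + ereal (1 - t) * (OT X C \<epsilon> \<phi> \<alpha>' \<beta>' + ereal (c \<alpha>' \<beta>'))"
      using OT_not_MInf[OF \<alpha>(1) \<beta>(1)] OT_not_MInf[OF \<alpha>(2) \<beta>(2)] 3
      by (cases "OT X C \<epsilon> \<phi> \<alpha> \<beta>"; cases "OT X C \<epsilon> \<phi> \<alpha>' \<beta>'") (simp_all add: distrib_left)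
    also have "\<dots> = ereal t * sinkhorn_divergence X C \<epsilon> \<phi> \<alpha> \<beta> + ereal (1 - t) * sinkhorn_divergence X C \<epsilon> \<phi> \<alpha>' \<beta>'"
      using sinkhorn_divergence_eq[OF \<alpha>(1) \<beta>(1)] sinkhorn_divergence_eq[OF \<alpha>(2) \<beta>(2)] by (simp add: c_def)
    finally show ?thesis .
  qed
qed

theorem sinkhorn_divergence_convex_left:
  assumes \<beta>: "\<beta> \<in> Mplus X"
  shows "convex_on_Mplus X (\<lambda>\<alpha>. sinkhorn_divergence X C \<epsilon> \<phi> \<alpha> \<beta>)"
  unfolding convex_on_Mplus_def
proof (intro ballI)
  fix \<alpha> \<alpha>' :: "'a measure" and t :: real
  assume *: "\<alpha> \<in> Mplus X" "\<alpha>' \<in> Mplus X" "t \<in> {0..1}"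
  then have m: "mix t \<beta> \<beta> = \<beta>" by (intro mix_same) auto
  have "mix t \<alpha> \<alpha>' \<Otimes>\<^sub>M mix t \<beta> \<beta> = mix t (\<alpha> \<Otimes>\<^sub>M \<beta>) (\<alpha>' \<Otimes>\<^sub>M \<beta>)"
    unfolding m using * \<beta> by (intro pair_mix_left) (auto simp: Mplus_sets dest: Mplus_finite)
  from sinkhorn_divergence_mix[OF *(1,2) \<beta> \<beta> *(3) this]
  show "sinkhorn_divergence X C \<epsilon> \<phi> (mix t \<alpha> \<alpha>') \<beta> \<le>
      ereal t * sinkhorn_divergence X C \<epsilon> \<phi> \<alpha> \<beta> + ereal (1 - t) * sinkhorn_divergence X C \<epsilon> \<phi> \<alpha>' \<beta>"
    unfolding m .
qed

theorem sinkhorn_divergence_convex_right: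
  assumes \<alpha>: "\<alpha> \<in> Mplus X"
  shows "convex_on_Mplus X (\<lambda>\<beta>. sinkhorn_divergence X C \<epsilon> \<phi> \<alpha> \<beta>)"
  unfolding convex_on_Mplus_def
proof (intro ballI)
  fix \<beta> \<beta>' :: "'a measure" and t :: real
  assume *: "\<beta> \<in> Mplus X" "\<beta>' \<in> Mplus X" "t \<in> {0..1}"
  then have m: "mix t \<alpha> \<alpha> = \<alpha>" by (intro mix_same) auto
  have "mix t \<alpha> \<alpha> \<Otimes>\<^sub>M mix t \<beta> \<beta>' = mix t (\<alpha> \<Otimes>\<^sub>M \<beta>) (\<alpha> \<Otimes>\<^sub>M \<beta>')"
    unfolding m using * \<alpha> by (intro pair_mix_right) (auto simp: Mplus_sets dest: Mplus_finite)
  from sinkhorn_divergence_mix[OF \<alpha> \<alpha> *(1,2,3) this]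
  show "sinkhorn_divergence X C \<epsilon> \<phi> \<alpha> (mix t \<beta> \<beta>') \<le>
      ereal t * sinkhorn_divergence X C \<epsilon> \<phi> \<alpha> \<beta> + ereal (1 - t) * sinkhorn_divergence X C \<epsilon> \<phi> \<alpha> \<beta>'"
    unfolding m .
qed

end

subsection \<open>Failure of joint convexity\<close>

text \<open>
  On a one-point space measures are masses. For \<open>\<phi>\<close> the indicator of \<open>[0, 2]\<close> and \<open>\<epsilon> = 1\<close>, the
  constraint \<open>\<pi>\<^sub>1 \<le> 2 \<alpha>\<close> is active for large masses, and joint convexity fails at the midpoint
  \<open>(4, 5)\<close> of \<open>(2, 4)\<close> and \<open>(6, 6)\<close> because \<open>2 ^ 7 > 5 ^ 3\<close>.
\<close>

definition box_entropy :: "real \<Rightarrow> ennreal" where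
  "box_entropy p = (if 0 \<le> p \<and> p \<le> 2 then 0 else \<infinity>)"

lemma entropy_function_box: "entropy_function box_entropy"
  unfolding entropy_function_def
proof (intro conjI allI impI)
  fix x y t :: real assume t: "0 \<le> t \<and> t \<le> 1"
  consider "t = 0" | "t = 1" | "0 < t" "t < 1" using t by fastforce
  then show "box_entropy (t * x + (1 - t) * y) \<le> ennreal t * box_entropy x + ennreal (1 - t) * box_entropy y"
  proof cases
    case 3
    show ?thesis
    proof (cases "0 \<le> x \<and> x \<le> 2 \<and> 0 \<le> y \<and> y \<le> 2")
      case True
      then have "t * x + (1 - t) * y \<le> t * 2 + (1 - t) * 2" "0 \<le> t * x + (1 - t) * y"
        using 3 by (auto intro!: add_mono[OF mult_left_mono mult_left_mono] simp del: right_diff_distrib_numeral left_diff_distrib_numeral)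
      then show ?thesis by (simp add: box_entropy_def)
    next
      case False
      then have "box_entropy x = \<infinity> \<or> box_entropy y = \<infinity>" by (auto simp: box_entropy_def)
      then have "ennreal t * box_entropy x + ennreal (1 - t) * box_entropy y = \<infinity>"
        using 3 by (auto simp: ennreal_mult_top)
      then show ?thesis by (simp only: infinity_ennreal_def top_greatest)
    qed
  qed auto
next
  fix x :: real
  show "box_entropy x \<le> Liminf (at x) box_entropy"
  proof (cases "0 \<le> x \<and> x \<le> 2")
    case False
    then have "x \<in> - {0..2}" by auto
    moreover have "open (- {0..2::real})" by auto
    ultimately have "\<forall>\<^sub>F y in at x. y \<in> - {0..2}" by (intro eventually_at_in_open')
    then have "\<forall>\<^sub>F y in at x. box_entropy x \<le> box_entropy y" by eventually_elim (auto simp: box_entropy_def)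
    then show ?thesis by (intro Liminf_bounded)
  qed (simp add: box_entropy_def)
qed (auto simp: box_entropy_def)

section \<open>Computations on a one-point space\<close>

definition point_mass :: "real \<Rightarrow> real measure" where
  "point_mass m = density (count_space {0}) (\<lambda>_. ennreal m)"

lemma sets_restrict_point: "sets (restrict_space borel {0::real}) = Pow {0}"
proof
  show "Pow {0} \<subseteq> sets (restrict_space borel {0::real})"
  proof
    fix A :: "real set" assume "A \<in> Pow {0}"
    then have "A = {} \<or> A = space (restrict_space borel {0::real})" by (auto simp: space_restrict_space)
    then show "A \<in> sets (restrict_space borel {0::real})" by (metis sets.empty_sets sets.top)
  qed
  show "sets (restrict_space borel {0::real}) \<subseteq> Pow {0}"
    using sets.space_closed[of "restrict_space borel {0::real}"] by (simp add: space_restrict_space)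
qed

lemma sets_point_mass [simp]: "sets (point_mass m) = Pow {0}"
  by (simp add: point_mass_def)

lemma space_point_mass [simp]: "space (point_mass m) = {0}"
  by (simp add: point_mass_def)

lemma emeasure_point_mass: "emeasure (point_mass m) {0} = ennreal m"
  unfolding point_mass_def by (subst emeasure_density) (auto simp: nn_integral_count_space_finite)

lemma mass_point_mass [simp]: "0 \<le> m \<Longrightarrow> measure (point_mass m) {0} = m"
  by (simp add: measure_def emeasure_point_mass)

lemma point_mass_Mplus: "point_mass m \<in> Mplus {0}"
proof -
  have "finite_measure (point_mass m)"
    by (rule finite_measureI) (simp only: space_point_mass emeasure_point_mass ennreal_neq_top infinity_ennreal_def not_False_eq_True)
  then show ?thesis unfolding Mplus_def mem_Collect_eq sets_restrict_point sets_point_mass by blast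
qed

lemma Mplus_point: "M \<in> Mplus {0} \<Longrightarrow> M = point_mass (mass M)"
proof (rule measure_eqI)
  assume M: "M \<in> Mplus {0}"
  interpret finite_measure M using M by (rule Mplus_finite)
  show s: "sets M = sets (point_mass (mass M))"
    unfolding Mplus_sets[OF M] sets_restrict_point sets_point_mass ..
  fix A assume "A \<in> sets M"
  then have "A \<in> Pow {0}" unfolding s sets_point_mass .
  then have "A = {} \<or> A = {0}" by blast
  then show "emeasure M A = emeasure (point_mass (mass M)) A"
  proof
    assume A: "A = {0}"
    show ?thesis unfolding A emeasure_point_mass emeasure_eq_measure Mplus_space[OF M] ..
  qed simp
qed

lemma point_mass_density:
  assumes "0 \<le> m" "0 \<le> c"
  shows "density (point_mass m) (\<lambda>_. ennreal c) = point_mass (c * m)"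
  unfolding point_mass_def using assms by (subst density_density_eq) (auto simp: ennreal_mult mult.commute)

lemma mix_point_mass:
  assumes "0 \<le> a" "0 \<le> b" "0 \<le> t" "t \<le> 1"
  shows "mix t (point_mass a) (point_mass b) = point_mass (t * a + (1 - t) * b)"
  unfolding point_mass_def using assms by (intro mix_density) auto

lemma integral_point_mass [simp]: "0 \<le> m \<Longrightarrow> (\<integral>x. F x \<partial>point_mass m) = m * F 0"
  by (simp add: point_mass_def integral_density lebesgue_integral_count_space_finite)

lemma sinkhorn_setting_point: "sinkhorn_setting {0::real} (\<lambda>_ _. 0) 0 1 box_entropy"
  unfolding sinkhorn_setting_def
proof (intro conjI)
  show "positive_kernel {0::real} (\<lambda>x y. exp (- 0 / 1))"
    unfolding positive_kernel_def
  proof (intro ballI)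
    fix \<mu> \<nu> :: "real measure" assume *: "\<mu> \<in> Mplus {0}" "\<nu> \<in> Mplus {0}"
    have k: "(LINT (x, y)|(M \<Otimes>\<^sub>M N). exp (- 0 / 1)) = mass M * mass N"
      if "M \<in> Mplus {0}" "N \<in> Mplus {0}" for M N :: "real measure"
      using mass_pair[OF Mplus_finite[OF that(1)] Mplus_finite[OF that(2)]] by (simp add: case_prod_unfold)
    have "0 \<le> (mass \<mu> - mass \<nu>)\<^sup>2" by simp
    then show "0 \<le> (LINT (x, y)|(\<mu> \<Otimes>\<^sub>M \<mu>). exp (- 0 / 1)) - (LINT (x, y)|(\<mu> \<Otimes>\<^sub>M \<nu>). exp (- 0 / 1))
       - (LINT (x, y)|(\<nu> \<Otimes>\<^sub>M \<mu>). exp (- 0 / 1)) + (LINT (x, y)|(\<nu> \<Otimes>\<^sub>M \<nu>). exp (- 0 / 1 :: real))"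
      unfolding k[OF *(1) *(1)] k[OF *(1) *(2)] k[OF *(2) *(1)] k[OF *(2) *(2)]
      by (simp add: power2_eq_square algebra_simps)
  qed
  show "universal_kernel {0::real} (\<lambda>x y. exp (- 0 / 1))"
    unfolding universal_kernel_def
  proof (intro allI impI)
    fix f :: "real \<Rightarrow> real" and e :: real assume "0 < e"
    then show "\<exists>T c. finite T \<and> T \<subseteq> {0} \<and> (\<forall>x\<in>{0}. \<bar>f x - (\<Sum>y\<in>T. c y * exp (- 0 / 1))\<bar> < e)"
      by (intro exI[of _ "{0}"] exI[of _ "\<lambda>_. f 0"]) simp
  qed
qed (use entropy_function_box in \<open>simp_all add: case_prod_unfold\<close>)

interpretation point: ot_problem box_entropy "{0::real}" "\<lambda>_ _. 0" 1
  by unfold_locales (use entropy_function_box in \<open>simp_all add: case_prod_unfold\<close>)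

text \<open>A plan is a mass p \<le> 2 m with cost p ln (p / (m n)) - p + m n, which decreases up to
  p = m n. As n \<ge> 2, the constraint is active and p = 2 m; it satisfies the second constraint
  because m \<le> n.\<close>

lemma OT_point:
  assumes m: "0 < m" "m \<le> n" "2 \<le> n"
  shows "OT {0::real} (\<lambda>_ _. 0) 1 box_entropy (point_mass m) (point_mass n) = ereal (2 * m * ln (2 / n) - 2 * m + m * n)"
proof (rule antisym)
  define f where "f = ln (2 / n)"
  have f: "f \<le> 0" "exp f = 2 / n" using m by (auto simp: f_def)
  let ?a = "point_mass m" and ?b = "point_mass n"
  note M = point_mass_Mplus[of m] point_mass_Mplus[of n]
  have mass: "mass ?a = m" "mass ?b = n" using m by auto
  have mP: "mass (?a \<Otimes>\<^sub>M ?b) = m * n" using mass_pair[OF Mplus_finite[OF M(1)] Mplus_finite[OF M(2)]] mass by simp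
  \<comment> \<open>2 f is the minimum of f p over [0, 2], as f \<le> 0. The potential 0 serves for
    the second marginal.\<close>
  have "point.dual_pair (\<lambda>_. f) (\<lambda>_. 2 * f)"
    unfolding point.dual_pair_def
  proof (intro conjI ballI allI impI)
    fix p :: real assume "0 \<le> p"
    show "ennreal (2 * f - 1 * f * p) \<le> box_entropy p"
    proof (cases "p \<le> 2")
      case True
      then have "f * (2 - p) \<le> 0" using f by (intro mult_nonpos_nonneg) auto
      then show ?thesis by (simp add: ennreal_neg algebra_simps)
    qed (simp add: box_entropy_def)
  qed (auto intro: exI[of _ "2 * \<bar>f\<bar>"])
  note ge = point.OT_ge[OF M this point.dual_pair_0]
  have u: "(\<integral>x. 2 * f \<partial>?a) = 2 * f * m" using integral_point_mass[of m "\<lambda>_. 2 * f"] m by (simp only: less_imp_le mult.commute)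
  have z: "(\<integral>x. 0 \<partial>?b) = (0::real)" by simp
  have sm: "point.soft_mass (\<lambda>_. f) (\<lambda>_. 0) ?a ?b = (2 / n) * (m * n)"
    by (simp add: point.soft_mass_def f(2) mP)
  have "ereal (2 * f * m + m * n - (2 / n) * (m * n)) \<le> OT {0::real} (\<lambda>_ _. 0) 1 box_entropy ?a ?b"
    using ge unfolding u z sm mass by (simp only: mult_1 add_0_right)
  moreover have "2 * f * m + m * n - (2 / n) * (m * n) = 2 * m * ln (2 / n) - 2 * m + m * n"
    using m by (simp add: f_def)
  ultimately show "ereal (2 * m * ln (2 / n) - 2 * m + m * n) \<le> OT {0::real} (\<lambda>_ _. 0) 1 box_entropy ?a ?b"
    by metis
  \<comment> \<open>The density 2 / n gives this plan the mass 2 m, saturating the first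
    constraint.\<close>
  define \<pi> where "\<pi> = density (?a \<Otimes>\<^sub>M ?b) (\<lambda>_. ennreal (exp f))"
  have finP: "finite_measure (?a \<Otimes>\<^sub>M ?b)" by (intro finite_measure_pair Mplus_finite[OF M(1)] Mplus_finite[OF M(2)])
  have "emeasure \<pi> (space \<pi>) = ennreal (exp f) * emeasure (?a \<Otimes>\<^sub>M ?b) (space (?a \<Otimes>\<^sub>M ?b))"
    unfolding \<pi>_def by (subst emeasure_density) (auto simp: nn_integral_cmult_indicator)
  also have "\<dots> = ennreal (2 * m)"
    unfolding finite_measure.emeasure_eq_measure[OF finP] mP f(2) using m by (subst ennreal_mult[symmetric]) auto
  finally have e\<pi>: "emeasure \<pi> (space \<pi>) = ennreal (2 * m)" .
  then have fin\<pi>: "finite_measure \<pi>" by (intro finite_measureI) simp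
  have \<pi>: "\<pi> \<in> Mplus ({0} \<times> {0})"
    using fin\<pi> sets_restrict_borel_Times[of "{0::real}"] sets_pair_measure_cong[OF Mplus_sets[OF M(1)] Mplus_sets[OF M(2)]]
    by (simp add: Mplus_def \<pi>_def)
  note mg = point.Mplus_marginals[OF \<pi>]
  have pm: "distr \<pi> (restrict_space borel {0}) h = point_mass (2 * m)"
    if h: "h \<in> \<pi> \<rightarrow>\<^sub>M restrict_space borel {0}" and fin: "finite_measure (distr \<pi> (restrict_space borel {0}) h)" for h :: "real \<times> real \<Rightarrow> real"
  proof -
    have D: "distr \<pi> (restrict_space borel {0}) h \<in> Mplus {0}" using fin by (simp add: Mplus_def)
    have "h -` {0} \<inter> space \<pi> = space \<pi>" using measurable_space[OF h] by (auto simp: space_restrict_space)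
    then have "emeasure (distr \<pi> (restrict_space borel {0}) h) {0} = ennreal (2 * m)"
      using e\<pi> sets_restrict_point by (subst emeasure_distr[OF h]) auto
    then have "mass (distr \<pi> (restrict_space borel {0}) h) = 2 * m"
      using m by (simp add: measure_def space_restrict_space)
    then show ?thesis using Mplus_point[OF D] by simp
  qed
  have d0: "phi_divergence box_entropy (point_mass (c * a)) (point_mass a) = 0" if "0 \<le> a" "0 \<le> c" "c \<le> 2" for a c
  proof -
    have "phi_divergence box_entropy (density (point_mass a) (\<lambda>_. ennreal c)) (point_mass a) = (\<integral>\<^sup>+_. box_entropy c \<partial>point_mass a)"
      using that by (intro point.phi_divergence_density_self) (auto simp: point_mass_density intro: Mplus_finite[OF point_mass_Mplus])
    then show ?thesis using that by (simp add: point_mass_density box_entropy_def)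
  qed
  have d1: "phi_divergence box_entropy (distr \<pi> (restrict_space borel {0}) fst) ?a = 0"
    unfolding pm[OF mg(1,3)] using d0[of m 2] m by simp
  have d2: "phi_divergence box_entropy (distr \<pi> (restrict_space borel {0}) snd) ?b = 0"
    unfolding pm[OF mg(2,4)] using d0[of n "2 * m / n"] m by (simp add: field_simps)
  have "KL \<pi> (?a \<Otimes>\<^sub>M ?b) = ereal ((\<integral>z. exp f * f \<partial>(?a \<Otimes>\<^sub>M ?b)) - (\<integral>z. exp f \<partial>(?a \<Otimes>\<^sub>M ?b)) + mass (?a \<Otimes>\<^sub>M ?b))"
    unfolding \<pi>_def by (rule KL_density[OF finP, of "\<lambda>_. f" "\<bar>f\<bar>"]) auto
  also have "\<dots> = ereal (2 * m * f - 2 * m + m * n)" using m by (simp add: mP f(2))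
  finally have kl: "KL \<pi> (?a \<Otimes>\<^sub>M ?b) = ereal (2 * m * f - 2 * m + m * n)" .
  have "OT {0::real} (\<lambda>_ _. 0) 1 box_entropy ?a ?b \<le> ereal (LINT (x, y)|\<pi>. 0)
     + enn2ereal (phi_divergence box_entropy (distr \<pi> (restrict_space borel {0}) fst) ?a)
     + enn2ereal (phi_divergence box_entropy (distr \<pi> (restrict_space borel {0}) snd) ?b)
     + ereal 1 * KL \<pi> (?a \<Otimes>\<^sub>M ?b)"
    unfolding OT_def by (rule INF_lower[OF \<pi>])
  also have "\<dots> = ereal (2 * m * f - 2 * m + m * n)" unfolding d1 d2 kl by (simp add: zero_ennreal.rep_eq case_prod_unfold)
  finally show "OT {0::real} (\<lambda>_ _. 0) 1 box_entropy ?a ?b \<le> ereal (2 * m * ln (2 / n) - 2 * m + m * n)"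
    by (simp add: f_def)
qed

lemma not_jointly_convex_point:
  "\<not> jointly_convex_on_Mplus {0::real} (sinkhorn_divergence {0} (\<lambda>_ _. 0) 1 box_entropy)"
proof
  let ?S = "sinkhorn_divergence {0::real} (\<lambda>_ _. 0) 1 box_entropy"
  assume "jointly_convex_on_Mplus {0::real} ?S"
  note J = this[unfolded jointly_convex_on_Mplus_def, rule_format]
  have "?S (mix (1/2) (point_mass 2) (point_mass 6)) (mix (1/2) (point_mass 4) (point_mass 6)) \<le>
      ereal (1/2) * ?S (point_mass 2) (point_mass 4) + ereal (1 - 1/2) * ?S (point_mass 6) (point_mass 6)"
    by (rule J) (auto intro: point_mass_Mplus)
  moreover have "mix (1/2) (point_mass 2) (point_mass 6) = point_mass 4" "mix (1/2) (point_mass 4) (point_mass 6) = point_mass 5"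
    by (simp_all add: mix_point_mass)
  moreover have "?S (point_mass 4) (point_mass 5) = ereal (7 * ln 2 - 3 * ln 5 + 1)"
    by (simp add: sinkhorn_divergence_def OT_point ln_div field_simps)
  moreover have "?S (point_mass 2) (point_mass 4) = ereal 2"
    by (simp add: sinkhorn_divergence_def OT_point ln_div field_simps)
  moreover have "?S (point_mass 6) (point_mass 6) = 0"
    by (simp add: sinkhorn_divergence_def OT_point zero_ereal_def ln_div field_simps)
  \<comment> \<open>The right-hand side is half of 2 plus half of 0, and this 1 cancels the constant
    in the value at (4, 5).\<close>
  ultimately have "7 * ln (2::real) \<le> 3 * ln 5" by simp
  moreover have "ln ((5::real) ^ 3) < ln (2 ^ 7)" by (subst ln_less_cancel_iff) auto
  moreover have "ln ((5::real) ^ 3) = 3 * ln 5" "ln ((2::real) ^ 7) = 7 * ln 2"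
    by (simp_all only: ln_realpow zero_less_numeral of_nat_numeral)
  ultimately show False by linarith
qed

text \<open>Failure of joint convexity is existential, since it cannot hold in every setting: on an
  empty X the zero measure is the only one.\<close>

theorem theorem5:
  shows "(\<forall>(X :: 'a::metric_space set) C \<gamma> \<epsilon> \<phi>. sinkhorn_setting X C \<gamma> \<epsilon> \<phi> \<longrightarrow>
      (\<forall>\<alpha>\<in>Mplus X. \<forall>\<beta>\<in>Mplus X. 0 \<le> sinkhorn_divergence X C \<epsilon> \<phi> \<alpha> \<beta>) \<and>
      (\<forall>\<alpha>\<in>Mplus X. \<forall>\<beta>\<in>Mplus X. sinkhorn_divergence X C \<epsilon> \<phi> \<alpha> \<beta> = 0 \<longleftrightarrow> \<alpha> = \<beta>) \<and>
      (\<forall>\<beta>\<in>Mplus X. convex_on_Mplus X (\<lambda>\<alpha>. sinkhorn_divergence X C \<epsilon> \<phi> \<alpha> \<beta>)) \<and>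
      (\<forall>\<alpha>\<in>Mplus X. convex_on_Mplus X (\<lambda>\<beta>. sinkhorn_divergence X C \<epsilon> \<phi> \<alpha> \<beta>)))
    \<and> (\<exists>(Y :: real set) C \<gamma> \<epsilon> \<phi>. sinkhorn_setting Y C \<gamma> \<epsilon> \<phi> \<and>
      \<not> jointly_convex_on_Mplus Y (sinkhorn_divergence Y C \<epsilon> \<phi>))"
proof (intro conjI allI impI)
  fix X :: "'a set" and C \<gamma> \<epsilon> \<phi>
  assume "sinkhorn_setting X C \<gamma> \<epsilon> \<phi>"
  then interpret sinkhorn \<phi> X C \<epsilon>
    by unfold_locales (auto simp: sinkhorn_setting_def)
  show "\<forall>\<alpha>\<in>Mplus X. \<forall>\<beta>\<in>Mplus X. 0 \<le> sinkhorn_divergence X C \<epsilon> \<phi> \<alpha> \<beta>"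
    using sinkhorn_divergence_nonneg by blast
  show "\<forall>\<alpha>\<in>Mplus X. \<forall>\<beta>\<in>Mplus X. sinkhorn_divergence X C \<epsilon> \<phi> \<alpha> \<beta> = 0 \<longleftrightarrow> \<alpha> = \<beta>"
    using sinkhorn_divergence_definite by blast
  show "\<forall>\<beta>\<in>Mplus X. convex_on_Mplus X (\<lambda>\<alpha>. sinkhorn_divergence X C \<epsilon> \<phi> \<alpha> \<beta>)"
    using sinkhorn_divergence_convex_left by blast
  show "\<forall>\<alpha>\<in>Mplus X. convex_on_Mplus X (\<lambda>\<beta>. sinkhorn_divergence X C \<epsilon> \<phi> \<alpha> \<beta>)"
    using sinkhorn_divergence_convex_right by blast
next
  show "\<exists>(Y :: real set) C \<gamma> \<epsilon> \<phi>. sinkhorn_setting Y C \<gamma> \<epsilon> \<phi> \<and>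
      \<not> jointly_convex_on_Mplus Y (sinkhorn_divergence Y C \<epsilon> \<phi>)"
    using sinkhorn_setting_point not_jointly_convex_point by blast
qed

end
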